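(* Assume GRH for $F$. Let $1/d_F<B_1\leq B_2< B_3<1$ and suppose that for some $c>0$, \[ \tilde{V}_F(X,h)=\frac{1}{6}h X\Big(6\log X-\big(3+8\log 2\big)\Big)+O\big(hX^{1-c}\big) \] uniformly for $X^{1-B_3}\ll h\ll X^{1-B_1}$. Then for every $\varepsilon>0$, \[ V_F(X, \delta)=\frac{1}{6}\delta X^2\big(3\log X-4\log 2\big)+O_\varepsilon\big(\delta^{1-\varepsilon}X^{2-c/3}\big)+O_\varepsilon\Big(\delta^{1-\varepsilon}X^{2}\big(\delta X^{B_3}\big)^{-2/(3B_3)}\Big) \] uniformly for $X^{-B_2}\ll\delta\ll X^{-B_1}$.
   Context: Let $F(s)=\sum_{n\ge1}a_F(n)n^{-s}$ be a primitive element of the Selberg class: the series converges absolutely for $\mathrm{Re}(s)>1$; $F$ extends meromorphically to $\mathbb C$ with at most a pole at $s=1$, whose order is denoted $m_F\ge0$, and $(s-1)^{m_F}F(s)$ is entire of finite order; $F$ satisfies $\Phi(s)=\varepsilon_F\overline{\Phi}(1-s)$ where $\Phi(s)=Q^s\prod_{j=1}^r\Gamma(\lambda_js+\mu_j)F(s)$ with $Q>0$, $\lambda_j>0$, $\mathrm{Re}(\mu_j)\ge0$, $|\varepsilon_F|=1$, and $\overline{\Phi}(s)=\overline{\Phi(\bar s)}$; $a_F(n)\ll_\varepsilon n^\varepsilon$; and $F(s)=\prod_p\exp\big(\sum_{l\ge1}b_F(p^l)p^{-ls}\big)$ with $b_F(p^l)\ll p^{l\theta}$ for some $\theta<1/2$.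 The degree is $d_F=2\sum_{j}\lambda_j$. Define $\Lambda_F(n)$ by $\frac{F'}{F}(s)=-\sum_{n\ge1}\Lambda_F(n)n^{-s}$ ($\mathrm{Re}(s)>1$) and $\psi_F(x)=\sum_{n\le x}\Lambda_F(n)$. GRH for $F$ means all nontrivial zeros of $F$ are $\rho_F=\tfrac12+i\gamma_F$ with $\gamma_F$ real. Define $V_F(X,\delta)=\int_1^X|\psi_F(x+\delta x)-\psi_F(x)-m_F\delta x|^2dx$, $\tilde V_F(X,h)=\int_1^X|\psi_F(x+h)-\psi_F(x)-m_Fh|^2dx$. "Uniformly for $a\ll y\ll b$" means: for any fixed positive constants $k_1,k_2$, the estimate holds for all $y$ with $k_1a\le y\le k_2b$ (as the main parameter tends to infinity), with implied constants independent of the variables. *)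

theory Defs
  imports "HOL-Analysis.Analysis" "HOL-Computational_Algebra.Primes"
begin

(* Dirichlet series  F(s) = sum_{n>=1} a(n) n^{-s}  (the n = 0 term is 0 since 0 powr s = 0) *)
definition dser :: "(nat \<Rightarrow> complex) \<Rightarrow> complex \<Rightarrow> complex" where
  "dser a s = (\<Sum>n. a n / of_nat n powr s)"

(* completed function  Phi(s) = Q^s prod_j Gamma(lam_j s + mu_j) F(s),
   with F continued meromorphically as F(s) = G(s)/(s-1)^m *)
definition Phi_fun :: "nat \<Rightarrow> (complex \<Rightarrow> complex) \<Rightarrow> real \<Rightarrow> nat \<Rightarrow> (nat \<Rightarrow> real)
     \<Rightarrow> (nat \<Rightarrow> complex) \<Rightarrow> complex \<Rightarrow> complex" where
  "Phi_fun m G Q r lam mu s =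
     of_real Q powr s * (\<Prod>j<r. Gamma (of_real (lam j) * s + mu j)) * (G s / (s - 1) ^ m)"

definition no_gamma_pole :: "nat \<Rightarrow> (nat \<Rightarrow> real) \<Rightarrow> (nat \<Rightarrow> complex) \<Rightarrow> complex \<Rightarrow> bool" where
  "no_gamma_pole r lam mu s \<longleftrightarrow> (\<forall>j<r. of_real (lam j) * s + mu j \<notin> \<int>\<^sub>\<le>\<^sub>0)"

(* analytic data of F: continuation with a pole of order exactly m at s = 1 (G = (s-1)^m F entire,
   finite order) and the functional equation  Phi(s) = eps * conj(Phi(conj(1 - s))) *)
definition selberg_data :: "(nat \<Rightarrow> complex) \<Rightarrow> nat \<Rightarrow> (complex \<Rightarrow> complex) \<Rightarrow> real \<Rightarrow> nat
     \<Rightarrow> (nat \<Rightarrow> real) \<Rightarrow> (nat \<Rightarrow> complex) \<Rightarrow> complex \<Rightarrow> bool" where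
  "selberg_data a m G Q r lam mu eps \<longleftrightarrow>
     G holomorphic_on UNIV \<and>
     (\<forall>s. Re s > 1 \<longrightarrow> G s = (s - 1) ^ m * dser a s) \<and>
     (m > 0 \<longrightarrow> G 1 \<noteq> 0) \<and>
     (\<exists>A B. \<forall>s. norm (G s) \<le> B * exp (norm s powr A)) \<and>
     Q > 0 \<and> (\<forall>j<r. lam j > 0 \<and> Re (mu j) \<ge> 0) \<and> norm eps = 1 \<and>
     (\<forall>s. s \<noteq> 0 \<and> s \<noteq> 1 \<and> no_gamma_pole r lam mu s \<and> no_gamma_pole r lam mu (cnj (1 - s)) \<longrightarrow>
        Phi_fun m G Q r lam mu s = eps * cnj (Phi_fun m G Q r lam mu (cnj (1 - s))))"

definition selberg_class :: "(nat \<Rightarrow> complex) \<Rightarrow> bool" where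
  "selberg_class a \<longleftrightarrow>
     (\<forall>s. Re s > 1 \<longrightarrow> summable (\<lambda>n. norm (a n / of_nat n powr s))) \<and>
     (\<exists>m G Q r lam mu eps. selberg_data a m G Q r lam mu eps) \<and>
     (\<forall>e>0. \<exists>C. \<forall>n\<ge>1. norm (a n) \<le> C * real n powr e) \<and>
     (\<exists>b :: nat \<Rightarrow> complex. \<exists>\<theta> < 1/2.
        (\<exists>C. \<forall>p l. prime p \<and> l \<ge> 1 \<longrightarrow> norm (b (p ^ l)) \<le> C * real p powr (real l * \<theta>)) \<and>
        (\<forall>s. Re s > 1 \<longrightarrow>
           (\<lambda>p. if prime p then exp (\<Sum>l. b (p ^ Suc l) / of_nat (p ^ Suc l) powr s) else 1)
             has_prod dser a s))"

definition dconv :: "(nat \<Rightarrow> complex) \<Rightarrow> (nat \<Rightarrow> complex) \<Rightarrow> nat \<Rightarrow> complex" where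
  "dconv a1 a2 n = (\<Sum>d | d dvd n. a1 d * a2 (n div d))"

definition one_coeff :: "nat \<Rightarrow> complex" where
  "one_coeff n = (if n = 1 then 1 else 0)"

definition selberg_primitive :: "(nat \<Rightarrow> complex) \<Rightarrow> bool" where
  "selberg_primitive a \<longleftrightarrow> selberg_class a \<and> \<not> (\<forall>n\<ge>1. a n = one_coeff n) \<and>
     (\<forall>a1 a2. selberg_class a1 \<and> selberg_class a2 \<and> (\<forall>n\<ge>1. a n = dconv a1 a2 n) \<longrightarrow>
        (\<forall>n\<ge>1. a1 n = one_coeff n) \<or> (\<forall>n\<ge>1. a2 n = one_coeff n))"

(* GRH: every nontrivial zero (zero of F = G/(s-1)^m, not a trivial zero, i.e. not at a pole of
   a gamma factor) has real part 1/2.  Zeros of F coincide with zeros of G since G 1 <> 0 if m > 0. *)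
definition GRH :: "(complex \<Rightarrow> complex) \<Rightarrow> nat \<Rightarrow> (nat \<Rightarrow> real) \<Rightarrow> (nat \<Rightarrow> complex) \<Rightarrow> bool" where
  "GRH G r lam mu \<longleftrightarrow> (\<forall>s. G s = 0 \<and> no_gamma_pole r lam mu s \<longrightarrow> Re s = 1/2)"

definition psiF :: "(nat \<Rightarrow> complex) \<Rightarrow> real \<Rightarrow> complex" where
  "psiF Lam x = (\<Sum>n\<in>{1..nat \<lfloor>x\<rfloor>}. Lam n)"

definition VF :: "(nat \<Rightarrow> complex) \<Rightarrow> nat \<Rightarrow> real \<Rightarrow> real \<Rightarrow> real" where
  "VF Lam m X \<delta> = integral {1..X}
     (\<lambda>x. (cmod (psiF Lam (x + \<delta> * x) - psiF Lam x - of_nat m * of_real (\<delta> * x)))\<^sup>2)"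

definition VtF :: "(nat \<Rightarrow> complex) \<Rightarrow> nat \<Rightarrow> real \<Rightarrow> real \<Rightarrow> real" where
  "VtF Lam m X h = integral {1..X}
     (\<lambda>x. (cmod (psiF Lam (x + h) - psiF Lam x - of_nat m * of_real h))\<^sup>2)"

definition unif_O :: "(real \<Rightarrow> real \<Rightarrow> real) \<Rightarrow> (real \<Rightarrow> real \<Rightarrow> real) \<Rightarrow> (real \<Rightarrow> real)
     \<Rightarrow> (real \<Rightarrow> real) \<Rightarrow> bool" where
  "unif_O E B lo hi \<longleftrightarrow> (\<forall>k1>0. \<forall>k2>0. \<exists>C X0. \<forall>X\<ge>X0. \<forall>y.
      k1 * lo X \<le> y \<and> y \<le> k2 * hi X \<longrightarrow> \<bar>E X y\<bar> \<le> C * B X y)"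

end

theory Submission
  imports Defs "HOL-Complex_Analysis.Complex_Analysis" "HOL-Probability.Probability" "HOL-Real_Asymp.Real_Asymp"
begin

text \<open>Write \<open>g x = psi x - m x\<close>. Under GRH the Mellin transform of \<open>g\<close> is \<open>(- G'/G - m)/s\<close>,
  holomorphic for \<open>Re s > 1/2\<close> and of size \<open>log (|t| + 3) / |s|\<close> there, so Plancherel on a line close to the
  critical one bounds the mean square of \<open>g (x + \<kappa> x) - g x\<close> by \<open>\<kappa> X\<^sup>2\<close> up to small powers, for every \<open>\<kappa> \<le> 1\<close>.

  For the asymptotic formula, insert a point \<open>x + v\<close> between \<open>x\<close> and \<open>x + \<delta> x\<close> and average over \<open>0 \<le> v \<le> V = \<eta> \<delta> X\<close>.
  Replacing \<open>x\<close> by \<open>x + v\<close> costs a relative error \<open>sqrt \<eta>\<close> by the mean square bound. In the averaged integral the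
  coordinates \<open>u = x + v\<close>, \<open>w = \<delta> x - v\<close> turn every slice of constant \<open>w\<close> into a difference of two values of the
  variance with fixed shift \<open>w\<close>; the hypothesis evaluates it with relative error \<open>X powr (-c) / \<eta>\<close>. It applies only for
  \<open>u \<ge> Y = \<delta> powr (-1/B3)\<close>, the range below being covered by the mean square bound. The choice
  \<open>\<eta> = max (X powr (-2c/3)) ((Y/X) powr (4/3))\<close> gives both error terms.\<close>

section \<open>Gamma quotients and complex-analytic growth lemmas\<close>

text \<open>The hypothesis treats a shift that is the same for all points, and its error term cannot
  be differentiated in \<open>X\<close>: over a range of length \<open>H\<close> it fixes the
  variance only up to the relative error \<open>X powr (1 - c) / H\<close>. Sliding the left end
  point to \<open>x + v\<close> while the right one stays at \<open>x + \<delta> * x\<close> makes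
  one length \<open>w\<close> occur for a whole range of \<open>u\<close>, of length about
  \<open>V / \<delta> = \<eta> * X\<close>; this is the origin of
  \<open>X powr (-c) / \<eta>\<close>. A discarded piece whose mean square is smaller by a factor
  \<open>\<eta>\<close> changes a square by the factor \<open>sqrt \<eta>\<close>, through the cross
  term. The two costs balance at \<open>\<eta> = X powr (-2 * c / 3)\<close>, whence
  \<open>c / 3\<close> in the result. No sum over zeros occurs: GRH enters only as the absence of
  zeros of \<open>G\<close> for \<open>Re s > 1/2\<close>. Every loss is a small power of
  \<open>X\<close>, and \<open>\<delta> \<le> k2 * X powr (-B1)\<close> converts it into a small
  power of \<open>1 / \<delta>\<close>.\<close>

lemma norm_Gamma_quotient_mono:
  assumes "Re z > 0" "w \<ge> 0"
  shows "norm (Gamma z) * Gamma (Re z + w) \<le> norm (Gamma (z + of_real w)) * Gamma (Re z)"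
proof (rule LIMSEQ_le)
  define x y where "x = Re z" and "y = Im z"
  have z: "z = Complex x y" by (simp add: x_def y_def)
  show "(\<lambda>n. norm (Gamma_series z n) * Gamma_series (Re z + w) n) \<longlonglongrightarrow> norm (Gamma z) * Gamma (Re z + w)"
    by (intro tendsto_intros)
  show "(\<lambda>n. norm (Gamma_series (z + of_real w) n) * Gamma_series (Re z) n) \<longlonglongrightarrow>
     norm (Gamma (z + of_real w)) * Gamma (Re z)"
    by (intro tendsto_intros)
  \<comment> \<open>Factor by factor: \<open>norm (Gamma z) / Gamma (Re z)\<close> is a limit of
    products of \<open>t / sqrt (t^2 + y^2)\<close> with \<open>t = x + k\<close>, and each such
    factor increases with \<open>t\<close>.\<close>
  have step: "norm (z + of_real w + of_nat k) * (x + of_nat k) \<le> norm (z + of_nat k) * (x + w + of_nat k)" for k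
  proof -
    define t where "t = x + real k"
    have t: "t > 0" using assms by (simp add: t_def x_def)
    have "(t + w)\<^sup>2 * t\<^sup>2 + y\<^sup>2 * t\<^sup>2 \<le> t\<^sup>2 * (t + w)\<^sup>2 + y\<^sup>2 * (t + w)\<^sup>2"
      using t assms by (intro add_mono mult_left_mono power_mono) auto
    hence "sqrt (((t + w)\<^sup>2 + y\<^sup>2) * t\<^sup>2) \<le> sqrt ((t\<^sup>2 + y\<^sup>2) * (t + w)\<^sup>2)"
      by (intro real_sqrt_le_mono) (simp add: algebra_simps)
    hence "sqrt ((t + w)\<^sup>2 + y\<^sup>2) * t \<le> sqrt (t\<^sup>2 + y\<^sup>2) * (t + w)"
      using t assms by (simp add: real_sqrt_mult)
    thus ?thesis by (simp add: z t_def cmod_def add_ac)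
  qed
  have pos: "pochhammer x n > 0" for n using assms by (intro pochhammer_pos) (auto simp: x_def)
  have posw: "pochhammer (x + w) n > 0" for n using assms by (intro pochhammer_pos) (auto simp: x_def)
  have nz: "norm (pochhammer z n) > 0" for n
    using assms(1) by (auto simp: pochhammer_eq_0_iff)
  have nzw: "norm (pochhammer (z + of_real w) n) > 0" for n
    using assms by (auto simp: pochhammer_eq_0_iff dest!: arg_cong[where f = Re])
  have P: "norm (pochhammer (z + of_real w) n) * pochhammer x n \<le> norm (pochhammer z n) * pochhammer (x + w) n" for n
  proof -
    have "norm (pochhammer (z + of_real w) n) * pochhammer x n =
        (\<Prod>k<n. norm (z + of_real w + of_nat k) * (x + of_nat k))"
      by (simp add: pochhammer_prod prod.distrib prod_norm[symmetric] atLeast0LessThan)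
    also have "\<dots> \<le> (\<Prod>k<n. norm (z + of_nat k) * (x + w + of_nat k))"
      using assms by (intro prod_mono conjI step) (auto simp: x_def)
    also have "\<dots> = norm (pochhammer z n) * pochhammer (x + w) n"
      by (simp add: pochhammer_prod prod.distrib prod_norm[symmetric] atLeast0LessThan)
    finally show ?thesis .
  qed
  show "\<exists>N. \<forall>n\<ge>N. norm (Gamma_series z n) * Gamma_series (Re z + w) n
      \<le> norm (Gamma_series (z + of_real w) n) * Gamma_series (Re z) n"
  proof (intro exI allI impI)
    fix n :: nat
    define L where "L = ln (real n)"
    have "norm (Gamma_series z n) * Gamma_series (Re z + w) n =
       (fact n)\<^sup>2 * exp ((2 * x + w) * L) / (norm (pochhammer z (n+1)) * pochhammer (x + w) (n+1))"
      by (simp add: Gamma_series_def norm_mult norm_divide norm_power L_def x_def power2_eq_square exp_add[symmetric] algebra_simps)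
    also have "\<dots> \<le> (fact n)\<^sup>2 * exp ((2 * x + w) * L) / (norm (pochhammer (z + of_real w) (n+1)) * pochhammer x (n+1))"
      by (intro divide_left_mono P mult_nonneg_nonneg mult_pos_pos nz nzw pos posw) auto
    also have "\<dots> = norm (Gamma_series (z + of_real w) n) * Gamma_series (Re z) n"
      by (simp add: Gamma_series_def norm_mult norm_divide norm_power L_def x_def power2_eq_square exp_add[symmetric] algebra_simps)
    finally show "norm (Gamma_series z n) * Gamma_series (Re z + w) n
      \<le> norm (Gamma_series (z + of_real w) n) * Gamma_series (Re z) n" .
  qed
qed

text \<open>A substitute for Stirling's formula. The shift is rounded up to an integer
  \<open>N\<close>, where the functional equation of Gamma gives a Pochhammer product and so a
  polynomial factor; the surplus \<open>N - w\<close> is removed by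
  \<open>norm_Gamma_quotient_mono\<close>. That lemma is applied at \<open>z + w\<close>, so
  \<open>Re z\<close> itself may be negative.\<close>

lemma norm_Gamma_shift_le:
  fixes x w :: real
  assumes "x + w > 0"
  obtains C N where "C \<ge> 0" "\<And>z. Re z = x \<Longrightarrow> z \<notin> \<int>\<^sub>\<le>\<^sub>0 \<Longrightarrow>
     norm (Gamma (z + of_real w)) \<le> C * (norm z + real N) ^ N * norm (Gamma z)"
proof -
  define N where "N = nat \<lceil>w\<rceil>"
  have N: "real N \<ge> w" unfolding N_def by linarith
  have pos: "Gamma (x + real N) > 0" "Gamma (x + w) > 0" using assms N by (auto intro!: Gamma_real_pos)
  show ?thesis
  proof (rule that[of "Gamma (x + w) / Gamma (x + real N)" N])
    show "Gamma (x + w) / Gamma (x + real N) \<ge> 0" using pos by simp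
    fix z assume z: "Re z = x" "z \<notin> \<int>\<^sub>\<le>\<^sub>0"
    have "norm (Gamma (z + of_real w)) * Gamma (Re (z + of_real w) + (real N - w))
        \<le> norm (Gamma (z + of_real w + of_real (real N - w))) * Gamma (Re (z + of_real w))"
      by (rule norm_Gamma_quotient_mono) (use assms z N in auto)
    hence 1: "norm (Gamma (z + of_real w)) * Gamma (x + real N) \<le> norm (Gamma (z + of_nat N)) * Gamma (x + w)"
      using z by simp
    have "Gamma (z + of_nat N) = pochhammer z N * Gamma z"
      using z by (simp add: pochhammer_Gamma Gamma_eq_zero_iff)
    moreover have "norm (pochhammer z N) \<le> (norm z + real N) ^ N"
    proof -
      have "norm (pochhammer z N) = (\<Prod>k<N. norm (z + of_nat k))"
        by (simp add: pochhammer_prod prod_norm[symmetric] atLeast0LessThan)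
      also have "\<dots> \<le> (\<Prod>k<N. norm z + real N)"
      proof (intro prod_mono conjI)
        fix k assume "k \<in> {..<N}"
        have "norm (z + of_nat k) \<le> norm z + norm (of_nat k :: complex)" by (rule norm_triangle_ineq)
        also have "\<dots> \<le> norm z + real N" using \<open>k \<in> {..<N}\<close> by simp
        finally show "norm (z + of_nat k) \<le> norm z + real N" .
      qed auto
      finally show ?thesis by simp
    qed
    ultimately have "norm (Gamma (z + of_nat N)) \<le> (norm z + real N) ^ N * norm (Gamma z)"
      by (auto simp: norm_mult intro!: mult_right_mono)
    hence "norm (Gamma (z + of_nat N)) * Gamma (x + w) \<le> (norm z + real N) ^ N * norm (Gamma z) * Gamma (x + w)"
      using pos by (intro mult_right_mono) auto
    with 1 have "norm (Gamma (z + of_real w)) * Gamma (x + real N) \<le> (norm z + real N) ^ N * norm (Gamma z) * Gamma (x + w)"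
      by linarith
    thus "norm (Gamma (z + of_real w)) \<le> Gamma (x + w) / Gamma (x + real N) * (norm z + real N) ^ N * norm (Gamma z)"
      using pos by (simp add: field_simps)
  qed
qed

section \<open>Phragmen-Lindelof and Borel-Caratheodory\<close>

text \<open>The barrier \<open>cos (\<kappa> * (z - m))\<close> is centred in the strip, and
  \<open>\<kappa> = 3 / (b - a)\<close> keeps the real part of its argument within
  \<open>3/2 < pi/2\<close>. Hence its real part is at least a positive constant times
  \<open>exp (\<kappa> * |Im z|)\<close>, so \<open>exp (- e * bar z)\<close> has norm at most 1 and
  beats growth of any finite order. In the end \<open>e\<close> tends to 0.\<close>

lemma Phragmen_Lindelof_strip:
  fixes f :: "complex \<Rightarrow> complex"
  assumes ab: "a < b" and f: "open S" "f holomorphic_on S" "{s. a \<le> Re s \<and> Re s \<le> b} \<subseteq> S"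
    and growth: "\<And>s. a \<le> Re s \<Longrightarrow> Re s \<le> b \<Longrightarrow> norm (f s) \<le> B * exp (norm s powr A)"
    and bd: "\<And>s. Re s = a \<or> Re s = b \<Longrightarrow> norm (f s) \<le> M"
    and M: "M > 0" and s: "a \<le> Re s" "Re s \<le> b"
  shows "norm (f s) \<le> M"
proof -
  define \<kappa> where "\<kappa> = 3 / (b - a)"
  define m where "m = (a + b) / 2"
  define d where "d = cos (3/2 :: real)"
  define bar where "bar = (\<lambda>z::complex. cos (of_real \<kappa> * (z - of_real m)))"
  have \<kappa>: "\<kappa> > 0" using ab by (simp add: \<kappa>_def)
  have d: "d > 0" unfolding d_def using pi_gt3 by (intro cos_gt_zero) auto
  have bar_Re: "Re (bar z) \<ge> d * exp (\<kappa> * \<bar>Im z\<bar>) / 2" if z: "a \<le> Re z" "Re z \<le> b" for z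
  proof -
    define t where "t = \<kappa> * Im z"
    have "\<bar>Re z - m\<bar> \<le> (b - a) / 2" using z unfolding m_def by (simp add: abs_le_iff field_simps)
    hence "\<kappa> * \<bar>Re z - m\<bar> \<le> \<kappa> * ((b - a) / 2)" using \<kappa> by (intro mult_left_mono) auto
    also have "\<dots> = 3/2" using ab by (simp add: \<kappa>_def field_simps)
    finally have "\<bar>\<kappa> * (Re z - m)\<bar> \<le> 3/2" using \<kappa> by (simp add: abs_mult)
    hence "cos (3/2) \<le> cos \<bar>\<kappa> * (Re z - m)\<bar>" using pi_gt3 by (intro cos_monotone_0_pi_le) auto
    hence c: "d \<le> cos (\<kappa> * (Re z - m))" by (simp add: d_def)
    have e: "exp \<bar>t\<bar> \<le> exp t + exp (- t)" by (cases "t \<ge> 0") (auto intro: order_trans[OF _ le_add_same_cancel1[THEN iffD2]])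
    have "d * exp \<bar>t\<bar> \<le> cos (\<kappa> * (Re z - m)) * (exp t + exp (-t))"
      using c e d by (intro mult_mono) auto
    thus ?thesis using \<kappa> by (simp add: bar_def Re_cos t_def abs_mult)
  qed
  have main: "norm (f s * exp (- of_real e * bar s)) \<le> M" if e: "e > 0" for e
  proof -
    define K where "K = \<bar>a\<bar> + \<bar>b\<bar> + 1"
    \<comment> \<open>A positive exponent makes \<open>powr\<close> monotone in its base.\<close>
    define A' where "A' = \<bar>A\<bar> + 1"
    have A': "A' > 0" by (simp add: A'_def)
    have "((\<lambda>T. \<bar>B\<bar> * exp ((K + T) powr A' - e * (d * exp (\<kappa> * T) / 2))) \<longlongrightarrow> 0) at_top"
      using e d \<kappa> A' by real_asymp
    hence "eventually (\<lambda>T. \<bar>B\<bar> * exp ((K + T) powr A' - e * (d * exp (\<kappa> * T) / 2)) < M) at_top"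
      using M by (rule order_tendstoD)
    moreover have "eventually (\<lambda>T. T > \<bar>Im s\<bar> + 1) at_top" by (rule eventually_gt_at_top)
    ultimately obtain T where T: "\<bar>B\<bar> * exp ((K + T) powr A' - e * (d * exp (\<kappa> * T) / 2)) < M" "T > \<bar>Im s\<bar> + 1"
      using eventually_conj eventually_happens' trivial_limit_at_top_linorder by (metis (mono_tags, lifting))
    define R where "R = cbox (Complex a (-T)) (Complex b T)"
    have R: "z \<in> R \<longleftrightarrow> a \<le> Re z \<and> Re z \<le> b \<and> \<bar>Im z\<bar> \<le> T" for z
      by (auto simp: R_def in_cbox_complex_iff)
    have RS: "R \<subseteq> S" using f(3) R by auto
    have hol: "(\<lambda>z. f z * exp (- of_real e * bar z)) holomorphic_on R" unfolding bar_def
      by (intro holomorphic_intros holomorphic_on_subset[OF f(2) RS])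
    show ?thesis
    proof (rule maximum_modulus_frontier[where S = R and f = "\<lambda>z. f z * exp (- of_real e * bar z)"])
      show "(\<lambda>z. f z * exp (- of_real e * bar z)) holomorphic_on interior R"
        using hol interior_subset holomorphic_on_subset by blast
      show "continuous_on (closure R) (\<lambda>z. f z * exp (- of_real e * bar z))"
        using hol by (simp add: R_def holomorphic_on_imp_continuous_on)
      show "bounded R" by (simp add: R_def)
      show "s \<in> R" using s T by (simp add: R)
      fix z assume "z \<in> frontier R"
      hence z: "z \<in> R" and z2: "Re z = a \<or> Re z = b \<or> \<bar>Im z\<bar> = T"
        by (auto simp: R_def frontier_cbox in_cbox_complex_iff in_box_complex_iff)
      have zz: "a \<le> Re z" "Re z \<le> b" "\<bar>Im z\<bar> \<le> T" using z R by auto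
      have n: "norm (exp (- of_real e * bar z)) \<le> exp (- e * (d * exp (\<kappa> * \<bar>Im z\<bar>) / 2))"
        using mult_left_mono[OF bar_Re[OF zz(1,2)], of e] e by simp
      show "norm (f z * exp (- of_real e * bar z)) \<le> M"
      proof (cases "\<bar>Im z\<bar> = T")
        case False
        hence 1: "norm (f z) \<le> M" using z2 bd by auto
        have "exp (- e * (d * exp (\<kappa> * \<bar>Im z\<bar>) / 2)) \<le> 1" using e d by simp
        hence "norm (exp (- of_real e * bar z)) \<le> 1" using n by linarith
        hence "norm (f z) * norm (exp (- of_real e * bar z)) \<le> M * 1"
          using 1 M by (intro mult_mono) auto
        thus ?thesis by (simp add: norm_mult)
      next
        case True
        have nz: "norm z \<ge> 1" using True T(2) abs_Im_le_cmod[of z] by linarith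
        have "norm z \<le> \<bar>Re z\<bar> + \<bar>Im z\<bar>" by (rule cmod_le)
        also have "\<dots> \<le> K + T" using zz True by (auto simp: K_def)
        finally have nz2: "norm z \<le> K + T" .
        have "norm z powr A \<le> norm z powr A'" using nz by (intro powr_mono) (auto simp: A'_def)
        also have "\<dots> \<le> (K + T) powr A'" using nz nz2 A' by (intro powr_mono2) auto
        finally have p: "norm z powr A \<le> (K + T) powr A'" .
        have "norm (f z) \<le> B * exp (norm z powr A)" using growth zz by auto
        also have "\<dots> \<le> \<bar>B\<bar> * exp ((K + T) powr A')" using p by (intro mult_mono) auto
        finally have "norm (f z) * norm (exp (- of_real e * bar z)) \<le>
            (\<bar>B\<bar> * exp ((K + T) powr A')) * exp (- e * (d * exp (\<kappa> * \<bar>Im z\<bar>) / 2))"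
          using n by (intro mult_mono) auto
        also have "\<dots> \<le> M" using T(1) unfolding True mult.assoc exp_add[symmetric] by simp
        finally show ?thesis by (simp add: norm_mult)
      qed
    qed
  qed
  have "((\<lambda>e. norm (f s * exp (- of_real e * bar s))) \<longlongrightarrow> norm (f s * exp (- of_real 0 * bar s))) (at_right 0)"
    by (intro tendsto_intros)
  moreover have "eventually (\<lambda>e. norm (f s * exp (- of_real e * bar s)) \<le> M) (at_right 0)"
    using main by (auto simp: eventually_at_filter)
  ultimately have "norm (f s * exp (- of_real 0 * bar s)) \<le> M"
    by (intro tendsto_upperbound) auto
  thus ?thesis by simp
qed

text \<open>The Moebius map \<open>h / (2 * M - h)\<close> takes the half-plane
  \<open>Re h < M\<close> into the unit disc and fixes 0, so Schwarz's lemma bounds it by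
  \<open>r / R\<close>; solving back for \<open>h\<close> gives the claim.\<close>

lemma Borel_Caratheodory:
  assumes f: "f holomorphic_on ball c R" and M: "M > 0"
    and Re: "\<And>z. z \<in> ball c R \<Longrightarrow> Re (f z - f c) < M"
    and z: "norm (z - c) \<le> r" and r: "r < R"
  shows "norm (f z - f c) \<le> 2 * M * r / (R - r)"
proof -
  have R: "R > 0" "r \<ge> 0" using z r norm_ge_zero[of "z - c"] by linarith+
  define h where "h = (\<lambda>w. f (c + of_real R * w) - f c)"
  define \<phi> where "\<phi> = (\<lambda>w. h w / (of_real (2 * M) - h w))"
  have inb: "c + of_real R * w \<in> ball c R" if "norm w < 1" for w
    using that R by (simp add: dist_norm norm_mult)
  have Reh: "Re (h w) < M" if "norm w < 1" for w using Re[OF inb[OF that]] by (simp add: h_def)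
  have nz: "of_real (2 * M) - h w \<noteq> 0" if "norm w < 1" for w
    using Reh[OF that] M by (auto simp: complex_eq_iff)
  have hh: "h holomorphic_on ball 0 1" unfolding h_def
    by (intro holomorphic_intros holomorphic_on_compose_gen[OF _ f, unfolded o_def]) (use inb in auto)
  have "norm (\<phi> ((z - c) / of_real R)) \<le> norm ((z - c) / of_real R)"
  proof (rule Schwarz_Lemma(1))
    show "\<phi> holomorphic_on ball 0 1" unfolding \<phi>_def
      by (intro holomorphic_intros hh) (use nz in auto)
    show "\<phi> 0 = 0" by (simp add: \<phi>_def h_def)
    show "norm ((z - c) / of_real R) < 1" using z r R by (simp add: norm_divide)
    fix w :: complex assume w: "norm w < 1"
    have "(2 * M - Re (h w))\<^sup>2 - (Re (h w))\<^sup>2 = 4 * M * (M - Re (h w))"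
      by (simp add: power2_eq_square algebra_simps)
    also have "\<dots> > 0" using M Reh[OF w] by simp
    finally have "norm (h w) < norm (of_real (2 * M) - h w)" by (simp add: cmod_def)
    thus "norm (\<phi> w) < 1" using nz[OF w] by (simp add: \<phi>_def norm_divide)
  qed
  hence 1: "norm (\<phi> ((z - c) / of_real R)) \<le> r / R" using z R by (simp add: norm_divide field_simps)
  have w1: "norm ((z - c) / of_real R) < 1" using z r R by (simp add: norm_divide)
  have hz: "h ((z - c) / of_real R) = f z - f c" using R by (simp add: h_def)
  have "norm (f z - f c) = norm (\<phi> ((z - c) / of_real R)) * norm (of_real (2 * M) - (f z - f c))"
    using nz[OF w1] hz by (simp add: \<phi>_def norm_divide)
  also have "\<dots> \<le> r / R * (2 * M + norm (f z - f c))"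
    using M R by (intro mult_mono 1 order_trans[OF norm_triangle_ineq4]) auto
  finally have "norm (f z - f c) * R \<le> r * (2 * M + norm (f z - f c))" using R by (simp add: field_simps)
  thus ?thesis using r by (simp add: field_simps)
qed

section \<open>Growth of the logarithmic derivative under GRH\<close>

lemma norm_dirichlet_term:
  "norm (a n / of_nat n powr s) = norm (a n :: complex) / real n powr Re s"
  by (simp add: norm_divide norm_powr_real_powr)

lemma summable_dirichlet_norm:
  assumes "\<forall>s. Re s > 1 \<longrightarrow> summable (\<lambda>n. norm (a n / of_nat n powr s))" "x > 1"
  shows "summable (\<lambda>n. norm (a n :: complex) / real n powr x)"
proof -
  have "summable (\<lambda>n. norm (a n / of_nat n powr complex_of_real x))" using assms by auto
  thus ?thesis unfolding norm_dirichlet_term by simp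
qed

lemma dirichlet_coeff_le:
  assumes "x \<le> y"
  shows "norm (a n :: complex) / real n powr y \<le> norm (a n) / real n powr x"
proof (cases "n = 0")
  case False
  thus ?thesis using assms by (intro divide_left_mono powr_mono mult_pos_pos) auto
qed auto

lemma norm_dser_le:
  assumes S: "\<forall>s. Re s > 1 \<longrightarrow> summable (\<lambda>n. norm (a n / of_nat n powr s))" and s: "Re s \<ge> 2"
  shows "norm (dser a s) \<le> (\<Sum>n. norm (a n) / real n powr 2)"
proof -
  have "norm (dser a s) \<le> (\<Sum>n. norm (a n / of_nat n powr s))"
    unfolding dser_def using S s by (intro summable_norm) auto
  also have "\<dots> \<le> (\<Sum>n. norm (a n) / real n powr 2)"
    unfolding norm_dirichlet_term using S s
    by (intro suminf_le dirichlet_coeff_le summable_dirichlet_norm) auto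
  finally show ?thesis .
qed

text \<open>For large \<open>K\<close> the first nonzero coefficient dominates the series.\<close>
lemma dser_lower_bound:
  assumes S: "\<forall>s. Re s > 1 \<longrightarrow> summable (\<lambda>n. norm (a n / of_nat n powr s))"
    and nz: "dser a s1 \<noteq> 0"
  obtains K c0 where "K \<ge> (4::real)" "c0 > 0" "\<And>t. norm (dser a (Complex K t)) \<ge> c0"
proof -
  have "\<exists>n\<ge>1. a n \<noteq> 0"
  proof (rule ccontr)
    assume "\<not> ?thesis"
    hence "a n / of_nat n powr s1 = 0" for n by (cases "n = 0") auto
    hence "dser a s1 = (\<Sum>n. 0)" unfolding dser_def by presburger
    thus False using nz by simp
  qed
  hence ex: "\<exists>n. n \<ge> 1 \<and> a n \<noteq> 0" by blast
  define n0 where "n0 = (LEAST n. n \<ge> 1 \<and> a n \<noteq> 0)"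
  have n0: "n0 \<ge> 1" "a n0 \<noteq> 0" using LeastI_ex[OF ex] by (auto simp: n0_def)
  have less: "a n = 0" if "n \<ge> 1" "n < n0" for n using not_less_Least[of n] that unfolding n0_def by blast
  define A where "A = (\<Sum>n. norm (a n) / real n powr 2)"
  have sum2: "summable (\<lambda>n. norm (a n) / real n powr 2)" by (rule summable_dirichlet_norm[OF S]) auto
  \<comment> \<open>Bounding \<open>n powr (K - 2)\<close> below by its value at
    \<open>n0 + 1\<close>, the tail beyond \<open>n0\<close> is at most
    \<open>A / (n0 + 1) powr (K - 2)\<close>, against the leading term
    \<open>norm (a n0) / n0 powr K\<close>. Their quotient is governed by
    \<open>q powr (K - 2)\<close>, which exceeds any constant for large \<open>K\<close>.\<close>
  define q where "q = (real n0 + 1) / real n0"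
  have q: "q > 1" using n0 by (simp add: q_def)
  have "filterlim (\<lambda>K. q powr (K - 2)) at_top at_top" using q by real_asymp
  hence "eventually (\<lambda>K. q powr (K - 2) > (A + 1) * real n0 powr 2 / norm (a n0)) at_top"
    by (simp add: filterlim_at_top_dense)
  moreover have "eventually (\<lambda>K. K \<ge> (4::real)) at_top" by (rule eventually_ge_at_top)
  ultimately obtain K where K: "K \<ge> 4" "q powr (K - 2) > (A + 1) * real n0 powr 2 / norm (a n0)"
    using eventually_conj eventually_happens' trivial_limit_at_top_linorder by (metis (mono_tags, lifting))
  define c0 where "c0 = norm (a n0) / real n0 powr K - A / (real n0 + 1) powr (K - 2)"
  have "(A + 1) * real n0 powr 2 < norm (a n0) * q powr (K - 2)" using K n0 by (simp add: field_simps)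
  also have "q powr (K - 2) = (real n0 + 1) powr (K - 2) / real n0 powr (K - 2)"
    using n0 by (simp add: q_def powr_divide)
  also have "real n0 powr (K - 2) = real n0 powr K / real n0 powr 2" by (simp add: powr_diff)
  finally have "(A + 1) * real n0 powr 2 < norm (a n0) * (real n0 + 1) powr (K - 2) / real n0 powr K * real n0 powr 2"
    by simp
  hence "A + 1 < norm (a n0) * (real n0 + 1) powr (K - 2) / real n0 powr K"
    by (rule mult_right_less_imp_less) simp
  hence "(A + 1) / (real n0 + 1) powr (K - 2) < norm (a n0) / real n0 powr K"
    using n0 by (simp add: field_simps)
  moreover have "A / (real n0 + 1) powr (K - 2) \<le> (A + 1) / (real n0 + 1) powr (K - 2)"
    by (intro divide_right_mono) auto
  ultimately have c0: "c0 > 0" unfolding c0_def by linarith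
  show ?thesis
  proof (rule that[OF K(1) c0])
    fix t
    let ?s = "Complex K t"
    define f where "f = (\<lambda>n. a n / of_nat n powr ?s)"
    have sf: "summable (\<lambda>n. norm (f n))" using S K by (auto simp: f_def)
    define g where "g = (\<lambda>n. if n = n0 then 0 else f n)"
    have sg: "summable (\<lambda>n. norm (g n))"
      by (rule summable_comparison_test[OF _ sf]) (auto simp: g_def)
    have "(\<lambda>n. f n - (if n = n0 then f n else 0)) sums ((\<Sum>n. f n) - f n0)"
      using summable_norm_cancel[OF sf] by (intro sums_diff sums_single) auto
    moreover have "(\<lambda>n. f n - (if n = n0 then f n else 0)) = g" by (auto simp: g_def)
    ultimately have "(\<Sum>n. g n) = dser a ?s - f n0" by (simp add: sums_iff dser_def f_def)
    hence "norm (dser a ?s - f n0) \<le> (\<Sum>n. norm (g n))" using summable_norm[OF sg] by simp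
    moreover have "(\<Sum>n. norm (g n)) \<le> (\<Sum>n. norm (a n) / real n powr 2 / (real n0 + 1) powr (K - 2))"
    proof (intro suminf_le sg summable_divide sum2)
      fix n
      show "norm (g n) \<le> norm (a n) / real n powr 2 / (real n0 + 1) powr (K - 2)"
      proof (cases "n > n0")
        case True
        have "norm (g n) = norm (a n) / real n powr K"
          using True by (simp add: g_def f_def norm_dirichlet_term)
        also have "real n powr K = real n powr 2 * real n powr (K - 2)" using powr_add[of "real n" 2 "K - 2"] by simp
        also have "norm (a n) / (real n powr 2 * real n powr (K - 2)) \<le> norm (a n) / (real n powr 2 * (real n0 + 1) powr (K - 2))"
          using True K by (intro divide_left_mono mult_left_mono powr_mono2 mult_pos_pos) auto
        finally show ?thesis by simp
      next
        case False
        hence "g n = 0" using less[of n] by (cases "n = 0") (auto simp: g_def f_def)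
        thus ?thesis by simp
      qed
    qed
    moreover have "(\<Sum>n. norm (a n) / real n powr 2 / (real n0 + 1) powr (K - 2)) = A / (real n0 + 1) powr (K - 2)"
      unfolding A_def using sum2 by (intro suminf_divide)
    moreover have "norm (f n0) = norm (a n0) / real n0 powr K" by (simp add: f_def norm_dirichlet_term)
    moreover have "norm (f n0) - norm (dser a ?s - f n0) \<le> norm (dser a ?s)"
      using norm_triangle_ineq2[of "f n0" "f n0 - dser a ?s"] by (simp add: norm_minus_commute)
    ultimately show "norm (dser a ?s) \<ge> c0" unfolding c0_def by linarith
  qed
qed

section \<open>Polynomial growth of \<open>G\<close>\<close>

text \<open>On \<open>Re s = -1\<close> the reflected point \<open>cnj (1 - s)\<close> is
  \<open>s + 3\<close>, on the line \<open>Re s = 2\<close> where the Dirichlet series is bounded.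
  The functional equation then leaves Gamma factors at arguments differing by
  \<open>3 * lam j\<close>, whose quotients are polynomially bounded.\<close>

lemma selberg_left_line_bound:
  assumes S: "\<forall>s. Re s > 1 \<longrightarrow> summable (\<lambda>n. norm (a n / of_nat n powr s))"
    and data: "selberg_data a m G Q r lam mu eps"
  obtains C N where "C \<ge> 0" "\<And>s. Re s = -1 \<Longrightarrow> norm (G s) \<le> C * (1 + norm s) ^ N"
proof -
  have holG: "G holomorphic_on UNIV" and GF: "\<And>s. Re s > 1 \<Longrightarrow> G s = (s - 1) ^ m * dser a s"
    and Q: "Q > 0" and lam: "\<And>j. j < r \<Longrightarrow> lam j > 0" and mu: "\<And>j. j < r \<Longrightarrow> Re (mu j) \<ge> 0" and eps: "norm eps = 1"
    and fe: "\<And>s. s \<noteq> 0 \<Longrightarrow> s \<noteq> 1 \<Longrightarrow> no_gamma_pole r lam mu s \<Longrightarrow> no_gamma_pole r lam mu (cnj (1 - s)) \<Longrightarrow>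
        Phi_fun m G Q r lam mu s = eps * cnj (Phi_fun m G Q r lam mu (cnj (1 - s)))"
    using data unfolding selberg_data_def by blast+
  define A where "A = (\<Sum>n. norm (a n) / real n powr 2)"
  have A: "A \<ge> 0" unfolding A_def by (intro suminf_nonneg summable_dirichlet_norm[OF S]) auto
  have "\<exists>C N. C \<ge> 0 \<and> (\<forall>z. Re z = Re (mu j) - lam j \<longrightarrow> z \<notin> \<int>\<^sub>\<le>\<^sub>0 \<longrightarrow>
     norm (Gamma (z + of_real (3 * lam j))) \<le> C * (norm z + real N) ^ N * norm (Gamma z))" if "j < r" for j
  proof -
    have "Re (mu j) - lam j + 3 * lam j > 0" using lam[OF that] mu[OF that] by simp
    from norm_Gamma_shift_le[OF this] show ?thesis by metis
  qed
  then obtain CC NN where CN: "\<And>j. j < r \<Longrightarrow> CC j \<ge> 0"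
     "\<And>j z. j < r \<Longrightarrow> Re z = Re (mu j) - lam j \<Longrightarrow> z \<notin> \<int>\<^sub>\<le>\<^sub>0 \<Longrightarrow>
     norm (Gamma (z + of_real (3 * lam j))) \<le> CC j * (norm z + real (NN j)) ^ NN j * norm (Gamma z)"
    by metis
  define D where "D = (\<lambda>j. lam j + norm (mu j) + real (NN j))"
  \<comment> \<open>For \<open>|Im s| \<ge> T\<close> no argument of a Gamma factor is real, so all
    poles of these factors are avoided; the remaining compact segment is settled by the continuity
    of \<open>G\<close>.\<close>
  define T where "T = 1 + (\<Sum>j<r. \<bar>Im (mu j)\<bar> / lam j)"
  define C1 where "C1 = Q ^ 3 * (\<Prod>j<r. CC j * D j ^ NN j) * 2 ^ m * A"
  define N where "N = (\<Sum>j<r. NN j) + m"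
  have far: "norm (G s) \<le> C1 * (1 + norm s) ^ N" if s: "Re s = -1" "\<bar>Im s\<bar> \<ge> T" for s
  proof -
    define z where "z = (\<lambda>j. of_real (lam j) * s + mu j)"
    define s' where "s' = cnj (1 - s)"
    have s': "s' = s + 3" using s by (simp add: s'_def complex_eq_iff)
    have zs': "of_real (lam j) * s' + mu j = z j + of_real (3 * lam j)" for j by (simp add: s' z_def algebra_simps)
    have Imz: "Im (z j) \<noteq> 0" if j: "j < r" for j
    proof
      assume "Im (z j) = 0"
      hence "\<bar>Im (mu j)\<bar> = \<bar>lam j * Im s\<bar>" by (simp add: z_def add_eq_0_iff2)
      hence "\<bar>Im s\<bar> = \<bar>Im (mu j)\<bar> / lam j" using lam[OF j] by (simp add: abs_mult)
      also have "\<dots> \<le> (\<Sum>j<r. \<bar>Im (mu j)\<bar> / lam j)"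
        using j lam by (intro member_le_sum) (auto intro!: divide_nonneg_pos)
      finally show False using s(2) by (simp add: T_def)
    qed
    have zni: "z j \<notin> \<int>\<^sub>\<le>\<^sub>0" "z j + of_real (3 * lam j) \<notin> \<int>\<^sub>\<le>\<^sub>0" if "j < r" for j
      using Imz[OF that] by (auto elim!: nonpos_Ints_cases simp: complex_eq_iff)
    have ng: "no_gamma_pole r lam mu s" "no_gamma_pole r lam mu s'"
      unfolding no_gamma_pole_def zs' using zni by (auto simp: z_def)
    have s01: "s \<noteq> 0" "s \<noteq> 1" using s by auto
    have "norm (Phi_fun m G Q r lam mu s) = norm (Phi_fun m G Q r lam mu s')"
      using fe[OF s01 ng(1)] ng(2) eps by (simp add: s'_def norm_mult)
    moreover have "norm (Phi_fun m G Q r lam mu s) = Q powr (-1) * (\<Prod>j<r. norm (Gamma (z j))) * (norm (G s) / norm (s - 1) ^ m)"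
      using Q s by (simp add: Phi_fun_def norm_mult norm_divide norm_power norm_powr_real_powr z_def prod_norm)
    moreover have "norm (Phi_fun m G Q r lam mu s') = Q powr 2 * (\<Prod>j<r. norm (Gamma (z j + of_real (3 * lam j)))) * norm (dser a s')"
    proof -
      have "Re s' = 2" using s by (simp add: s')
      hence "G s' / (s' - 1) ^ m = dser a s'" using GF[of s'] by auto
      thus ?thesis unfolding Phi_fun_def zs'
        using Q \<open>Re s' = 2\<close> by (simp add: norm_mult norm_powr_real_powr prod_norm)
    qed
    ultimately have eq: "Q powr (-1) * (\<Prod>j<r. norm (Gamma (z j))) * (norm (G s) / norm (s - 1) ^ m) =
      Q powr 2 * (\<Prod>j<r. norm (Gamma (z j + of_real (3 * lam j)))) * norm (dser a s')" by simp
    define P where "P = (\<Prod>j<r. norm (Gamma (z j)))"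
    have P: "P > 0" unfolding P_def by (intro prod_pos) (use zni in \<open>auto simp: Gamma_eq_zero_iff\<close>)
    have "(\<Prod>j<r. norm (Gamma (z j + of_real (3 * lam j)))) \<le>
        (\<Prod>j<r. (CC j * D j ^ NN j) * (1 + norm s) ^ NN j * norm (Gamma (z j)))"
    proof (intro prod_mono conjI)
      fix j assume "j \<in> {..<r}" hence j: "j < r" by simp
      have le: "norm (z j) + real (NN j) \<le> D j * (1 + norm s)"
      proof -
        have "norm (z j) \<le> lam j * norm s + norm (mu j)"
          unfolding z_def using lam[OF j] by (intro order_trans[OF norm_triangle_ineq]) (simp add: norm_mult)
        also have "\<dots> + real (NN j) \<le> D j * (1 + norm s)"
          using lam[OF j] by (simp add: D_def algebra_simps)
        finally show ?thesis by simp
      qed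
      have "norm (Gamma (z j + of_real (3 * lam j))) \<le> CC j * (norm (z j) + real (NN j)) ^ NN j * norm (Gamma (z j))"
        by (rule CN(2)[OF j]) (use zni[OF j] s in \<open>auto simp: z_def\<close>)
      also have "\<dots> \<le> CC j * (D j * (1 + norm s)) ^ NN j * norm (Gamma (z j))"
        using CN(1)[OF j] le by (intro mult_right_mono mult_left_mono power_mono) auto
      finally show "norm (Gamma (z j + of_real (3 * lam j))) \<le> (CC j * D j ^ NN j) * (1 + norm s) ^ NN j * norm (Gamma (z j))"
        by (simp add: power_mult_distrib mult_ac)
    qed auto
    also have "\<dots> = (\<Prod>j<r. CC j * D j ^ NN j) * (1 + norm s) ^ (\<Sum>j<r. NN j) * P"
      by (simp add: prod.distrib power_sum P_def)
    finally have g: "(\<Prod>j<r. norm (Gamma (z j + of_real (3 * lam j)))) \<le> (\<Prod>j<r. CC j * D j ^ NN j) * (1 + norm s) ^ (\<Sum>j<r. NN j) * P" .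
    have d: "norm (dser a s') \<le> A" unfolding A_def using s by (intro norm_dser_le S) (auto simp: s')
    have Dn: "(\<Prod>j<r. CC j * D j ^ NN j) \<ge> 0" using CN(1) lam by (intro prod_nonneg) (auto simp: D_def less_imp_le)
    have "norm (s - 1) > 0" using s by auto
    hence "norm (G s) * P = Q powr 2 / Q powr (-1) * (\<Prod>j<r. norm (Gamma (z j + of_real (3 * lam j)))) * norm (dser a s') * norm (s - 1) ^ m"
      using eq Q unfolding P_def[symmetric] by (simp add: field_simps)
    also have "Q powr 2 / Q powr (-1) = Q ^ 3" using Q by (simp flip: powr_diff add: powr_realpow' power3_eq_cube power2_eq_square)
    also have "Q ^ 3 * (\<Prod>j<r. norm (Gamma (z j + of_real (3 * lam j)))) * norm (dser a s') * norm (s - 1) ^ m \<le>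
        Q ^ 3 * ((\<Prod>j<r. CC j * D j ^ NN j) * (1 + norm s) ^ (\<Sum>j<r. NN j) * P) * A * (2 * (1 + norm s)) ^ m"
    proof -
      have "norm (s - 1) \<le> 2 * (1 + norm s)" using norm_triangle_ineq4[of s 1] by (smt (verit) norm_ge_zero norm_one)
      hence "norm (s - 1) ^ m \<le> (2 * (1 + norm s)) ^ m" by (intro power_mono) auto
      moreover have "0 \<le> (\<Prod>j<r. norm (Gamma (z j + of_real (3 * lam j))))" by (intro prod_nonneg) auto
      ultimately show ?thesis using Q g d Dn P A by (intro mult_mono mult_nonneg_nonneg) auto
    qed
    also have "\<dots> = C1 * (1 + norm s) ^ N * P" by (simp only: C1_def N_def power_mult_distrib power_add mult_ac)
    finally show ?thesis using P by simp
  qed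
  have "compact (cbox (Complex (-1) (-T)) (Complex (-1) T))" by (rule compact_cbox)
  moreover have "continuous_on (cbox (Complex (-1) (-T)) (Complex (-1) T)) G"
    using holG holomorphic_on_imp_continuous_on continuous_on_subset by blast
  ultimately have "bounded (G ` cbox (Complex (-1) (-T)) (Complex (-1) T))"
    by (intro compact_imp_bounded compact_continuous_image)
  then obtain C2 where C2: "C2 > 0" "\<And>z. z \<in> cbox (Complex (-1) (-T)) (Complex (-1) T) \<Longrightarrow> norm (G z) \<le> C2"
    unfolding bounded_pos by auto
  show ?thesis
  proof (rule that[of "max C1 C2" N])
    show "max C1 C2 \<ge> 0" using C2 by simp
    fix s assume s: "Re s = -1"
    show "norm (G s) \<le> max C1 C2 * (1 + norm s) ^ N"
    proof (cases "\<bar>Im s\<bar> \<ge> T")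
      case True
      thus ?thesis using far[OF s] by (rule_tac order_trans[OF _ mult_right_mono[OF max.cobounded1]]) auto
    next
      case False
      hence "norm (G s) \<le> C2" using s by (intro C2) (auto simp: in_cbox_complex_iff)
      also have "\<dots> \<le> max C1 C2 * (1 + norm s) ^ N"
        using C2 by (intro order_trans[OF _ mult_mono[OF max.cobounded2 one_le_power]]) auto
      finally show ?thesis .
    qed
  qed
qed

text \<open>Phragmen-Lindelof between \<open>Re s = -1\<close> and \<open>Re s = 2\<close>, applied
  to \<open>G s / (s + 3) ^ N\<close>: the power of \<open>s + 3\<close>, which has norm at least 2
  there, turns the polynomial bounds on the two lines into constants without introducing a
  pole.\<close>

lemma selberg_polynomial_growth:
  assumes S: "\<forall>s. Re s > 1 \<longrightarrow> summable (\<lambda>n. norm (a n / of_nat n powr s))"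
    and data: "selberg_data a m G Q r lam mu eps"
  obtains C N where "C > 0" "\<And>s. Re s \<ge> -1 \<Longrightarrow> norm (G s) \<le> C * (1 + norm s) ^ N"
proof -
  have holG: "G holomorphic_on UNIV" and GF: "\<And>s. Re s > 1 \<Longrightarrow> G s = (s - 1) ^ m * dser a s"
    and fin: "\<exists>A B. \<forall>s. norm (G s) \<le> B * exp (norm s powr A)"
    using data unfolding selberg_data_def by blast+
  obtain A B where AB: "\<And>s. norm (G s) \<le> B * exp (norm s powr A)" using fin by blast
  obtain C1 N1 where C1: "C1 \<ge> 0" "\<And>s. Re s = -1 \<Longrightarrow> norm (G s) \<le> C1 * (1 + norm s) ^ N1"
    using selberg_left_line_bound[OF S data] by blast
  define A2 where "A2 = (\<Sum>n. norm (a n) / real n powr 2)"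
  have A2: "A2 \<ge> 0" unfolding A2_def by (intro suminf_nonneg summable_dirichlet_norm[OF S]) auto
  define N where "N = N1 + m"
  define C where "C = C1 + A2 + 1"
  have le1: "norm (G s) \<le> C * (1 + norm s) ^ N" if "Re s = -1" for s
  proof -
    have "norm (G s) \<le> C1 * (1 + norm s) ^ N1" using C1 that by auto
    also have "\<dots> \<le> C * (1 + norm s) ^ N"
      using C1 A2 by (intro mult_mono power_increasing) (auto simp: C_def N_def)
    finally show ?thesis .
  qed
  have le2: "norm (G s) \<le> C * (1 + norm s) ^ N" if "Re s \<ge> 2" for s
  proof -
    have "norm (s - 1) \<le> 1 + norm s" using norm_triangle_ineq4[of s 1] by simp
    hence "norm (s - 1) ^ m * norm (dser a s) \<le> (1 + norm s) ^ m * A2"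
      unfolding A2_def using that by (intro mult_mono power_mono norm_dser_le S) auto
    also have "\<dots> \<le> (1 + norm s) ^ N * C"
      using C1 A2 by (intro mult_mono power_increasing) (auto simp: C_def N_def)
    finally show ?thesis using GF[of s] that by (simp add: norm_mult norm_power mult_ac)
  qed
  have Cpos: "C > 0" using C1 A2 by (simp add: C_def)
  have n3: "norm (s + 3) \<ge> 2" "1 + norm s \<le> 3 * norm (s + 3)" if "Re s \<ge> -1" for s
  proof -
    show "norm (s + 3) \<ge> 2" using complex_Re_le_cmod[of "s + 3"] that by simp
    moreover have "norm s \<le> norm (s + 3) + 3" using norm_triangle_ineq4[of "s + 3" 3] by simp
    ultimately show "1 + norm s \<le> 3 * norm (s + 3)" by linarith
  qed
  have mid: "norm (G s / (s + 3) ^ N) \<le> C * 3 ^ N" if s: "-1 \<le> Re s" "Re s \<le> 2" for s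
  proof (rule Phragmen_Lindelof_strip[where f = "\<lambda>s. G s / (s + 3) ^ N" and a = "-1" and b = 2 and S = "{s. Re s > -3}" and A = A and B = B])
    show "open {s. Re s > - 3}" by (rule open_halfspace_Re_gt)
    show "(\<lambda>s. G s / (s + 3) ^ N) holomorphic_on {s. Re s > - 3}"
      by (intro holomorphic_intros holomorphic_on_subset[OF holG]) (auto simp: add_eq_0_iff2)
    show "C * 3 ^ N > 0" using Cpos by simp
  next
    fix s :: complex assume s: "-1 \<le> Re s" "Re s \<le> 2"
    have "norm (s + 3) ^ N \<ge> 1" using n3(1)[of s] s by (intro one_le_power) auto
    hence "norm (G s / (s + 3) ^ N) \<le> norm (G s) / 1"
      unfolding norm_divide norm_power by (intro divide_left_mono) (auto intro: order_less_le_trans[OF zero_less_one])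
    also have "\<dots> \<le> B * exp (norm s powr A)" using AB by simp
    finally show "norm (G s / (s + 3) ^ N) \<le> B * exp (norm s powr A)" .
  next
    fix s :: complex assume s: "Re s = -1 \<or> Re s = 2"
    hence s': "Re s \<ge> -1" by auto
    have "norm (G s) \<le> C * (1 + norm s) ^ N" using s le1 le2 by auto
    also have "\<dots> \<le> C * (3 * norm (s + 3)) ^ N" using Cpos n3[OF s'] by (intro mult_left_mono power_mono) auto
    finally have "norm (G s) \<le> C * 3 ^ N * norm (s + 3) ^ N" by (simp add: power_mult_distrib mult_ac)
    moreover have "norm (s + 3) ^ N > 0" using n3(1)[OF s'] by (intro zero_less_power) linarith
    ultimately show "norm (G s / (s + 3) ^ N) \<le> C * 3 ^ N"
      by (simp add: norm_divide norm_power pos_divide_le_eq)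
  qed (use s in auto)
  show ?thesis
  proof (rule that[of "C * 3 ^ N * 3 ^ N" N])
    show "C * 3 ^ N * 3 ^ N > 0" using Cpos by simp
    fix s :: complex assume s: "Re s \<ge> -1"
    show "norm (G s) \<le> C * 3 ^ N * 3 ^ N * (1 + norm s) ^ N"
    proof (cases "Re s \<le> 2")
      case True
      have "norm (s + 3) ^ N > 0" using n3(1)[OF s] by (intro zero_less_power) linarith
      hence "norm (G s) \<le> C * 3 ^ N * norm (s + 3) ^ N"
        using mid[OF s True] by (simp add: norm_divide norm_power pos_divide_le_eq)
      also have "\<dots> \<le> C * 3 ^ N * (3 * (1 + norm s)) ^ N"
      proof -
        have "norm (s + 3) \<le> norm s + 3" using norm_triangle_ineq[of s 3] by simp
        also have "\<dots> \<le> 3 * norm s + 3" by simp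
        also have "\<dots> = 3 * (1 + norm s)" by (simp add: algebra_simps)
        finally show ?thesis using Cpos by (intro mult_left_mono power_mono) auto
      qed
      finally show ?thesis by (simp only: power_mult_distrib mult.assoc)
    next
      case False
      hence "norm (G s) \<le> C * (1 + norm s) ^ N" using le2 by auto
      also have "\<dots> \<le> C * 3 ^ N * 3 ^ N * (1 + norm s) ^ N"
        using Cpos mult_mono[OF one_le_power[of "3::real" N] one_le_power[of "3::real" N]] by (intro mult_right_mono) auto
      finally show ?thesis .
    qed
  qed
qed


text \<open>A holomorphic logarithm of \<open>G\<close> exists to the right of the critical line; its real part is at most logarithmic by the
  polynomial growth of \<open>G\<close>, which Borel--Caratheodory and Cauchy's estimate turn into a bound for its derivative.\<close>
lemma selberg_log_deriv_bound:
  assumes S: "\<forall>s. Re s > 1 \<longrightarrow> summable (\<lambda>n. norm (a n / of_nat n powr s))"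
    and data: "selberg_data a m G Q r lam mu eps"
    and nz: "\<And>s. Re s > 1/2 \<Longrightarrow> G s \<noteq> 0" and e: "e > 0"
  obtains C where "C > 0" "\<And>s. 1/2 + e \<le> Re s \<Longrightarrow> Re s \<le> 3 \<Longrightarrow> norm (deriv G s / G s) \<le> C * ln (3 + \<bar>Im s\<bar>)"
proof -
  have holG: "G holomorphic_on UNIV" and GF: "\<And>s. Re s > 1 \<Longrightarrow> G s = (s - 1) ^ m * dser a s"
    using data unfolding selberg_data_def by blast+
  have "dser a 3 \<noteq> 0" using nz[of 3] GF[of 3] by auto
  then obtain K c0 where K: "K \<ge> 4" and c0: "c0 > 0" "\<And>t. norm (dser a (Complex K t)) \<ge> c0"
    using dser_lower_bound[OF S] by blast
  obtain C N where C: "C > 0" "\<And>s. Re s \<ge> -1 \<Longrightarrow> norm (G s) \<le> C * (1 + norm s) ^ N"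
    using selberg_polynomial_growth[OF S data] by blast
  define H where "H = {s. Re s > (1/2 :: real)}"
  have H: "convex H" "open H" unfolding H_def by (simp_all only: convex_halfspace_Re_gt open_halfspace_Re_gt)
  obtain l where l: "l holomorphic_on H" "\<And>s. s \<in> H \<Longrightarrow> exp (l s) = G s"
    by (rule holomorphic_logarithm_exists[OF H holomorphic_on_subset[OF holG], of 1])
       (use nz in \<open>auto simp: H_def\<close>)
  have Rel: "Re (l s) = ln (norm (G s))" if "s \<in> H" for s
    using l(2)[OF that] by (metis ln_exp norm_exp_eq_Re)
  define D where "D = \<bar>ln (C / c0)\<bar> + real N * ln (1 + 2 * K) + real N + 1"
  have D: "D > 0" using K unfolding D_def by (intro add_nonneg_pos add_nonneg_nonneg mult_nonneg_nonneg) auto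
  define C' where "C' = 2 * D * (K - 1/2 - e/2) / (e/4) / (e/2)"
  show ?thesis
  proof (cases "e \<le> 5/2")
    \<comment> \<open>Here \<open>1/2 + e > 3\<close>, so no \<open>s\<close> satisfies both
      conditions and any constant will do.\<close>
    case False
    thus ?thesis using that[of 1] by force
  next
    case True
    have C': "C' > 0" unfolding C'_def using D K e True by (intro divide_pos_pos mult_pos_pos) auto
    show ?thesis
    proof (rule that[OF C'])
      fix s assume s: "1/2 + e \<le> Re s" "Re s \<le> 3"
      define t where "t = Im s"
      define c where "c = Complex K t"
      \<comment> \<open>Nested discs: the one of radius \<open>R\<close> about \<open>c\<close>
        reaches to the abscissa \<open>1/2 + e/4\<close>, the one of radius \<open>r\<close> to
        \<open>1/2 + e/2\<close>, and the Cauchy disc of radius \<open>e/2\<close> about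
        \<open>s\<close> stays inside the latter. \<open>K \<ge> 4\<close> puts the centre to the
        right of every \<open>s\<close> considered.\<close>
      define R where "R = K - 1/2 - e/4"
      define r where "r = K - 1/2 - e/2"
      define M where "M = D * ln (3 + \<bar>t\<bar>)"
      have ln1: "ln (3 + \<bar>t\<bar>) \<ge> 1"
      proof -
        have "ln (exp 1) \<le> ln (3 + \<bar>t\<bar>)" using exp_le by (intro ln_mono) auto
        thus ?thesis by simp
      qed
      have M: "M > 0" unfolding M_def using D ln1 by (intro mult_pos_pos) auto
      have rR: "r < R" "r \<ge> 0" "R - r = e / 4" using e K True by (auto simp: r_def R_def)
      have sub: "ball c R \<subseteq> H"
      proof
        fix z assume "z \<in> ball c R"
        hence "norm (c - z) < R" by (simp add: dist_norm)
        moreover have "Re (c - z) \<le> norm (c - z)" by (rule complex_Re_le_cmod)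
        ultimately show "z \<in> H" using e by (simp add: c_def R_def H_def)
      qed
      \<comment> \<open>The real part is \<open>ln (norm (G z) / norm (G c))\<close>: polynomial
        growth bounds the numerator, and the lower bound \<open>c0\<close> for the series on
        \<open>Re s = K\<close> keeps the denominator away from 0.\<close>
      have Rebd: "Re (l z - l c) < M" if z: "z \<in> ball c R" for z
      proof -
        have zH: "z \<in> H" and cH: "c \<in> H" using sub z rR by auto
        have "norm z \<le> norm c + norm (z - c)" using norm_triangle_ineq[of c "z - c"] by simp
        also have "\<dots> \<le> (K + \<bar>t\<bar>) + K"
          using cmod_le[of c] z K e by (auto simp: c_def dist_norm norm_minus_commute R_def)
        finally have nz': "1 + norm z \<le> (1 + 2 * K) * (3 + \<bar>t\<bar>)" using K
          by (simp add: algebra_simps) (smt (verit) mult_nonneg_nonneg)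
        have "norm (G z) \<le> C * (1 + norm z) ^ N" using C(2)[of z] zH by (simp add: H_def)
        also have "\<dots> \<le> C * ((1 + 2 * K) * (3 + \<bar>t\<bar>)) ^ N" using C(1) nz' by (intro mult_left_mono power_mono) auto
        finally have Gz: "norm (G z) \<le> C * ((1 + 2 * K) * (3 + \<bar>t\<bar>)) ^ N" .
        have Gz0: "norm (G z) > 0" using nz zH by (auto simp: H_def)
        have "1 \<le> norm (c - 1)" using complex_Re_le_cmod[of "c - 1"] K by (simp add: c_def)
        hence "1 * c0 \<le> norm (c - 1) ^ m * norm (dser a c)"
          using c0 unfolding c_def by (intro mult_mono one_le_power) auto
        hence Gc: "c0 \<le> norm (G c)" using GF[of c] K by (simp add: c_def norm_mult norm_power)
        have "ln (norm (G z)) \<le> ln (C * ((1 + 2 * K) * (3 + \<bar>t\<bar>)) ^ N)" using Gz Gz0 by (intro ln_mono) auto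
        also have "\<dots> = ln C + real N * (ln (1 + 2 * K) + ln (3 + \<bar>t\<bar>))"
          using C(1) K by (simp add: ln_mult ln_realpow)
        finally have 1: "ln (norm (G z)) \<le> ln C + real N * (ln (1 + 2 * K) + ln (3 + \<bar>t\<bar>))" .
        have 2: "ln c0 \<le> ln (norm (G c))" using c0 Gc by (intro ln_mono) auto
        have "Re (l z - l c) \<le> ln (C / c0) + real N * ln (1 + 2 * K) * 1 + real N * ln (3 + \<bar>t\<bar>)"
          using 1 2 C c0 by (simp add: Rel[OF zH] Rel[OF cH] ln_div algebra_simps)
        also have "\<dots> < (\<bar>ln (C / c0)\<bar> + 1) * ln (3 + \<bar>t\<bar>) + real N * ln (1 + 2 * K) * ln (3 + \<bar>t\<bar>) + real N * ln (3 + \<bar>t\<bar>)"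
        proof -
          have "ln (C / c0) < (\<bar>ln (C / c0)\<bar> + 1) * 1" by simp
          also have "\<dots> \<le> (\<bar>ln (C / c0)\<bar> + 1) * ln (3 + \<bar>t\<bar>)" using ln1 by (intro mult_left_mono) auto
          finally show ?thesis using ln1 K by (intro add_less_le_mono mult_left_mono) auto
        qed
        also have "\<dots> = M" by (simp add: M_def D_def algebra_simps)
        finally show ?thesis .
      qed
      define B where "B = 2 * M * r / (R - r)"
      have lB: "norm (l w - l c) \<le> B" if w: "norm (s - w) \<le> e / 2" for w
        unfolding B_def
      proof (rule Borel_Caratheodory[OF holomorphic_on_subset[OF l(1) sub] M Rebd _ rR(1)])
        have "norm (s - c) = K - Re s" using s K by (simp add: c_def t_def cmod_def)
        moreover have "norm (w - c) \<le> norm (w - s) + norm (s - c)" using norm_triangle_ineq[of "w - s" "s - c"] by simp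
        ultimately show "norm (w - c) \<le> r" using w s by (simp add: r_def norm_minus_commute)
      qed
      have cb: "cball s (e/2) \<subseteq> H"
      proof
        fix z assume "z \<in> cball s (e/2)"
        hence "norm (s - z) \<le> e/2" by (simp add: dist_norm)
        moreover have "Re (s - z) \<le> norm (s - z)" by (rule complex_Re_le_cmod)
        ultimately show "z \<in> H" using s e by (simp add: H_def)
      qed
      have hl: "(\<lambda>w. l w - l c) holomorphic_on H" by (intro holomorphic_intros l(1))
      have "norm ((deriv ^^ 1) (\<lambda>w. l w - l c) s) \<le> fact 1 * B / (e/2) ^ 1"
      proof (rule Cauchy_inequality)
        show "(\<lambda>w. l w - l c) holomorphic_on ball s (e/2)"
          using cb ball_subset_cball by (intro holomorphic_on_subset[OF hl]) blast
        show "continuous_on (cball s (e/2)) (\<lambda>w. l w - l c)"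
          using cb by (intro holomorphic_on_imp_continuous_on holomorphic_on_subset[OF hl])
      qed (use e lB in auto)
      moreover have sH: "s \<in> H" using s e by (simp add: H_def)
      have dl: "(l has_field_derivative deriv l s) (at s)" using l(1) H(2) sH by (rule holomorphic_derivI)
      have "((\<lambda>w. l w - l c) has_field_derivative deriv l s) (at s)"
        using DERIV_diff[OF dl DERIV_const[of "l c"]] by simp
      hence "deriv (\<lambda>w. l w - l c) s = deriv l s" by (rule DERIV_imp_deriv)
      ultimately have 1: "norm (deriv l s) \<le> B / (e/2)" by simp
      have "((\<lambda>w. exp (l w)) has_field_derivative exp (l s) * deriv l s) (at s)"
        by (rule DERIV_chain2[OF DERIV_exp dl])
      hence "(G has_field_derivative exp (l s) * deriv l s) (at s)"
        by (rule has_field_derivative_transform_within_open[OF _ H(2) sH]) (use l(2) in auto)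
      hence "deriv G s = G s * deriv l s" using l(2)[OF sH] by (auto dest: DERIV_imp_deriv)
      hence "deriv G s / G s = deriv l s" using nz[of s] s e by simp
      moreover have "B / (e/2) = C' * ln (3 + \<bar>Im s\<bar>)"
        unfolding B_def rR(3) unfolding M_def C'_def t_def r_def by simp
      ultimately show "norm (deriv G s / G s) \<le> C' * ln (3 + \<bar>Im s\<bar>)" using 1 by simp
    qed
  qed
qed

section \<open>Perron's formula\<close>

lemma integrable_one_plus_abs_powr:
  assumes "p > 1"
  shows "integrable lborel (\<lambda>t::real. (1 + \<bar>t\<bar>) powr (-p))"
proof -
  define f0 where "f0 = (\<lambda>t::real. (1 + \<bar>t\<bar>) powr (-p) * indicator {0..} t)"
  have m: "(\<lambda>t::real. (1 + \<bar>t\<bar>) powr (-p)) \<in> borel_measurable borel" by measurable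
  have "(\<integral>\<^sup>+t. ennreal ((1 + \<bar>t\<bar>) powr (-p)) * indicator {0..} t \<partial>lborel) =
      0 - (\<lambda>t. (1 + t) powr (1 - p) / (1 - p)) 0"
  proof (rule nn_integral_FTC_atLeast[OF m])
    fix x :: real assume x: "0 \<le> x"
    have "((\<lambda>t. (1 + t) powr (1 - p) / (1 - p)) has_real_derivative (1 + x) powr (-p)) (at x)"
      using x assms by (auto intro!: derivative_eq_intros)
    thus "((\<lambda>t. (1 + t) powr (1 - p) / (1 - p)) has_real_derivative (1 + \<bar>x\<bar>) powr (-p)) (at x)"
      using x by simp
  next
    show "((\<lambda>t. (1 + t) powr (1 - p) / (1 - p)) \<longlongrightarrow> 0) at_top"
      using assms by real_asymp
  qed auto
  moreover have "(\<integral>\<^sup>+t. ennreal (norm (f0 t)) \<partial>lborel) = (\<integral>\<^sup>+t. ennreal ((1 + \<bar>t\<bar>) powr (-p)) * indicator {0..} t \<partial>lborel)"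
    by (intro nn_integral_cong) (auto simp: f0_def split: split_indicator)
  ultimately have "(\<integral>\<^sup>+t. ennreal (norm (f0 t)) \<partial>lborel) < \<infinity>" by simp
  moreover have "f0 \<in> borel_measurable lborel" unfolding f0_def by measurable
  ultimately have f0: "integrable lborel f0" by (intro integrableI_bounded) auto
  have "integrable lborel (\<lambda>t. f0 (0 + (-1) * t))" by (rule lborel_integrable_real_affine[OF f0]) auto
  hence "integrable lborel (\<lambda>t. f0 t + f0 (-t))" using f0 by simp
  thus ?thesis
    by (rule Bochner_Integration.integrable_bound) (auto simp: f0_def split: split_indicator)
qed

lemma integrable_powr_bound:
  fixes f :: "real \<Rightarrow> complex"
  assumes "f \<in> borel_measurable borel" "p > 1" "\<And>t. norm (f t) \<le> C * (1 + \<bar>t\<bar>) powr (-p)"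
  shows "integrable lborel f"
proof (rule Bochner_Integration.integrable_bound[OF integrable_mult_right[OF integrable_one_plus_abs_powr[OF assms(2)]]])
  show "f \<in> borel_measurable lborel" using assms(1) by simp
  have "norm (f t) \<le> norm (C * (1 + \<bar>t\<bar>) powr (-p))" for t
    using order_trans[OF assms(3)[of t] abs_ge_self] by simp
  thus "AE x in lborel. norm (f x) \<le> norm (C * (1 + \<bar>x\<bar>) powr (-p))" by auto
qed

text \<open>The link between the segment integrals that contour integration produces and Lebesgue
  integrals over the whole line, by dominated convergence along symmetric intervals.\<close>

lemma integral_symmetric_tendsto:
  fixes f :: "real \<Rightarrow> complex"
  assumes f: "integrable lborel f"
  shows "(\<lambda>n. integral {-real n..real n} f) \<longlonglongrightarrow> (LINT t|lborel. f t)"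
proof -
  have "(\<lambda>n. LINT t|lborel. indicator {-real n..real n} t *\<^sub>R f t) \<longlonglongrightarrow> (LINT t|lborel. f t)"
  proof (rule integral_dominated_convergence[where w = "\<lambda>t. norm (f t)"])
    show "AE t in lborel. (\<lambda>n. indicator {-real n..real n} t *\<^sub>R f t) \<longlonglongrightarrow> f t"
    proof (intro AE_I2)
      fix t :: real
      have "eventually (\<lambda>n. indicator {-real n..real n} t *\<^sub>R f t = f t) sequentially"
        using eventually_ge_at_top[of "nat \<lceil>\<bar>t\<bar>\<rceil>"]
      proof eventually_elim
        case (elim n)
        hence "\<bar>t\<bar> \<le> real n" by linarith
        thus ?case by (simp add: indicator_def abs_le_iff)
      qed
      thus "(\<lambda>n. indicator {-real n..real n} t *\<^sub>R f t) \<longlonglongrightarrow> f t" by (rule tendsto_eventually)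
    qed
  qed (use f in \<open>auto simp: indicator_def\<close>)
  moreover have "(LINT t|lborel. indicator {-real n..real n} t *\<^sub>R f t) = integral {-real n..real n} f" for n
  proof -
    have "set_integrable lborel {-real n..real n} f"
      using f unfolding set_integrable_def by (intro integrable_mult_indicator) auto
    from set_borel_integral_eq_integral(2)[OF this] show ?thesis by (simp add: set_lebesgue_integral_def)
  qed
  ultimately show ?thesis by simp
qed

text \<open>Only the horizontal sides are estimated, and the value \<open>I\<close> of the closed
  contour integral stays free: the same bound then serves with residues inside the rectangle and
  with \<open>I = 0\<close>.\<close>

lemma rectangle_contour_bound:
  fixes f :: "complex \<Rightarrow> complex"
  assumes ab: "a < b" and T: "T > 0"
    and cont: "continuous_on (path_image (rectpath (Complex a (-T)) (Complex b T))) f"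
    and I: "(f has_contour_integral I) (rectpath (Complex a (-T)) (Complex b T))"
    and h: "\<And>s. a \<le> Re s \<Longrightarrow> Re s \<le> b \<Longrightarrow> \<bar>Im s\<bar> = T \<Longrightarrow> norm (f s) \<le> h"
  shows "norm (I - \<i> * integral {-T..T} (\<lambda>t. f (Complex b t)) + \<i> * integral {-T..T} (\<lambda>t. f (Complex a t)))
           \<le> 2 * (b - a) * h"
proof -
  define a1 a2 a3 a4 where "a1 = Complex a (-T)" and "a2 = Complex b (-T)" and "a3 = Complex b T" and "a4 = Complex a T"
  have img: "path_image (rectpath a1 a3) = closed_segment a1 a2 \<union> closed_segment a2 a3 \<union> closed_segment a3 a4 \<union> closed_segment a4 a1"
    by (simp add: rectpath_def Let_def path_image_join a1_def a2_def a3_def a4_def Un_assoc)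
  have cs: "continuous_on (closed_segment a1 a2) f" "continuous_on (closed_segment a2 a3) f"
     "continuous_on (closed_segment a3 a4) f" "continuous_on (closed_segment a4 a1) f"
    using cont unfolding a1_def[symmetric] a3_def[symmetric] img by (auto intro: continuous_on_subset)
  note ci = cs[THEN contour_integrable_continuous_linepath]
  have h0: "h \<ge> 0" by (rule order_trans[OF norm_ge_zero h[of a3]]) (use ab T in \<open>auto simp: a3_def\<close>)
  have "I = contour_integral (rectpath a1 a3) f"
    using I unfolding a1_def a3_def by (rule contour_integral_unique[symmetric])
  also have "\<dots> = contour_integral (linepath a1 a2) f + (contour_integral (linepath a2 a3) f +
      (contour_integral (linepath a3 a4) f + contour_integral (linepath a4 a1) f))"
    unfolding rectpath_def Let_def using ci
    by (simp add: a1_def a2_def a3_def a4_def contour_integrable_joinI)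
  also have "contour_integral (linepath a2 a3) f = \<i> * integral {-T..T} (\<lambda>t. f (Complex b t))"
    by (rule contour_integral_linepath_same_Re) (use T in \<open>auto simp: a2_def a3_def\<close>)
  also have "contour_integral (linepath a4 a1) f = - contour_integral (linepath a1 a4) f"
    using ci(4) cs(4) by (subst contour_integral_reverse_linepath) (auto simp: closed_segment_commute)
  also have "contour_integral (linepath a1 a4) f = \<i> * integral {-T..T} (\<lambda>t. f (Complex a t))"
    by (rule contour_integral_linepath_same_Re) (use T in \<open>auto simp: a1_def a4_def\<close>)
  finally have "I - \<i> * integral {-T..T} (\<lambda>t. f (Complex b t)) + \<i> * integral {-T..T} (\<lambda>t. f (Complex a t)) =
     contour_integral (linepath a1 a2) f + contour_integral (linepath a3 a4) f" by simp
  moreover have "norm (contour_integral (linepath a1 a2) f) \<le> h * norm (a2 - a1)"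
    by (rule contour_integral_bound_linepath[OF ci(1) h0])
       (use ab T in \<open>auto intro!: h simp: a1_def a2_def closed_segment_same_Im closed_segment_eq_real_ivl\<close>)
  moreover have "norm (contour_integral (linepath a3 a4) f) \<le> h * norm (a4 - a3)"
    by (rule contour_integral_bound_linepath[OF ci(3) h0])
       (use ab T in \<open>auto intro!: h simp: a3_def a4_def closed_segment_same_Im closed_segment_eq_real_ivl\<close>)
  moreover have "norm (a2 - a1) = b - a" "norm (a4 - a3) = b - a"
    using ab by (auto simp: a1_def a2_def a3_def a4_def cmod_def)
  moreover have "norm (contour_integral (linepath a1 a2) f + contour_integral (linepath a3 a4) f) \<le>
      norm (contour_integral (linepath a1 a2) f) + norm (contour_integral (linepath a3 a4) f)"
    by (rule norm_triangle_ineq)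
  ultimately show ?thesis by (simp add: algebra_simps)
qed

lemma vertical_line_shift:
  fixes f :: "complex \<Rightarrow> complex"
  assumes ab: "a < b" and S: "convex S" "{s. a \<le> Re s \<and> Re s \<le> b} \<subseteq> S" and hol: "f holomorphic_on S"
    and h: "\<And>s. a \<le> Re s \<Longrightarrow> Re s \<le> b \<Longrightarrow> norm (f s) \<le> h \<bar>Im s\<bar>" "(h \<longlongrightarrow> 0) at_top"
    and ia: "integrable lborel (\<lambda>t. f (Complex a t))" and ib: "integrable lborel (\<lambda>t. f (Complex b t))"
  shows "(LINT t|lborel. f (Complex a t)) = (LINT t|lborel. f (Complex b t))"
proof -
  have bd: "norm (integral {-T..T} (\<lambda>t. f (Complex b t)) - integral {-T..T} (\<lambda>t. f (Complex a t))) \<le> 2 * (b - a) * h T"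
    if T: "T > 0" for T
  proof -
    have sub: "path_image (rectpath (Complex a (-T)) (Complex b T)) \<subseteq> S"
      using path_image_rectpath_subset_cbox[of "Complex a (-T)" "Complex b T"] ab T S(2)
      by (fastforce simp: in_cbox_complex_iff)
    have "(f has_contour_integral 0) (rectpath (Complex a (-T)) (Complex b T))"
      by (rule Cauchy_theorem_convex_simple[OF hol S(1) _ sub]) auto
    from rectangle_contour_bound[OF ab T _ this, of "h T"]
    have "norm (\<i> * (integral {-T..T} (\<lambda>t. f (Complex a t)) - integral {-T..T} (\<lambda>t. f (Complex b t)))) \<le> 2 * (b - a) * h T"
      using holomorphic_on_imp_continuous_on[OF hol] continuous_on_subset[OF _ sub] h(1)
      by (force simp: algebra_simps)
    thus ?thesis by (simp add: norm_mult norm_minus_commute)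
  qed
  have "(\<lambda>n. norm (integral {-real n..real n} (\<lambda>t. f (Complex b t)) - integral {-real n..real n} (\<lambda>t. f (Complex a t))))
      \<longlonglongrightarrow> norm ((LINT t|lborel. f (Complex b t)) - (LINT t|lborel. f (Complex a t)))"
    by (intro tendsto_intros integral_symmetric_tendsto ia ib)
  moreover have "(\<lambda>n. 2 * (b - a) * h (real n)) \<longlonglongrightarrow> 2 * (b - a) * 0"
    by (intro tendsto_intros filterlim_compose[OF h(2)] filterlim_real_sequentially)
  ultimately have "norm ((LINT t|lborel. f (Complex b t)) - (LINT t|lborel. f (Complex a t))) \<le> 2 * (b - a) * 0"
    by (rule LIMSEQ_le) (use bd in \<open>auto intro!: exI[of _ 1]\<close>)
  thus ?thesis by simp
qed

text \<open>The norm is at least \<open>c - p\<close> by its real part and at least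
  \<open>|t|\<close> by its imaginary part; adding the two bounds, with \<open>c - p\<close> cut at
  1, produces the factor \<open>1 + |t|\<close>.\<close>

lemma norm_Complex_minus_real_ge:
  fixes c p :: real
  assumes "p < c"
  shows "norm (Complex c t - of_real p) \<ge> min 1 (c - p) / 2 * (1 + \<bar>t\<bar>)"
proof -
  define \<mu> where "\<mu> = min 1 (c - p)"
  have "\<mu> \<le> c - p" by (simp add: \<mu>_def)
  moreover have "c - p \<le> norm (Complex c t - of_real p)" using complex_Re_le_cmod[of "Complex c t - of_real p"] by simp
  moreover have "\<bar>t\<bar> \<le> norm (Complex c t - of_real p)" using abs_Im_le_cmod[of "Complex c t - of_real p"] by simp
  moreover have "\<mu> * \<bar>t\<bar> \<le> 1 * \<bar>t\<bar>" by (intro mult_right_mono) (auto simp: \<mu>_def)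
  ultimately have "\<mu> + \<mu> * \<bar>t\<bar> \<le> 2 * norm (Complex c t - of_real p)" by linarith
  thus ?thesis unfolding \<mu>_def[symmetric] by (simp add: algebra_simps)
qed

lemma vertical_line_nonzero:
  fixes c p t :: real
  assumes "p \<noteq> c"
  shows "of_real c + \<i> * of_real t - of_real p \<noteq> (0 :: complex)"
  using assms by (auto simp: complex_eq_iff)

section \<open>The Perron kernel with two real poles\<close>

lemma perron_kernel_integrable:
  fixes c p q u :: real
  assumes "p < c" "q < c"
  shows "integrable lborel (\<lambda>t. exp (of_real u * Complex c t) / ((Complex c t - of_real p) * (Complex c t - of_real q)))"
proof (rule integrable_powr_bound[where p = 2])
  let ?A = "min 1 (c - p) / 2" let ?B = "min 1 (c - q) / 2"
  have AB: "?A > 0" "?B > 0" using assms by auto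
  fix t :: real
  have "norm ((Complex c t - of_real p) * (Complex c t - of_real q)) \<ge> (?A * (1 + \<bar>t\<bar>)) * (?B * (1 + \<bar>t\<bar>))"
    unfolding norm_mult using assms AB by (intro mult_mono norm_Complex_minus_real_ge) auto
  moreover have "0 < (?A * (1 + \<bar>t\<bar>)) * (?B * (1 + \<bar>t\<bar>))" using AB by (intro mult_pos_pos) auto
  ultimately have "norm (exp (of_real u * Complex c t) / ((Complex c t - of_real p) * (Complex c t - of_real q)))
      \<le> exp (u * c) / ((?A * (1 + \<bar>t\<bar>)) * (?B * (1 + \<bar>t\<bar>)))"
    unfolding norm_divide by (intro frac_le) auto
  also have "\<dots> = (exp (u * c) / (?A * ?B)) * (1 + \<bar>t\<bar>) powr (-2)"
    by (simp add: powr_minus powr_numeral power2_eq_square field_simps)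
  finally show "norm (exp (of_real u * Complex c t) / ((Complex c t - of_real p) * (Complex c t - of_real q)))
      \<le> (exp (u * c) / (?A * ?B)) * (1 + \<bar>t\<bar>) powr (-2)" .
next
  have "continuous_on UNIV (\<lambda>t. exp (of_real u * (of_real c + \<i> * of_real t)) /
      (((of_real c + \<i> * of_real t) - of_real p) * ((of_real c + \<i> * of_real t) - of_real q)))"
    using assms by (intro continuous_intros) (use vertical_line_nonzero[of p c] vertical_line_nonzero[of q c] in simp)
  thus "(\<lambda>t. exp (of_real u * Complex c t) / ((Complex c t - of_real p) * (Complex c t - of_real q))) \<in> borel_measurable borel"
    unfolding Complex_eq by (rule borel_measurable_continuous_onI)
qed auto

text \<open>For \<open>u \<ge> 0\<close> the contour is closed to the left, where
  \<open>exp (u * s)\<close> does not exceed its size on \<open>Re s = c\<close>. Partial fractions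
  reduce the two residues to Cauchy's integral formula. General \<open>p\<close> and
  \<open>q\<close> are kept because both \<open>1 / (s * (s + 1))\<close> and
  \<open>1 / ((s - 1) * (s + 1))\<close> are needed.\<close>

lemma perron_kernel_nonneg:
  fixes c p q u :: real
  assumes pq: "p < c" "q < c" "p \<noteq> q" and c: "c > 0" and u: "u \<ge> 0"
  shows "(LINT t|lborel. exp (of_real u * Complex c t) / ((Complex c t - of_real p) * (Complex c t - of_real q)))
           = of_real (2 * pi * ((exp (u * p) - exp (u * q)) / (p - q)))"
proof -
  define f where "f = (\<lambda>s::complex. exp (of_real u * s) / ((s - of_real p) * (s - of_real q)))"
  define I where "I = of_real (2 * pi * ((exp (u * p) - exp (u * q)) / (p - q))) * \<i>"
  define B where "B = \<bar>p\<bar> + \<bar>q\<bar> + c"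
  define E where "E = exp (u * c)"
  have E1: "E \<ge> 1" using u c by (simp add: E_def)
  have den: "norm (f s) \<le> E / (D * D)" if "Re s \<le> c" "norm (s - of_real p) \<ge> D" "norm (s - of_real q) \<ge> D" "D > 0" for s D
  proof -
    have "norm (exp (of_real u * s)) \<le> E" using that u by (simp add: E_def mult_left_mono)
    moreover have "norm ((s - of_real p) * (s - of_real q)) \<ge> D * D"
      unfolding norm_mult using that by (intro mult_mono) auto
    ultimately show ?thesis unfolding f_def norm_divide using that E1 by (intro frac_le) auto
  qed
  \<comment> \<open>\<open>T > 2 * B + 1\<close> puts both poles strictly inside the rectangle and
    keeps its left side at distance at least \<open>T - B > 0\<close> from them.\<close>
  have bd: "norm (I - \<i> * integral {-T..T} (\<lambda>t. f (Complex c t))) \<le> 2 * (c + T) * (E / (T * T)) + (E / ((T - B) * (T - B))) * (2 * T)"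
    if T: "T > 2 * B + 1" for T
  proof -
    have B: "B > 0" "\<bar>p\<bar> \<le> B" "\<bar>q\<bar> \<le> B" "c \<le> B" using c by (auto simp: B_def)
    have T0: "T > 0" "- T < c" using T B c by auto
    let ?R = "rectpath (Complex (-T) (-T)) (Complex c T)"
    have inbox: "of_real z \<in> box (Complex (-T) (-T)) (Complex c T)" if "\<bar>z\<bar> \<le> B" "z < c" for z
      using that T T0 B by (auto simp: in_box_complex_iff)
    have nin: "of_real z \<notin> path_image ?R" if "\<bar>z\<bar> \<le> B" "z < c" for z
      using inbox[OF that] T0 by (subst path_image_rectpath_cbox_minus_box) auto
    have K: "((\<lambda>s. exp (of_real u * s) / (s - of_real z)) has_contour_integral (2 * pi * \<i> * exp (of_real u * of_real z))) ?R"
      if "\<bar>z\<bar> \<le> B" "z < c" for z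
    proof -
      have "((\<lambda>s. exp (of_real u * s) / (s - of_real z)) has_contour_integral
          (2 * pi * \<i> * winding_number ?R (of_real z) * exp (of_real u * of_real z))) ?R"
        by (rule Cauchy_integral_formula_convex_simple[of UNIV]) (use nin[OF that] in \<open>auto intro!: holomorphic_intros\<close>)
      thus ?thesis by (simp add: winding_number_rectpath[OF inbox[OF that]])
    qed
    have "((\<lambda>s. (exp (of_real u * s) / (s - of_real p) - exp (of_real u * s) / (s - of_real q)) * (1 / of_real (p - q))) has_contour_integral
       (2 * pi * \<i> * exp (of_real u * of_real p) - 2 * pi * \<i> * exp (of_real u * of_real q)) * (1 / of_real (p - q))) ?R"
      by (intro has_contour_integral_rmul has_contour_integral_diff K) (use B pq in auto)
    moreover have "(2 * pi * \<i> * exp (of_real u * of_real p) - 2 * pi * \<i> * exp (of_real u * of_real q)) * (1 / of_real (p - q)) = I"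
      by (simp add: I_def exp_of_real[symmetric] field_simps)
    ultimately have "((\<lambda>s. (exp (of_real u * s) / (s - of_real p) - exp (of_real u * s) / (s - of_real q)) * (1 / of_real (p - q))) has_contour_integral I) ?R"
      by simp
    hence hI: "(f has_contour_integral I) ?R"
    proof (rule has_contour_integral_eq)
      fix s assume "s \<in> path_image ?R"
      hence "s - of_real p \<noteq> 0" "s - of_real q \<noteq> 0" using nin[of p] nin[of q] B pq by auto
      moreover have "of_real (p - q) \<noteq> (0 :: complex)" using pq by simp
      ultimately show "(exp (of_real u * s) / (s - of_real p) - exp (of_real u * s) / (s - of_real q)) * (1 / of_real (p - q)) = f s"
        unfolding f_def by (simp add: divide_simps) (simp add: algebra_simps)
    qed
    have cf: "continuous_on (path_image ?R) f" unfolding f_def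
      using nin[of p] nin[of q] B pq by (intro continuous_intros) auto
    have "norm (I - \<i> * integral {-T..T} (\<lambda>t. f (Complex c t)) + \<i> * integral {-T..T} (\<lambda>t. f (Complex (-T) t))) \<le>
        2 * (c - - T) * (E / (T * T))"
    proof (rule rectangle_contour_bound[OF T0(2,1) cf hI])
      fix s assume s: "- T \<le> Re s" "Re s \<le> c" "\<bar>Im s\<bar> = T"
      show "norm (f s) \<le> E / (T * T)"
        using s T0 abs_Im_le_cmod[of "s - of_real p"] abs_Im_le_cmod[of "s - of_real q"] by (intro den) auto
    qed
    moreover have "norm (integral (cbox (-T) T) (\<lambda>t. f (Complex (-T) t))) \<le> (E / ((T - B) * (T - B))) * measure lborel (cbox (-T) T)"
    proof (rule integrable_bound)
      show "0 \<le> E / ((T - B) * (T - B))" using E1 by simp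
      have "continuous_on {-T..T} (\<lambda>t. exp (of_real u * (of_real (-T) + \<i> * of_real t)) /
        (((of_real (-T) + \<i> * of_real t) - of_real p) * ((of_real (-T) + \<i> * of_real t) - of_real q)))"
        using T B by (intro continuous_intros) (use vertical_line_nonzero[of p "-T"] vertical_line_nonzero[of q "-T"] in simp)
      hence "(\<lambda>t. f (Complex (-T) t)) integrable_on {-T..T}"
        unfolding Complex_eq f_def by (rule integrable_continuous_interval)
      thus "(\<lambda>t. f (Complex (-T) t)) integrable_on cbox (-T) T" by simp
      fix t assume "t \<in> cbox (-T) T"
      show "norm (f (Complex (-T) t)) \<le> E / ((T - B) * (T - B))"
        using T B c abs_Re_le_cmod[of "Complex (-T) t - of_real p"] abs_Re_le_cmod[of "Complex (-T) t - of_real q"]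
        by (intro den) auto
    qed
    ultimately have 1: "norm (I - \<i> * integral {-T..T} (\<lambda>t. f (Complex c t)) + \<i> * integral {-T..T} (\<lambda>t. f (Complex (-T) t))) \<le>
        2 * (c + T) * (E / (T * T))" and 2: "norm (\<i> * integral {-T..T} (\<lambda>t. f (Complex (-T) t))) \<le> (E / ((T - B) * (T - B))) * (2 * T)"
      using T0 by (auto simp: norm_mult)
    show ?thesis using norm_triangle_ineq4[of "I - \<i> * integral {-T..T} (\<lambda>t. f (Complex c t)) + \<i> * integral {-T..T} (\<lambda>t. f (Complex (-T) t))"
       "\<i> * integral {-T..T} (\<lambda>t. f (Complex (-T) t))"] 1 2 by simp
  qed
  have int: "integrable lborel (\<lambda>t. f (Complex c t))" unfolding f_def by (rule perron_kernel_integrable) (use pq in auto)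
  have "(\<lambda>n. norm (I - \<i> * integral {-real n..real n} (\<lambda>t. f (Complex c t)))) \<longlonglongrightarrow> norm (I - \<i> * (LINT t|lborel. f (Complex c t)))"
    by (intro tendsto_intros integral_symmetric_tendsto int)
  moreover have "(\<lambda>n. 2 * (c + real n) * (E / (real n * real n)) + (E / ((real n - B) * (real n - B))) * (2 * real n)) \<longlonglongrightarrow> 0"
    by real_asymp
  ultimately have "norm (I - \<i> * (LINT t|lborel. f (Complex c t))) \<le> 0"
  proof (rule LIMSEQ_le)
    show "\<exists>N. \<forall>n\<ge>N. norm (I - \<i> * integral {-real n..real n} (\<lambda>t. f (Complex c t))) \<le>
       2 * (c + real n) * (E / (real n * real n)) + (E / ((real n - B) * (real n - B))) * (2 * real n)"
      by (rule exI[of _ "nat \<lceil>2 * B + 2\<rceil>"]) (intro allI impI bd, linarith)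
  qed
  hence "\<i> * (LINT t|lborel. f (Complex c t)) = \<i> * of_real (2 * pi * ((exp (u * p) - exp (u * q)) / (p - q)))"
    by (simp add: I_def mult_ac)
  hence "(LINT t|lborel. f (Complex c t)) = of_real (2 * pi * ((exp (u * p) - exp (u * q)) / (p - q)))"
    by (simp only: mult_left_cancel[OF complex_i_not_zero])
  thus ?thesis unfolding f_def .
qed

text \<open>For \<open>u \<le> 0\<close> the factor \<open>exp (u * s)\<close> does not grow to the
  right of \<open>Re s = c\<close>, and closing the contour there encloses no pole. At
  \<open>u = 0\<close> both evaluations give 0.\<close>

lemma perron_kernel_nonpos:
  fixes c p q u :: real
  assumes pq: "p < c" "q < c" and u: "u \<le> 0"
  shows "(LINT t|lborel. exp (of_real u * Complex c t) / ((Complex c t - of_real p) * (Complex c t - of_real q))) = 0"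
proof -
  define f where "f = (\<lambda>s::complex. exp (of_real u * s) / ((s - of_real p) * (s - of_real q)))"
  define E where "E = exp (u * c)"
  have E0: "E > 0" by (simp add: E_def)
  have den: "norm (f s) \<le> E / (T * T)" if "Re s \<ge> c" "norm (s - of_real p) \<ge> T" "norm (s - of_real q) \<ge> T" "T > 0" for s T
  proof -
    have "norm (exp (of_real u * s)) \<le> E" using that u by (simp add: E_def mult_left_mono_neg)
    moreover have "norm ((s - of_real p) * (s - of_real q)) \<ge> T * T"
      unfolding norm_mult using that by (intro mult_mono) auto
    ultimately show ?thesis unfolding f_def norm_divide using that E0 by (intro frac_le) auto
  qed
  define S where "S = {s. Re s \<ge> c}"
  have S: "convex S" unfolding S_def by (rule convex_halfspace_Re_ge)
  have hol: "f holomorphic_on S" unfolding f_def S_def using pq by (intro holomorphic_intros) auto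
  have bd: "norm (integral {-T..T} (\<lambda>t. f (Complex c t))) \<le> 2 * T * (E / (T * T)) + (E / (T * T)) * (2 * T)"
    if T0: "T > 0" for T
  proof -
    let ?R = "rectpath (Complex c (-T)) (Complex (c + T) T)"
    have sub: "path_image ?R \<subseteq> S"
      using path_image_rectpath_subset_cbox[of "Complex c (-T)" "Complex (c + T) T"] T0
      by (auto simp: in_cbox_complex_iff S_def)
    have I: "(f has_contour_integral 0) ?R"
      by (rule Cauchy_theorem_convex_simple[OF hol S _ sub]) auto
    have cf: "continuous_on (path_image ?R) f"
      using holomorphic_on_imp_continuous_on[OF hol] continuous_on_subset[OF _ sub] by blast
    have "norm (0 - \<i> * integral {-T..T} (\<lambda>t. f (Complex (c + T) t)) + \<i> * integral {-T..T} (\<lambda>t. f (Complex c t))) \<le>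
        2 * ((c + T) - c) * (E / (T * T))"
    proof (rule rectangle_contour_bound[OF _ T0 cf I])
      fix s assume s: "c \<le> Re s" "Re s \<le> c + T" "\<bar>Im s\<bar> = T"
      show "norm (f s) \<le> E / (T * T)"
        using s T0 abs_Im_le_cmod[of "s - of_real p"] abs_Im_le_cmod[of "s - of_real q"] by (intro den) auto
    qed (use T0 in auto)
    moreover have "norm (integral (cbox (-T) T) (\<lambda>t. f (Complex (c + T) t))) \<le> (E / (T * T)) * measure lborel (cbox (-T) T)"
    proof (rule integrable_bound)
      show "0 \<le> E / (T * T)" using E0 by simp
      have "continuous_on {-T..T} (\<lambda>t. exp (of_real u * (of_real (c + T) + \<i> * of_real t)) /
        (((of_real (c + T) + \<i> * of_real t) - of_real p) * ((of_real (c + T) + \<i> * of_real t) - of_real q)))"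
        using T0 pq by (intro continuous_intros) (use vertical_line_nonzero[of p "c + T"] vertical_line_nonzero[of q "c + T"] in simp)
      hence "(\<lambda>t. f (Complex (c + T) t)) integrable_on {-T..T}"
        unfolding Complex_eq f_def by (rule integrable_continuous_interval)
      thus "(\<lambda>t. f (Complex (c + T) t)) integrable_on cbox (-T) T" by simp
      fix t assume "t \<in> cbox (-T) T"
      show "norm (f (Complex (c + T) t)) \<le> E / (T * T)"
        using T0 pq abs_Re_le_cmod[of "Complex (c + T) t - of_real p"] abs_Re_le_cmod[of "Complex (c + T) t - of_real q"]
        by (intro den) auto
    qed
    ultimately have 1: "norm (\<i> * integral {-T..T} (\<lambda>t. f (Complex c t)) - \<i> * integral {-T..T} (\<lambda>t. f (Complex (c + T) t))) \<le>
        2 * T * (E / (T * T))" and 2: "norm (\<i> * integral {-T..T} (\<lambda>t. f (Complex (c + T) t))) \<le> (E / (T * T)) * (2 * T)"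
      using T0 by (auto simp: norm_mult)
    have "norm (\<i> * integral {-T..T} (\<lambda>t. f (Complex c t))) \<le> 2 * T * (E / (T * T)) + (E / (T * T)) * (2 * T)"
      using norm_triangle_ineq[of "\<i> * integral {-T..T} (\<lambda>t. f (Complex c t)) - \<i> * integral {-T..T} (\<lambda>t. f (Complex (c + T) t))"
       "\<i> * integral {-T..T} (\<lambda>t. f (Complex (c + T) t))"] 1 2 by simp
    thus ?thesis by (simp only: norm_mult norm_ii mult_1)
  qed
  have int: "integrable lborel (\<lambda>t. f (Complex c t))" unfolding f_def by (rule perron_kernel_integrable) (use pq in auto)
  have "(\<lambda>n. norm (integral {-real n..real n} (\<lambda>t. f (Complex c t)))) \<longlonglongrightarrow> norm (LINT t|lborel. f (Complex c t))"
    by (intro tendsto_intros integral_symmetric_tendsto int)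
  moreover have "(\<lambda>n. 2 * real n * (E / (real n * real n)) + (E / (real n * real n)) * (2 * real n)) \<longlonglongrightarrow> 0"
    by real_asymp
  ultimately have "norm (LINT t|lborel. f (Complex c t)) \<le> 0"
    by (rule LIMSEQ_le) (use bd in \<open>auto intro!: exI[of _ 1]\<close>)
  thus ?thesis unfolding f_def by simp
qed

text \<open>This is \<open>exp (- u)\<close> times the integral of \<open>psi x - m x\<close> over \<open>[1, exp u]\<close>.\<close>
definition perron_mean :: "(nat \<Rightarrow> complex) \<Rightarrow> nat \<Rightarrow> real \<Rightarrow> complex" where
  "perron_mean Lam m u = (\<Sum>n\<in>{1..nat \<lfloor>exp u\<rfloor>}. Lam n * of_real (1 - real n * exp (- u)))
     - of_nat m * of_real ((exp u - exp (- u)) / 2)"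

text \<open>With \<open>1 / (s * (s + 1))\<close> in place of \<open>1 / s\<close> every integral
  converges absolutely, so the series may be integrated termwise; the price is that
  \<open>psi\<close> appears averaged. Up to the factor \<open>2 * pi\<close>, the kernel at
  \<open>u - ln n\<close> contributes \<open>1 - n * exp (- u)\<close> for
  \<open>n \<le> exp u\<close> and nothing for larger \<open>n\<close>.\<close>

lemma perron_sum:
  fixes Lam :: "nat \<Rightarrow> complex"
  assumes S: "summable (\<lambda>n. norm (Lam n) / real n powr 3)" and u: "u \<ge> 0"
  defines "g \<equiv> (\<lambda>t. (\<Sum>n. Lam n / of_nat n powr Complex 3 t) * (exp (of_real u * Complex 3 t) / (Complex 3 t * (Complex 3 t + 1))))"
  shows "integrable lborel g"
    and "(LINT t|lborel. g t) = of_real (2 * pi) * (\<Sum>n\<in>{1..nat \<lfloor>exp u\<rfloor>}. Lam n * of_real (1 - real n * exp (- u)))"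
proof -
  define k where "k = (\<lambda>v t. exp (of_real v * Complex 3 t) / ((Complex 3 t - of_real 0) * (Complex 3 t - of_real (-1))))"
  have kint: "integrable lborel (k v)" for v unfolding k_def by (rule perron_kernel_integrable) auto
  define f where "f = (\<lambda>n t. if n = 0 then 0 else Lam n * k (u - ln (real n)) t)"
  have fint: "integrable lborel (f n)" for n unfolding f_def using kint[of "u - ln (real n)"] by (cases "n = 0") auto
  have feq: "f n t = Lam n / of_nat n powr Complex 3 t * k u t" for n t
  proof (cases "n = 0")
    case False
    have "exp (of_real (u - ln (real n)) * Complex 3 t) = exp (of_real u * Complex 3 t - Complex 3 t * of_real (ln (real n)))"
      by (simp add: algebra_simps)
    also have "\<dots> = exp (of_real u * Complex 3 t) / of_nat n powr Complex 3 t"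
      using False by (simp add: exp_diff powr_def Ln_of_nat)
    finally show ?thesis using False by (simp add: f_def k_def)
  qed (simp add: f_def)
  have fnorm: "norm (f n t) = norm (Lam n) / real n powr 3 * norm (k u t)" for n t
    unfolding feq by (simp add: norm_mult norm_divide norm_powr_real_powr)
  have s1: "summable (\<lambda>n. norm (f n t))" for t unfolding fnorm using S by (rule summable_mult2)
  have s2: "summable (\<lambda>n. LINT t|lborel. norm (f n t))" 
  proof -
    have *: "(LINT t|lborel. norm (f n t)) = norm (Lam n) / real n powr 3 * (LINT t|lborel. norm (k u t))" for n
      unfolding fnorm by simp
    show ?thesis unfolding * by (rule summable_mult2[OF S])
  qed
  have geq: "g t = (\<Sum>n. f n t)" for t
  proof -
    have "summable (\<lambda>n. norm (Lam n / of_nat n powr Complex 3 t))"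
      using S by (simp add: norm_divide norm_powr_real_powr)
    hence "(\<Sum>n. Lam n / of_nat n powr Complex 3 t * k u t) = (\<Sum>n. Lam n / of_nat n powr Complex 3 t) * k u t"
      by (rule suminf_mult2[OF summable_norm_cancel, symmetric])
    thus ?thesis by (simp add: feq g_def k_def)
  qed
  show "integrable lborel g" unfolding geq by (rule integrable_suminf[OF fint]) (use s1 s2 in auto)
  have "(LINT t|lborel. g t) = (\<Sum>n. LINT t|lborel. f n t)"
    unfolding geq by (rule integral_suminf[OF fint]) (use s1 s2 in auto)
  also have "\<dots> = (\<Sum>n\<in>{1..nat \<lfloor>exp u\<rfloor>}. LINT t|lborel. f n t)"
  proof (rule suminf_finite)
    fix n assume n: "n \<notin> {1..nat \<lfloor>exp u\<rfloor>}"
    show "(LINT t|lborel. f n t) = 0"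
    proof (cases "n = 0")
      case False
      hence "real n > exp u" using n by (auto simp: le_nat_iff le_floor_iff)
      hence "ln (exp u) < ln (real n)" using False by (subst ln_less_cancel_iff) auto
      hence "u - ln (real n) \<le> 0" by simp
      hence "(LINT t|lborel. k (u - ln (real n)) t) = 0" unfolding k_def by (intro perron_kernel_nonpos) auto
      thus ?thesis using False by (simp add: f_def)
    qed (simp add: f_def)
  qed auto
  also have "\<dots> = (\<Sum>n\<in>{1..nat \<lfloor>exp u\<rfloor>}. of_real (2 * pi) * (Lam n * of_real (1 - real n * exp (- u))))"
  proof (intro sum.cong refl)
    fix n assume n: "n \<in> {1..nat \<lfloor>exp u\<rfloor>}"
    hence n0: "n > 0" "real n \<le> exp u" by (auto simp: le_nat_iff le_floor_iff)
    hence "ln (real n) \<le> u" by (metis ln_exp ln_mono of_nat_0_less_iff)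
    hence "(LINT t|lborel. k (u - ln (real n)) t) = of_real (2 * pi * ((exp ((u - ln (real n)) * 0) - exp ((u - ln (real n)) * (-1))) / (0 - (-1))))"
      unfolding k_def by (intro perron_kernel_nonneg) auto
    also have "exp ((u - ln (real n)) * (-1)) = real n * exp (- u)"
      using n0 by (simp add: exp_diff exp_minus field_simps)
    finally show "(LINT t|lborel. f n t) = of_real (2 * pi) * (Lam n * of_real (1 - real n * exp (- u)))"
      using n0 by (simp add: f_def)
  qed
  also have "\<dots> = of_real (2 * pi) * (\<Sum>n\<in>{1..nat \<lfloor>exp u\<rfloor>}. Lam n * of_real (1 - real n * exp (- u)))"
    by (simp add: sum_distrib_left)
  finally show "(LINT t|lborel. g t) = of_real (2 * pi) * (\<Sum>n\<in>{1..nat \<lfloor>exp u\<rfloor>}. Lam n * of_real (1 - real n * exp (- u)))" .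
qed

text \<open>Multiplied by \<open>1 / (s * (s + 1))\<close>, the term \<open>m * s / (s - 1)\<close>
  becomes \<open>m / ((s - 1) * (s + 1))\<close>, whose transform is the mean of
  \<open>m * x\<close>. Subtracting it removes the pole at 1 before the line of integration is
  moved.\<close>

lemma perron_formula:
  fixes Lam :: "nat \<Rightarrow> complex"
  assumes S: "summable (\<lambda>n. norm (Lam n) / real n powr 3)" and u: "u \<ge> 0"
    and H: "\<And>t. H (Complex 3 t) = (\<Sum>n. Lam n / of_nat n powr Complex 3 t) - of_nat m * Complex 3 t / (Complex 3 t - 1)"
  defines "g \<equiv> (\<lambda>t. H (Complex 3 t) * (exp (of_real u * Complex 3 t) / (Complex 3 t * (Complex 3 t + 1))))"
  shows "integrable lborel g" and "(LINT t|lborel. g t) = of_real (2 * pi) * perron_mean Lam m u"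
proof -
  define g1 where "g1 = (\<lambda>t. (\<Sum>n. Lam n / of_nat n powr Complex 3 t) * (exp (of_real u * Complex 3 t) / (Complex 3 t * (Complex 3 t + 1))))"
  define k where "k = (\<lambda>t. exp (of_real u * Complex 3 t) / ((Complex 3 t - of_real 1) * (Complex 3 t - of_real (-1))))"
  have kint: "integrable lborel k" unfolding k_def by (rule perron_kernel_integrable) auto
  have kI: "(LINT t|lborel. k t) = of_real (2 * pi * ((exp (u * 1) - exp (u * (-1))) / (1 - (-1))))"
    unfolding k_def using u by (intro perron_kernel_nonneg) auto
  have g1: "integrable lborel g1" "(LINT t|lborel. g1 t) = of_real (2 * pi) * (\<Sum>n\<in>{1..nat \<lfloor>exp u\<rfloor>}. Lam n * of_real (1 - real n * exp (- u)))"
    using perron_sum[OF S u] unfolding g1_def by auto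
  have geq: "g = (\<lambda>t. g1 t - of_nat m * k t)"
  proof
    fix t
    define s where "s = Complex 3 t"
    have nz: "s \<noteq> 0" "s - 1 \<noteq> 0" "s + 1 \<noteq> 0" by (auto simp: s_def complex_eq_iff)
    show "g t = g1 t - of_nat m * k t"
      unfolding g_def g1_def k_def H s_def[symmetric] using nz by (simp add: divide_simps) (simp add: algebra_simps)
  qed
  show "integrable lborel g" unfolding geq using g1 kint by auto
  show "(LINT t|lborel. g t) = of_real (2 * pi) * perron_mean Lam m u"
  proof -
    have "(LINT t|lborel. g t) = (LINT t|lborel. g1 t) - of_nat m * (LINT t|lborel. k t)"
      unfolding geq using g1(1) kint by simp
    also have "\<dots> = of_real (2 * pi) * perron_mean Lam m u"
      unfolding g1(2) kI by (simp add: perron_mean_def algebra_simps)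
    finally show ?thesis .
  qed
qed

lemma norm_perron_factor_le:
  assumes "Re s \<ge> 1/2"
  shows "norm (1 / (s * (s + 1))) \<le> 8 * (1 + \<bar>Im s\<bar>) powr (-2)"
proof -
  have "1/4 * (1 + \<bar>Im s\<bar>) \<le> min 1 (Re s - 0) / 2 * (1 + \<bar>Im s\<bar>)" using assms by (intro mult_right_mono) auto
  also have "\<dots> \<le> norm (Complex (Re s) (Im s) - of_real 0)" using assms by (intro norm_Complex_minus_real_ge) auto
  finally have 1: "1/4 * (1 + \<bar>Im s\<bar>) \<le> norm s" by simp
  have "1/2 * (1 + \<bar>Im s\<bar>) \<le> min 1 (Re s - (-1)) / 2 * (1 + \<bar>Im s\<bar>)" using assms by (intro mult_right_mono) auto
  also have "\<dots> \<le> norm (Complex (Re s) (Im s) - of_real (-1))" using assms by (intro norm_Complex_minus_real_ge) auto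
  finally have 2: "1/2 * (1 + \<bar>Im s\<bar>) \<le> norm (s + 1)" by simp
  have "(1/4 * (1 + \<bar>Im s\<bar>)) * (1/2 * (1 + \<bar>Im s\<bar>)) \<le> norm (s * (s + 1))"
    unfolding norm_mult using 1 2 by (intro mult_mono) auto
  hence "norm (1 / (s * (s + 1))) \<le> 1 / ((1/4 * (1 + \<bar>Im s\<bar>)) * (1/2 * (1 + \<bar>Im s\<bar>)))"
    unfolding norm_divide by (intro frac_le) (auto intro!: mult_pos_pos)
  also have "\<dots> = 8 * (1 + \<bar>Im s\<bar>) powr (-2)"
    by (simp add: powr_minus powr_numeral power2_eq_square field_simps)
  finally show ?thesis .
qed

text \<open>The decay \<open>(1 + |t|) powr (-2)\<close> of the kernel against growth with exponent
  \<open>\<alpha> < 1\<close> leaves an integrable function on the new line and makes the horizontal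
  sides vanish in the limit.\<close>

lemma perron_formula_shifted:
  fixes Lam :: "nat \<Rightarrow> complex"
  assumes S: "summable (\<lambda>n. norm (Lam n) / real n powr 3)" and u: "u \<ge> 0"
    and H: "\<And>t. H (Complex 3 t) = (\<Sum>n. Lam n / of_nat n powr Complex 3 t) - of_nat m * Complex 3 t / (Complex 3 t - 1)"
    and hol: "H holomorphic_on {s. Re s > 1/2}"
    and \<sigma>: "1/2 < \<sigma>" "\<sigma> < 3" and \<alpha>: "\<alpha> < 1"
    and bd: "\<And>s. \<sigma> \<le> Re s \<Longrightarrow> Re s \<le> 3 \<Longrightarrow> norm (H s) \<le> C * (1 + \<bar>Im s\<bar>) powr \<alpha>"
  defines "g \<equiv> (\<lambda>t. H (Complex \<sigma> t) * (exp (of_real u * Complex \<sigma> t) / (Complex \<sigma> t * (Complex \<sigma> t + 1))))"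
  shows "integrable lborel g" and "(LINT t|lborel. g t) = of_real (2 * pi) * perron_mean Lam m u"
proof -
  define f where "f = (\<lambda>s. H s * (exp (of_real u * s) / (s * (s + 1))))"
  have holf: "f holomorphic_on {s. Re s > 1/2}" unfolding f_def
    by (intro holomorphic_intros hol) (auto simp: add_eq_0_iff2)
  have fb: "norm (f s) \<le> (8 * exp (3 * u) * C) * (1 + \<bar>Im s\<bar>) powr (-(2 - \<alpha>))" if s: "\<sigma> \<le> Re s" "Re s \<le> 3" for s
  proof -
    have "norm (f s) = norm (H s) * (norm (exp (of_real u * s)) * norm (1 / (s * (s + 1))))"
      by (simp add: f_def norm_mult norm_divide)
    also have "\<dots> \<le> (C * (1 + \<bar>Im s\<bar>) powr \<alpha>) * (exp (3 * u) * (8 * (1 + \<bar>Im s\<bar>) powr (-2)))"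
      using s \<sigma> u bd[OF s] order_trans[OF norm_ge_zero bd[OF s]]
      by (intro mult_mono norm_perron_factor_le) (auto simp: mult.commute[of u] mult_right_mono)
    also have "\<dots> = (8 * exp (3 * u) * C) * ((1 + \<bar>Im s\<bar>) powr \<alpha> * (1 + \<bar>Im s\<bar>) powr (-2))" by simp
    also have "(1 + \<bar>Im s\<bar>) powr \<alpha> * (1 + \<bar>Im s\<bar>) powr (-2) = (1 + \<bar>Im s\<bar>) powr (-(2 - \<alpha>))"
      by (simp flip: powr_add)
    finally show ?thesis .
  qed
  have "continuous_on UNIV (\<lambda>t. f (of_real \<sigma> + \<i> * of_real t))"
    by (intro continuous_on_compose2[OF holomorphic_on_imp_continuous_on[OF holf]] continuous_intros) (use \<sigma> in auto)
  hence meas: "(\<lambda>t. f (Complex \<sigma> t)) \<in> borel_measurable borel"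
    unfolding Complex_eq by (rule borel_measurable_continuous_onI)
  have ia: "integrable lborel (\<lambda>t. f (Complex \<sigma> t))"
  proof (rule integrable_powr_bound[OF meas])
    show "2 - \<alpha> > 1" using \<alpha> by simp
    fix t
    show "norm (f (Complex \<sigma> t)) \<le> (8 * exp (3 * u) * C) * (1 + \<bar>t\<bar>) powr (-(2 - \<alpha>))"
      using fb[of "Complex \<sigma> t"] \<sigma> by simp
  qed
  have ib: "integrable lborel (\<lambda>t. f (Complex 3 t))" and Ib: "(LINT t|lborel. f (Complex 3 t)) = of_real (2 * pi) * perron_mean Lam m u"
    using perron_formula[OF S u H] unfolding f_def by auto
  have geq: "g = (\<lambda>t. f (Complex \<sigma> t))" by (simp add: g_def f_def)
  show "integrable lborel g" unfolding geq by (rule ia)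
  have "(LINT t|lborel. f (Complex \<sigma> t)) = (LINT t|lborel. f (Complex 3 t))"
  proof (rule vertical_line_shift[OF \<sigma>(2) _ _ holf _ _ ia ib])
    show "convex {s. Re s > 1/2}" by (rule convex_halfspace_Re_gt)
    show "{s. \<sigma> \<le> Re s \<and> Re s \<le> 3} \<subseteq> {s. 1/2 < Re s}" using \<sigma> by auto
    show "((\<lambda>T. (8 * exp (3 * u) * C) * (1 + T) powr (-(2 - \<alpha>))) \<longlongrightarrow> 0) at_top"
      using \<alpha> by real_asymp
  qed (use fb in auto)
  thus "(LINT t|lborel. g t) = of_real (2 * pi) * perron_mean Lam m u" unfolding geq Ib .
qed

section \<open>The mean square in multiplicatively short intervals\<close>

lemma nn_integral_gaussian_shift:
  fixes R t :: real
  assumes "R > 0"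
  shows "(\<integral>\<^sup>+t'. ennreal (exp (-((R * (t - t'))\<^sup>2) / 2)) \<partial>lborel) = ennreal (sqrt (2 * pi) / R)"
proof -
  have 1: "(\<integral>\<^sup>+x. ennreal (std_normal_density x) \<partial>lborel) = 1"
  proof -
    interpret prob_space "density lborel (\<lambda>x. ennreal (std_normal_density x))"
      by (rule prob_space_normal_density) simp
    show ?thesis using emeasure_space_1 by (simp add: emeasure_density)
  qed
  have "(\<integral>\<^sup>+x. ennreal (std_normal_density x) \<partial>lborel) = ennreal \<bar>-R\<bar> * (\<integral>\<^sup>+x. ennreal (std_normal_density (R * t + (-R) * x)) \<partial>lborel)"
    using assms by (intro nn_integral_real_affine) auto
  also have "(\<integral>\<^sup>+x. ennreal (std_normal_density (R * t + (-R) * x)) \<partial>lborel) =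
      (\<integral>\<^sup>+x. ennreal (1 / sqrt (2 * pi)) * ennreal (exp (-((R * (t - x))\<^sup>2) / 2)) \<partial>lborel)"
    by (intro nn_integral_cong) (simp add: std_normal_density_def algebra_simps flip: ennreal_mult)
  also have "\<dots> = ennreal (1 / sqrt (2 * pi)) * (\<integral>\<^sup>+x. ennreal (exp (-((R * (t - x))\<^sup>2) / 2)) \<partial>lborel)"
    by (intro nn_integral_cmult) measurable
  finally have 2: "ennreal (R / sqrt (2 * pi)) * (\<integral>\<^sup>+x. ennreal (exp (-((R * (t - x))\<^sup>2) / 2)) \<partial>lborel) = 1"
    using assms 1 by (simp add: mult.assoc[symmetric] ennreal_mult[symmetric])
  have "(\<integral>\<^sup>+x. ennreal (exp (-((R * (t - x))\<^sup>2) / 2)) \<partial>lborel) =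
      ennreal (sqrt (2 * pi) / R) * (ennreal (R / sqrt (2 * pi)) * (\<integral>\<^sup>+x. ennreal (exp (-((R * (t - x))\<^sup>2) / 2)) \<partial>lborel))"
    using assms by (simp add: mult.assoc[symmetric] ennreal_mult[symmetric])
  thus ?thesis using 2 by simp
qed

text \<open>Expanding the square and integrating first over the normal variable turns the
  oscillating factor into the characteristic function of the normal law, a positive kernel in
  \<open>t - t'\<close> of total mass \<open>sqrt (2 * pi) / R\<close>. The inequality between
  arithmetic and geometric mean then decouples the two variables. The right-hand side may be
  infinite, hence the form in \<open>ennreal\<close>.\<close>

lemma gaussian_mean_square_le:
  fixes \<Phi> :: "real \<Rightarrow> complex"
  assumes \<Phi>: "integrable lborel \<Phi>" and R: "R > 0"
  defines "f \<equiv> (\<lambda>u. LINT t|lborel. \<Phi> t * iexp (t * u))"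
  shows "(\<integral>\<^sup>+z. ennreal ((norm (f (R * z)))\<^sup>2) \<partial>std_normal_distribution) \<le>
           ennreal (sqrt (2 * pi) / R) * (\<integral>\<^sup>+t. ennreal ((norm (\<Phi> t))\<^sup>2) \<partial>lborel)"
proof -
  define N where "N = std_normal_distribution"
  interpret N: real_distribution N unfolding N_def by (rule real_dist_normal_dist)
  have [measurable]: "\<Phi> \<in> borel_measurable borel" using \<Phi> by simp
  have [measurable_cong]: "sets N = sets borel" by simp
  define J where "J = (LINT t|lborel. norm (\<Phi> t))"
  define w where "w = (\<lambda>p::real\<times>real. \<Phi> (fst p) * cnj (\<Phi> (snd p)))"
  have [measurable]: "(\<lambda>t. cnj (\<Phi> t)) \<in> borel_measurable borel"
    by (rule measurable_compose[of \<Phi> borel borel cnj]) (auto intro!: borel_measurable_continuous_onI continuous_intros)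
  have [measurable]: "w \<in> borel_measurable borel" unfolding w_def borel_prod[symmetric] by measurable
  have wint: "integrable (lborel :: (real \<times> real) measure) w"
    unfolding lborel_prod[symmetric]
  proof (rule lborel_pair.Fubini_integrable)
    show "w \<in> borel_measurable (lborel \<Otimes>\<^sub>M lborel)" by (simp add: lborel_prod)
    show "integrable lborel (\<lambda>x. LINT y|lborel. norm (w (x, y)))"
      using \<Phi> by (simp add: w_def norm_mult)
    show "AE x in lborel. integrable lborel (\<lambda>y. w (x, y))"
      using \<Phi> by (simp add: w_def)
  qed
  have [measurable]: "fst \<in> borel_measurable (borel :: (real \<times> real) measure)" "snd \<in> borel_measurable (borel :: (real \<times> real) measure)"
    by (auto intro!: borel_measurable_continuous_onI continuous_intros)
  define W where "W = (\<lambda>zp::real\<times>(real\<times>real). w (snd zp) * iexp (R * (fst (snd zp) - snd (snd zp)) * fst zp))"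
  interpret P: pair_sigma_finite N "lborel :: (real \<times> real) measure" ..
  have [measurable]: "W \<in> borel_measurable (N \<Otimes>\<^sub>M lborel)" 
    unfolding W_def by measurable
  have normW: "norm (W (z, p)) = norm (w p)" for z p by (simp add: W_def norm_mult)
  have Wsec: "integrable lborel (\<lambda>p. W (z, p))" for z
    by (rule Bochner_Integration.integrable_bound[OF wint]) (auto simp: normW)
  have Wint: "integrable (N \<Otimes>\<^sub>M lborel) W"
    by (rule P.Fubini_integrable) (auto simp: normW Wsec)
  have ff: "complex_of_real ((norm (f (R * z)))\<^sup>2) = (LINT p|lborel. W (z, p))" for z
  proof -
    have i1: "integrable lborel (\<lambda>t. \<Phi> t * iexp (t * (R * z)))"
      by (rule Bochner_Integration.integrable_bound[OF \<Phi>]) (auto simp: norm_mult)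
    have "(LINT p|lborel. W (z, p)) = (LINT t|lborel. LINT t'|lborel. W (z, (t, t')))"
      using Wsec[of z] unfolding lborel_prod[symmetric] by (subst lborel_pair.integral_fst') auto
    also have "\<dots> = (LINT t|lborel. LINT t'|lborel. (\<Phi> t * iexp (t * (R * z))) * cnj (\<Phi> t' * iexp (t' * (R * z))))"
    proof (intro Bochner_Integration.integral_cong refl)
      fix t t' :: real
      have "iexp (R * (t - t') * z) = iexp (t * (R * z)) * cnj (iexp (t' * (R * z)))"
        by (simp add: exp_cnj flip: exp_add) (simp add: algebra_simps)
      thus "W (z, (t, t')) = (\<Phi> t * iexp (t * (R * z))) * cnj (\<Phi> t' * iexp (t' * (R * z)))"
        by (simp add: W_def w_def)
    qed
    also have "\<dots> = (LINT t|lborel. (\<Phi> t * iexp (t * (R * z))) * cnj (f (R * z)))"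
      using i1 by (simp add: f_def integral_cnj del: complex_cnj_mult)
    also have "\<dots> = f (R * z) * cnj (f (R * z))" using i1 by (simp add: f_def)
    finally show ?thesis by (simp only: complex_norm_square)
  qed
  have fb: "norm (f u) \<le> J" for u
  proof -
    have "norm (f u) \<le> (LINT t|lborel. norm (\<Phi> t * iexp (t * u)))" unfolding f_def by (rule integral_norm_bound)
    thus ?thesis by (simp add: norm_mult J_def)
  qed
  have fm[measurable]: "f \<in> borel_measurable borel" unfolding f_def by measurable
  have J0: "J \<ge> 0" unfolding J_def by simp
  have int: "integrable N (\<lambda>z. (norm (f (R * z)))\<^sup>2)"
    by (rule N.integrable_const_bound[of _ "J\<^sup>2"]) (use fb J0 in \<open>auto intro!: power_mono\<close>)
  have "complex_of_real (LINT z|N. (norm (f (R * z)))\<^sup>2) = (LINT z|N. (LINT p|lborel. W (z, p)))"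
    unfolding ff[symmetric] by (rule integral_complex_of_real[symmetric])
  also have "\<dots> = (LINT p|lborel. (LINT z|N. W (z, p)))"
    using P.Fubini_integral[of "\<lambda>z p. W (z, p)"] Wint by simp
  also have "\<dots> = (LINT p|lborel. w p * of_real (exp (-((R * (fst p - snd p))\<^sup>2) / 2)))"
  proof (intro Bochner_Integration.integral_cong refl)
    fix p :: "real \<times> real"
    have "(LINT z|N. W (z, p)) = w p * char N (R * (fst p - snd p))"
      by (simp add: W_def char_def)
    thus "(LINT z|N. W (z, p)) = w p * of_real (exp (-((R * (fst p - snd p))\<^sup>2) / 2))"
      unfolding N_def char_std_normal_distribution by simp
  qed
  finally have eq: "complex_of_real (LINT z|N. (norm (f (R * z)))\<^sup>2) = \<dots>" .
  define G where "G = (\<lambda>t t'. ennreal (exp (-((R * (t - t'))\<^sup>2) / 2)))"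
  have [measurable]: "case_prod G \<in> borel_measurable (borel \<Otimes>\<^sub>M borel)" unfolding G_def by measurable
  have "(\<integral>\<^sup>+z. ennreal ((norm (f (R * z)))\<^sup>2) \<partial>N) = ennreal (LINT z|N. (norm (f (R * z)))\<^sup>2)"
    using int by (intro nn_integral_eq_integral) auto
  also have "\<dots> = ennreal (norm (complex_of_real (LINT z|N. (norm (f (R * z)))\<^sup>2)))" by simp
  also have "\<dots> \<le> (\<integral>\<^sup>+p. ennreal (norm (w p * of_real (exp (-((R * (fst p - snd p))\<^sup>2) / 2)))) \<partial>lborel)"
    unfolding eq by (rule integral_norm_bound_ennreal)
      (rule Bochner_Integration.integrable_bound[OF wint], auto simp: norm_mult intro!: mult_left_le)
  also have "\<dots> \<le> (\<integral>\<^sup>+p. (ennreal ((norm (\<Phi> (fst p)))\<^sup>2 / 2) + ennreal ((norm (\<Phi> (snd p)))\<^sup>2 / 2)) * G (fst p) (snd p) \<partial>lborel)"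
  proof (intro nn_integral_mono)
    fix p :: "real \<times> real"
    have "norm (\<Phi> (fst p)) * norm (\<Phi> (snd p)) \<le> (norm (\<Phi> (fst p)))\<^sup>2 / 2 + (norm (\<Phi> (snd p)))\<^sup>2 / 2"
      using sum_squares_bound[of "norm (\<Phi> (fst p))" "norm (\<Phi> (snd p))"] by simp
    thus "ennreal (norm (w p * of_real (exp (-((R * (fst p - snd p))\<^sup>2) / 2)))) \<le>
      (ennreal ((norm (\<Phi> (fst p)))\<^sup>2 / 2) + ennreal ((norm (\<Phi> (snd p)))\<^sup>2 / 2)) * G (fst p) (snd p)"
      by (simp add: w_def norm_mult G_def flip: ennreal_plus ennreal_mult)
  qed
  also have "\<dots> = (\<integral>\<^sup>+p. ennreal ((norm (\<Phi> (fst p)))\<^sup>2 / 2) * G (fst p) (snd p) \<partial>(lborel \<Otimes>\<^sub>M lborel)) +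
      (\<integral>\<^sup>+p. ennreal ((norm (\<Phi> (snd p)))\<^sup>2 / 2) * G (fst p) (snd p) \<partial>(lborel \<Otimes>\<^sub>M lborel))"
    unfolding distrib_right lborel_prod[symmetric] by (intro nn_integral_add) measurable
  also have "(\<integral>\<^sup>+p. ennreal ((norm (\<Phi> (fst p)))\<^sup>2 / 2) * G (fst p) (snd p) \<partial>(lborel \<Otimes>\<^sub>M lborel)) =
      (\<integral>\<^sup>+t. \<integral>\<^sup>+t'. ennreal ((norm (\<Phi> t))\<^sup>2 / 2) * G t t' \<partial>lborel \<partial>lborel)"
    by (subst lborel.nn_integral_fst[symmetric]) (auto simp: split_beta)
  also have "\<dots> = (\<integral>\<^sup>+t. ennreal ((norm (\<Phi> t))\<^sup>2 / 2) * ennreal (sqrt (2 * pi) / R) \<partial>lborel)"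
    by (intro nn_integral_cong, subst nn_integral_cmult) (auto simp: G_def nn_integral_gaussian_shift[OF R, simplified])
  also have "(\<integral>\<^sup>+p. ennreal ((norm (\<Phi> (snd p)))\<^sup>2 / 2) * G (fst p) (snd p) \<partial>(lborel \<Otimes>\<^sub>M lborel)) =
      (\<integral>\<^sup>+t'. \<integral>\<^sup>+t. ennreal ((norm (\<Phi> t'))\<^sup>2 / 2) * G t t' \<partial>lborel \<partial>lborel)"
    by (subst lborel_pair.nn_integral_snd[symmetric]) (auto simp: split_beta)
  also have "\<dots> = (\<integral>\<^sup>+t. ennreal ((norm (\<Phi> t))\<^sup>2 / 2) * ennreal (sqrt (2 * pi) / R) \<partial>lborel)"
  proof (intro nn_integral_cong)
    fix t' :: real
    have "G t t' = G t' t" for t by (simp add: G_def power2_eq_square algebra_simps)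
    thus "(\<integral>\<^sup>+t. ennreal ((norm (\<Phi> t'))\<^sup>2 / 2) * G t t' \<partial>lborel) = ennreal ((norm (\<Phi> t'))\<^sup>2 / 2) * ennreal (sqrt (2 * pi) / R)"
      by (subst nn_integral_cmult) (auto simp: G_def nn_integral_gaussian_shift[OF R, simplified])
  qed
  also have "(\<integral>\<^sup>+t. ennreal ((norm (\<Phi> t))\<^sup>2 / 2) * ennreal (sqrt (2 * pi) / R) \<partial>lborel) +
      (\<integral>\<^sup>+t. ennreal ((norm (\<Phi> t))\<^sup>2 / 2) * ennreal (sqrt (2 * pi) / R) \<partial>lborel) =
      (\<integral>\<^sup>+t. ennreal ((norm (\<Phi> t))\<^sup>2) * ennreal (sqrt (2 * pi) / R) \<partial>lborel)"
    by (subst nn_integral_add[symmetric]) (auto simp flip: distrib_right ennreal_plus)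
  also have "\<dots> = ennreal (sqrt (2 * pi) / R) * (\<integral>\<^sup>+t. ennreal ((norm (\<Phi> t))\<^sup>2) \<partial>lborel)"
    by (subst nn_integral_multc) (auto simp: mult.commute)
  finally show ?thesis unfolding N_def .
qed

text \<open>On \<open>[-R, R]\<close> the normal density at \<open>u / R\<close> is at least
  \<open>exp (-1/2) / sqrt (2 * pi)\<close>. Rescaling produces a factor \<open>R\<close> that
  cancels the \<open>1 / R\<close> of the Gaussian bound, so the constant does not depend on
  \<open>R\<close>.\<close>

lemma plancherel_ineq:
  fixes \<Phi> :: "real \<Rightarrow> complex"
  assumes \<Phi>: "integrable lborel \<Phi>" and R: "R > 0"
  defines "f \<equiv> (\<lambda>u. LINT t|lborel. \<Phi> t * iexp (t * u))"
  shows "(\<integral>\<^sup>+u. ennreal ((norm (f u))\<^sup>2) * indicator {-R..R} u \<partial>lborel) \<le>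
           ennreal (2 * pi * exp (1/2)) * (\<integral>\<^sup>+t. ennreal ((norm (\<Phi> t))\<^sup>2) \<partial>lborel)"
proof -
  have [measurable]: "\<Phi> \<in> borel_measurable borel" using \<Phi> by simp
  have fm[measurable]: "f \<in> borel_measurable borel" unfolding f_def by measurable
  define B where "B = (\<integral>\<^sup>+t. ennreal ((norm (\<Phi> t))\<^sup>2) \<partial>lborel)"
  define e where "e = exp (-1/2) / sqrt (2 * pi)"
  have e: "e > 0" by (simp add: e_def)
  have "ennreal e * (\<integral>\<^sup>+u. ennreal ((norm (f u))\<^sup>2) * indicator {-R..R} u \<partial>lborel) =
      ennreal e * (ennreal \<bar>R\<bar> * (\<integral>\<^sup>+z. ennreal ((norm (f (0 + R * z)))\<^sup>2) * indicator {-R..R} (0 + R * z) \<partial>lborel))"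
    using R by (subst nn_integral_real_affine[of _ R 0]) auto
  also have "\<dots> = ennreal R * (\<integral>\<^sup>+z. ennreal e * (ennreal ((norm (f (R * z)))\<^sup>2) * indicator {-R..R} (R * z)) \<partial>lborel)"
    using R by (subst nn_integral_cmult) (auto simp: mult_ac)
  also have "\<dots> \<le> ennreal R * (\<integral>\<^sup>+z. ennreal (std_normal_density z) * ennreal ((norm (f (R * z)))\<^sup>2) \<partial>lborel)"
  proof (intro mult_left_mono nn_integral_mono)
    fix z :: real
    show "ennreal e * (ennreal ((norm (f (R * z)))\<^sup>2) * indicator {-R..R} (R * z)) \<le> ennreal (std_normal_density z) * ennreal ((norm (f (R * z)))\<^sup>2)"
    proof (cases "R * z \<in> {-R..R}")
      case True
      hence "\<bar>R * z\<bar> \<le> R" by auto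
      hence "R * \<bar>z\<bar> \<le> R * 1" using R by (simp add: abs_mult)
      hence "\<bar>z\<bar> \<le> 1" using R by simp
      hence "z\<^sup>2 \<le> 1" by (simp add: abs_square_le_1)
      hence "e \<le> std_normal_density z" by (auto simp: e_def std_normal_density_def intro!: divide_right_mono)
      thus ?thesis using True by (auto intro!: mult_right_mono ennreal_leI)
    qed auto
  qed auto
  also have "(\<integral>\<^sup>+z. ennreal (std_normal_density z) * ennreal ((norm (f (R * z)))\<^sup>2) \<partial>lborel) = (\<integral>\<^sup>+z. ennreal ((norm (f (R * z)))\<^sup>2) \<partial>std_normal_distribution)"
    by (subst nn_integral_density) auto
  also have "ennreal R * \<dots> \<le> ennreal R * (ennreal (sqrt (2 * pi) / R) * B)"
    unfolding B_def f_def by (intro mult_left_mono gaussian_mean_square_le \<Phi> R) auto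
  also have "\<dots> = ennreal (sqrt (2 * pi)) * B" using R by (simp add: mult.assoc[symmetric] ennreal_mult[symmetric])
  finally have 1: "ennreal e * (\<integral>\<^sup>+u. ennreal ((norm (f u))\<^sup>2) * indicator {-R..R} u \<partial>lborel) \<le> ennreal (sqrt (2 * pi)) * B" .
  have "(\<integral>\<^sup>+u. ennreal ((norm (f u))\<^sup>2) * indicator {-R..R} u \<partial>lborel) =
     ennreal (1 / e) * (ennreal e * (\<integral>\<^sup>+u. ennreal ((norm (f u))\<^sup>2) * indicator {-R..R} u \<partial>lborel))"
    using e by (simp add: mult.assoc[symmetric] ennreal_mult[symmetric])
  also have "\<dots> \<le> ennreal (1 / e) * (ennreal (sqrt (2 * pi)) * B)" by (intro mult_left_mono 1) auto
  also have "\<dots> = ennreal (1 / e * sqrt (2 * pi)) * B" using e by (simp add: mult.assoc[symmetric] ennreal_mult[symmetric])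
  also have "1 / e * sqrt (2 * pi) = 2 * pi * exp (1/2)" by (simp add: e_def exp_minus field_simps)
  finally show ?thesis unfolding B_def .
qed

section \<open>Recovering \<open>gF\<close> from its smoothed means\<close>

lemma measurable_psiF [measurable]: "psiF Lam \<in> borel_measurable borel"
proof -
  have A: "(\<lambda>x::real. nat \<lfloor>x\<rfloor>) \<in> measurable borel (count_space UNIV)" by measurable
  have B: "(\<lambda>n::nat. \<Sum>k\<in>{1..n}. Lam k) \<in> measurable (count_space UNIV) borel" by simp
  from measurable_compose[OF A B] show ?thesis by (simp add: psiF_def[abs_def])
qed

definition gF :: "(nat \<Rightarrow> complex) \<Rightarrow> nat \<Rightarrow> real \<Rightarrow> complex" where
  "gF Lam m x = psiF Lam x - of_nat m * of_real x"

lemma measurable_gF [measurable]: "gF Lam m \<in> borel_measurable borel"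
  unfolding gF_def[abs_def] by measurable

lemma exp_perron_mean:
  "of_real (exp u) * perron_mean Lam m u =
     (\<Sum>n\<in>{1..nat \<lfloor>exp u\<rfloor>}. Lam n * of_real (exp u - real n)) - of_nat m * of_real (((exp u)\<^sup>2 - 1) / 2)"
proof -
  have 1: "exp u * (1 - real n * exp (- u)) = exp u - real n" for n by (simp add: exp_minus field_simps)
  have "of_real (exp u) * perron_mean Lam m u =
     (\<Sum>n\<in>{1..nat \<lfloor>exp u\<rfloor>}. Lam n * of_real (exp u * (1 - real n * exp (- u)))) -
       of_nat m * of_real (exp u * ((exp u - exp (- u)) / 2))"
    by (simp add: perron_mean_def right_diff_distrib sum_distrib_left mult_ac)
  also have "exp u * ((exp u - exp (- u)) / 2) = ((exp u)\<^sup>2 - 1) / 2"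
    by (simp add: exp_minus field_simps power2_eq_square)
  finally show ?thesis unfolding 1 .
qed

text \<open>The left-hand side is the integral of \<open>psi x - m * x\<close> from
  \<open>exp u\<close> to \<open>exp v\<close>. By the condition on \<open>v\<close> no integer lies
  above \<open>exp u\<close> and up to \<open>exp v\<close>, so \<open>psi\<close> is constant there
  and the linear part integrates to its value at the midpoint.\<close>

lemma exp_perron_mean_increment:
  assumes "u \<le> v" "exp v < real (nat \<lfloor>exp u\<rfloor>) + 1"
  shows "of_real (exp v) * perron_mean Lam m v - of_real (exp u) * perron_mean Lam m u =
     of_real (exp v - exp u) * (psiF Lam (exp u) - of_nat m * of_real ((exp u + exp v) / 2))"
proof -
  have "exp u \<le> exp v" using assms by simp
  moreover have "real (nat \<lfloor>exp u\<rfloor>) \<le> exp u" by simp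
  ultimately have "nat \<lfloor>exp v\<rfloor> = nat \<lfloor>exp u\<rfloor>" using assms(2) by linarith
  thus ?thesis unfolding exp_perron_mean psiF_def
    by (simp add: right_diff_distrib sum_subtractf sum_distrib_left power2_eq_square diff_divide_distrib add_divide_distrib algebra_simps)
qed

text \<open>A difference quotient of the primitive of \<open>gF\<close>. It is taken to the right
  because \<open>psiF\<close> is continuous from the right, so the limit is \<open>gF\<close> at
  every point, jumps included.\<close>

lemma perron_mean_quotient_tendsto:
  "(\<lambda>j. (of_real (exp (u + 1 / real (Suc j))) * perron_mean Lam m (u + 1 / real (Suc j)) - of_real (exp u) * perron_mean Lam m u)
      / of_real (exp u * (exp (1 / real (Suc j)) - 1))) \<longlonglongrightarrow> gF Lam m (exp u)"
proof -
  define \<tau> where "\<tau> = (\<lambda>j. 1 / real (Suc j))"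
  have \<tau>: "\<tau> \<longlonglongrightarrow> 0" unfolding \<tau>_def by (rule LIMSEQ_Suc[OF lim_1_over_n])
  have lim: "(\<lambda>j. exp (u + \<tau> j)) \<longlonglongrightarrow> exp (u + 0)" by (intro tendsto_intros \<tau>)
  have "exp (u + 0) < real (nat \<lfloor>exp u\<rfloor>) + 1" by simp
  from order_tendstoD(2)[OF lim this]
  have ev: "eventually (\<lambda>j. (of_real (exp (u + \<tau> j)) * perron_mean Lam m (u + \<tau> j) - of_real (exp u) * perron_mean Lam m u)
      / of_real (exp u * (exp (\<tau> j) - 1)) = psiF Lam (exp u) - of_nat m * of_real ((exp u + exp (u + \<tau> j)) / 2)) sequentially"
  proof eventually_elim
    case (elim j)
    have pos: "\<tau> j > 0" by (simp add: \<tau>_def)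
    hence "exp u * (exp (\<tau> j) - 1) \<noteq> 0" by simp
    moreover have "exp (u + \<tau> j) - exp u = exp u * (exp (\<tau> j) - 1)" by (simp add: exp_add algebra_simps)
    ultimately show ?case using exp_perron_mean_increment[OF _ elim, of Lam m] pos by (simp del: of_real_mult of_real_diff)
  qed
  have "(\<lambda>j. psiF Lam (exp u) - of_nat m * of_real ((exp u + exp (u + \<tau> j)) / 2)) \<longlonglongrightarrow>
      psiF Lam (exp u) - of_nat m * of_real ((exp u + exp (u + 0)) / 2)"
    by (intro tendsto_intros \<tau>) auto
  hence "(\<lambda>j. (of_real (exp (u + \<tau> j)) * perron_mean Lam m (u + \<tau> j) - of_real (exp u) * perron_mean Lam m u)
      / of_real (exp u * (exp (\<tau> j) - 1))) \<longlonglongrightarrow> gF Lam m (exp u)"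
    using tendsto_cong[OF ev] by (simp add: gF_def)
  thus ?thesis by (simp add: \<tau>_def)
qed

section \<open>Size of the transform on a vertical line\<close>

lemma norm_exp_minus_one_le:
  fixes z :: complex
  assumes "Re z \<ge> 0"
  shows "norm (exp z - 1) \<le> exp (Re z) * norm z"
proof -
  have "norm (exp z - exp 0) \<le> exp (Re z) * norm (z - 0)"
  proof (rule field_differentiable_bound[where S = "{w. Re w \<le> Re z}" and f' = exp])
    show "convex {w. Re w \<le> Re z}" by (rule convex_halfspace_Re_le)
  qed (use assms in \<open>auto intro!: derivative_eq_intros\<close>)
  thus ?thesis by simp
qed

text \<open>Interpolates between the two bounds for a minimum. With \<open>a\<close> the shift and
  \<open>b\<close> the inverse of the height, the exponent \<open>1 + \<beta>\<close> makes the
  integral over the line converge, while nearly a full power of the shift is retained.\<close>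

lemma min_power2_le_powr:
  fixes a b :: real
  assumes "a > 0" "b > 0" "0 \<le> \<beta>" "\<beta> \<le> 1"
  shows "(min a b)\<^sup>2 \<le> a powr (1 - \<beta>) * b powr (1 + \<beta>)"
proof -
  have "(min a b)\<^sup>2 = min a b powr (1 - \<beta>) * min a b powr (1 + \<beta>)"
    using assms by (simp flip: powr_add add: powr_numeral)
  also have "\<dots> \<le> a powr (1 - \<beta>) * b powr (1 + \<beta>)"
    using assms by (intro mult_mono powr_mono2) auto
  finally show ?thesis .
qed

text \<open>The mean value bound gives \<open>k\<close> and the trivial bound gives the inverse
  height; the transition at height about \<open>1 / k\<close> is where the saving of a power of the
  shift comes from.\<close>

lemma norm_exp_quotient_le:
  assumes s: "1/2 < Re s" "Re s < 3" and k: "0 < k" "k \<le> 1"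
  shows "norm ((exp (of_real k * s) - 1) / s) \<le> 8 * exp 3 * min k (1 / (1 + \<bar>Im s\<bar>))"
proof -
  define T where "T = 1 + \<bar>Im s\<bar>"
  have T: "T > 0" by (simp add: T_def)
  have "1/4 * T \<le> min 1 (Re s - 0) / 2 * T" using s T by (intro mult_right_mono) auto
  also have "\<dots> \<le> norm (Complex (Re s) (Im s) - of_real 0)" unfolding T_def using s by (intro norm_Complex_minus_real_ge) auto
  finally have ns: "T / 4 \<le> norm s" by simp
  have "k * Re s \<le> 1 * 3" using s k by (intro mult_mono) auto
  hence ek: "exp (k * Re s) \<le> exp 3" by simp
  have "norm (exp (of_real k * s) - 1) \<le> exp (k * Re s) * (k * norm s)"
    using norm_exp_minus_one_le[of "of_real k * s"] s k by (simp add: norm_mult)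
  also have "\<dots> \<le> exp 3 * (k * norm s)" using ek k by (intro mult_right_mono) auto
  finally have "norm ((exp (of_real k * s) - 1) / s) \<le> exp 3 * (k * norm s) / norm s"
    unfolding norm_divide by (intro divide_right_mono) auto
  also have "\<dots> \<le> 8 * exp 3 * k" using ns T k by simp
  finally have 1: "norm ((exp (of_real k * s) - 1) / s) \<le> 8 * exp 3 * k" .
  have "norm (exp (of_real k * s) - 1) \<le> exp (k * Re s) + 1"
    using norm_triangle_ineq4[of "exp (of_real k * s)" 1] by simp
  also have "\<dots> \<le> 2 * exp 3" using ek by (smt (verit) one_le_exp_iff)
  finally have "norm ((exp (of_real k * s) - 1) / s) \<le> 2 * exp 3 / (T / 4)"
    unfolding norm_divide using ns T by (intro frac_le) auto
  hence 2: "norm ((exp (of_real k * s) - 1) / s) \<le> 8 * exp 3 * (1 / T)" by (simp add: field_simps)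
  show ?thesis using 1 2 unfolding T_def[symmetric] by (simp add: min_def)
qed

text \<open>The smoothing factor stays bounded uniformly in \<open>\<tau>\<close>, because
  \<open>exp \<tau> - 1 \<ge> \<tau>\<close>; this is what the passage to the limit
  \<open>\<tau> = 0\<close> requires.\<close>

lemma norm_exp_shift_quotient_le:
  assumes s: "1/2 < Re s" "Re s < 3" and \<tau>: "0 < \<tau>" "\<tau> \<le> 1"
  shows "norm ((exp (of_real \<tau> * (s + 1)) - 1) / ((s + 1) * of_real (exp \<tau> - 1))) \<le> exp 4"
proof -
  have "norm (s + 1) > 0" using s by (auto simp: add_eq_0_iff2)
  have e\<tau>: "exp \<tau> - 1 \<ge> \<tau>" using exp_ge_add_one_self[of \<tau>] by linarith
  have "\<tau> * (Re s + 1) \<le> 1 * 4" using s \<tau> by (intro mult_mono) auto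
  hence ek: "exp (\<tau> * (Re s + 1)) \<le> exp 4" by simp
  have "norm (exp (of_real \<tau> * (s + 1)) - 1) \<le> exp (\<tau> * (Re s + 1)) * (\<tau> * norm (s + 1))"
    using norm_exp_minus_one_le[of "of_real \<tau> * (s + 1)"] s \<tau> by (simp add: norm_mult)
  also have "\<dots> \<le> exp 4 * ((exp \<tau> - 1) * norm (s + 1))" using ek \<tau> e\<tau> by (intro mult_mono) auto
  finally have "norm (exp (of_real \<tau> * (s + 1)) - 1) \<le> exp 4 * ((exp \<tau> - 1) * norm (s + 1))" .
  moreover have "norm ((s + 1) * of_real (exp \<tau> - 1)) = (exp \<tau> - 1) * norm (s + 1)"
    using e\<tau> \<tau> by (simp only: norm_mult norm_of_real) simp
  moreover have "(exp \<tau> - 1) * norm (s + 1) > 0" using e\<tau> \<tau> \<open>norm (s + 1) > 0\<close> by (intro mult_pos_pos) auto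
  ultimately show ?thesis by (simp only: norm_divide pos_divide_le_eq)
qed

text \<open>Plancherel on the line \<open>Re s = \<sigma>\<close>. The factor with \<open>\<tau>\<close> smooths the jumps of \<open>gF\<close> so that the Mellin
  inversion converges absolutely; Fatou's lemma removes it.\<close>
lemma mean_square_log:
  fixes Lam :: "nat \<Rightarrow> complex"
  assumes S: "summable (\<lambda>n. norm (Lam n) / real n powr 3)"
    and H: "\<And>t. H (Complex 3 t) = (\<Sum>n. Lam n / of_nat n powr Complex 3 t) - of_nat m * Complex 3 t / (Complex 3 t - 1)"
    and hol: "H holomorphic_on {s. Re s > 1/2}"
    and \<sigma>: "1/2 < \<sigma>" "\<sigma> < 3" and \<alpha>: "0 < \<alpha>" "\<alpha> \<le> 1/4" and C: "C \<ge> 0"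
    and bd: "\<And>s. \<sigma> \<le> Re s \<Longrightarrow> Re s \<le> 3 \<Longrightarrow> norm (H s) \<le> C * (1 + \<bar>Im s\<bar>) powr \<alpha>"
    and k: "0 < k" "k \<le> 1" and R: "R > 0"
  defines "K \<equiv> 2 * pi * exp (1/2) * ((C * 8 * exp 3 * exp 4)\<^sup>2 * (LINT t|lborel. (1 + \<bar>t\<bar>) powr (-(1 + 2 * \<alpha>))))"
  shows "(\<integral>\<^sup>+u. ennreal ((norm (gF Lam m (exp (u + k)) - gF Lam m (exp u)))\<^sup>2 * exp (- 2 * \<sigma> * u)) * indicator {0..R} u \<partial>lborel)
           \<le> ennreal (K * k powr (1 - 4 * \<alpha>))"
proof -
  define \<tau> where "\<tau> = (\<lambda>j. 1 / real (Suc j))"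
  have \<tau>: "0 < \<tau> j" "\<tau> j \<le> 1" for j by (auto simp: \<tau>_def)
  define g where "g = (\<lambda>v t. H (Complex \<sigma> t) * (exp (of_real v * Complex \<sigma> t) / (Complex \<sigma> t * (Complex \<sigma> t + 1))))"
  have \<alpha>1: "\<alpha> < 1" using \<alpha> by simp
  have g: "integrable lborel (g v)" "(LINT t|lborel. g v t) = of_real (2 * pi) * perron_mean Lam m v" if "v \<ge> 0" for v
    using perron_formula_shifted[OF S that H hol \<sigma> \<alpha>1 bd] unfolding g_def by auto
  define q where "q = (\<lambda>v. of_real (exp v) * perron_mean Lam m v)"
  \<comment> \<open>By \<open>exp_perron_mean\<close>, \<open>q v\<close> is the primitive of
    \<open>gF\<close> evaluated at \<open>exp v\<close>. So \<open>D j\<close> is a difference of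
    two right difference quotients and tends to the increment of \<open>gF\<close>;
    \<open>\<Phi> j\<close> is its transform on \<open>Re s = \<sigma>\<close>.\<close>
  define D where "D = (\<lambda>j u. (q (u + k + \<tau> j) - q (u + k)) / of_real (exp (u + k) * (exp (\<tau> j) - 1))
        - (q (u + \<tau> j) - q u) / of_real (exp u * (exp (\<tau> j) - 1)))"
  define \<Phi> where "\<Phi> = (\<lambda>j t. of_real (1 / (2 * pi)) * H (Complex \<sigma> t) * ((exp (of_real k * Complex \<sigma> t) - 1) / Complex \<sigma> t)
     * ((exp (of_real (\<tau> j) * (Complex \<sigma> t + 1)) - 1) / ((Complex \<sigma> t + 1) * of_real (exp (\<tau> j) - 1))))"
  \<comment> \<open>The four kernels combine into a product of two differences; the exponent
    \<open>s + 1\<close> in the second one comes from the factor \<open>exp v\<close> in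
    \<open>q\<close>.\<close>
  have comb: "\<Phi> j t * exp (of_real u * Complex \<sigma> t) = of_real (1 / (2 * pi * (exp (\<tau> j) - 1))) *
     (of_real (exp (\<tau> j)) * g (u + k + \<tau> j) t - g (u + k) t - of_real (exp (\<tau> j)) * g (u + \<tau> j) t + g u t)" for j t u
  proof -
    define s where "s = Complex \<sigma> t"
    have nz: "s \<noteq> 0" "s + 1 \<noteq> 0" using \<sigma> by (auto simp: s_def complex_eq_iff)
    define E where "E = (of_real (exp (\<tau> j)) :: complex)"
    define a b c where "a = exp (of_real u * s)" and "b = exp (of_real k * s)" and "c = exp (of_real (\<tau> j) * s)"
    have e: "exp (of_real (u + k + \<tau> j) * s) = a * b * c" "exp (of_real (u + k) * s) = a * b"
      "exp (of_real (u + \<tau> j) * s) = a * c" "exp (of_real (\<tau> j) * (s + 1)) = c * E"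
      by (simp_all add: a_def b_def c_def E_def distrib_left distrib_right exp_add exp_of_real)
    have E1: "E - 1 \<noteq> 0" using \<tau>[of j] by (simp add: E_def)
    show ?thesis unfolding \<Phi>_def g_def s_def[symmetric] e a_def[symmetric] b_def[symmetric]
      of_real_mult of_real_divide of_real_diff E_def[symmetric] of_real_1
      using nz E1 by (simp add: divide_simps) (simp add: algebra_simps)
  qed
  have \<Phi>int: "integrable lborel (\<Phi> j)" for j
  proof -
    have "integrable lborel (\<lambda>t. \<Phi> j t * exp (of_real 0 * Complex \<sigma> t))"
      unfolding comb using g(1)[of "0 + k + \<tau> j"] g(1)[of "0 + k"] g(1)[of "0 + \<tau> j"] g(1)[of 0] k \<tau>[of j] by auto
    thus ?thesis by simp
  qed
  define f where "f = (\<lambda>j u. LINT t|lborel. \<Phi> j t * iexp (t * u))"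
  have Df: "D j u = of_real (exp (\<sigma> * u)) * f j u" if u: "u \<ge> 0" for j u
  proof -
    define e1 where "e1 = (of_real (exp (\<tau> j) - 1) :: complex)"
    have e1: "e1 \<noteq> 0" using \<tau>[of j] by (simp add: e1_def)
    have "of_real (exp (\<sigma> * u)) * f j u = (LINT t|lborel. of_real (exp (\<sigma> * u)) * (\<Phi> j t * iexp (t * u)))"
      by (simp add: f_def)
    also have "\<dots> = (LINT t|lborel. \<Phi> j t * exp (of_real u * Complex \<sigma> t))"
    proof (intro Bochner_Integration.integral_cong refl)
      fix t
      have "exp (of_real u * Complex \<sigma> t) = of_real (exp (\<sigma> * u)) * iexp (t * u)"
        by (simp add: Complex_eq distrib_left exp_add exp_of_real[symmetric] mult_ac)
      thus "of_real (exp (\<sigma> * u)) * (\<Phi> j t * iexp (t * u)) = \<Phi> j t * exp (of_real u * Complex \<sigma> t)" by simp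
    qed
    also have "\<dots> = of_real (1 / (2 * pi * (exp (\<tau> j) - 1))) * (of_real (exp (\<tau> j)) * (LINT t|lborel. g (u + k + \<tau> j) t) - (LINT t|lborel. g (u + k) t)
       - of_real (exp (\<tau> j)) * (LINT t|lborel. g (u + \<tau> j) t) + (LINT t|lborel. g u t))"
      unfolding comb using g(1)[of "u + k + \<tau> j"] g(1)[of "u + k"] g(1)[of "u + \<tau> j"] g(1)[of u] k \<tau>[of j] u by simp
    also have "\<dots> = (of_real (exp (\<tau> j)) * perron_mean Lam m (u + k + \<tau> j) - perron_mean Lam m (u + k)
       - of_real (exp (\<tau> j)) * perron_mean Lam m (u + \<tau> j) + perron_mean Lam m u) / e1"
      using g(2)[of "u + k + \<tau> j"] g(2)[of "u + k"] g(2)[of "u + \<tau> j"] g(2)[of u] k \<tau>[of j] u e1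
      by (simp add: e1_def[symmetric] of_real_diff[symmetric] del: of_real_diff) (simp add: field_simps)
    also have "\<dots> = D j u"
      using e1 by (simp add: D_def q_def exp_add e1_def[symmetric] of_real_diff[symmetric] del: of_real_diff) (simp add: field_simps)
    finally show ?thesis by simp
  qed
  have \<Phi>b: "(norm (\<Phi> j t))\<^sup>2 \<le> (C * 8 * exp 3 * exp 4)\<^sup>2 * k powr (1 - 4 * \<alpha>) * (1 + \<bar>t\<bar>) powr (-(1 + 2 * \<alpha>))" for j t
  proof -
    define T where "T = 1 + \<bar>t\<bar>"
    have T: "T > 0" by (simp add: T_def)
    have pi1: "norm (complex_of_real (1 / (2 * pi))) \<le> 1"
      unfolding norm_of_real using pi_gt3 by (simp add: field_simps)
    have "norm (\<Phi> j t) \<le> 1 * (C * T powr \<alpha>) * (8 * exp 3 * min k (1 / T)) * exp 4"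
      unfolding \<Phi>_def norm_mult T_def
      using bd[of "Complex \<sigma> t"] norm_exp_quotient_le[of "Complex \<sigma> t" k] norm_exp_shift_quotient_le[of "Complex \<sigma> t" "\<tau> j"] \<sigma> k \<tau>[of j] C pi1
      by (intro mult_mono mult_nonneg_nonneg) (auto simp del: of_real_diff of_real_divide of_real_mult)
    hence "(norm (\<Phi> j t))\<^sup>2 \<le> (1 * (C * T powr \<alpha>) * (8 * exp 3 * min k (1 / T)) * exp 4)\<^sup>2"
      by (intro power_mono) auto
    also have "\<dots> = (C * 8 * exp 3 * exp 4)\<^sup>2 * (T powr (2 * \<alpha>) * (min k (1 / T))\<^sup>2)"
    proof -
      have "(T powr \<alpha>)\<^sup>2 = T powr (2 * \<alpha>)" by (simp add: power2_eq_square flip: powr_add)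
      thus ?thesis by (simp add: power_mult_distrib mult_ac)
    qed
    \<comment> \<open>Interpolation with \<open>\<beta> = 4 * \<alpha>\<close>: the growth
      \<open>T powr (2 * \<alpha>)\<close> coming from \<open>H\<close> is absorbed, and the
      resulting exponent \<open>-(1 + 2 * \<alpha>)\<close> is still integrable.\<close>
    also have "\<dots> \<le> (C * 8 * exp 3 * exp 4)\<^sup>2 * (T powr (2 * \<alpha>) * (k powr (1 - 4 * \<alpha>) * (1 / T) powr (1 + 4 * \<alpha>)))"
      using k T \<alpha> by (intro mult_left_mono min_power2_le_powr) auto
    also have "(1 / T) powr (1 + 4 * \<alpha>) = T powr (-(1 + 4 * \<alpha>))"
      using T by (subst powr_minus) (simp add: powr_divide inverse_eq_divide)
    also have "(C * 8 * exp 3 * exp 4)\<^sup>2 * (T powr (2 * \<alpha>) * (k powr (1 - 4 * \<alpha>) * T powr (-(1 + 4 * \<alpha>)))) =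
      (C * 8 * exp 3 * exp 4)\<^sup>2 * k powr (1 - 4 * \<alpha>) * (T powr (2 * \<alpha>) * T powr (-(1 + 4 * \<alpha>)))" by (simp only: mult_ac)
    also have "T powr (2 * \<alpha>) * T powr (-(1 + 4 * \<alpha>)) = T powr (-(1 + 2 * \<alpha>))"
      by (simp only: powr_add[symmetric]) (simp add: algebra_simps)
    finally show ?thesis unfolding T_def .
  qed
  have I: "integrable lborel (\<lambda>t::real. (1 + \<bar>t\<bar>) powr (-(1 + 2 * \<alpha>)))"
    using \<alpha> by (intro integrable_one_plus_abs_powr) auto
  have bound: "(\<integral>\<^sup>+u. ennreal ((norm (D j u))\<^sup>2 * exp (- 2 * \<sigma> * u)) * indicator {0..R} u \<partial>lborel) \<le> ennreal (K * k powr (1 - 4 * \<alpha>))" for j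
  proof -
    have "(\<integral>\<^sup>+u. ennreal ((norm (D j u))\<^sup>2 * exp (- 2 * \<sigma> * u)) * indicator {0..R} u \<partial>lborel) \<le>
        (\<integral>\<^sup>+u. ennreal ((norm (f j u))\<^sup>2) * indicator {-R..R} u \<partial>lborel)"
    proof (intro nn_integral_mono)
      fix u :: real
      show "ennreal ((norm (D j u))\<^sup>2 * exp (- 2 * \<sigma> * u)) * indicator {0..R} u \<le> ennreal ((norm (f j u))\<^sup>2) * indicator {-R..R} u"
      proof (cases "u \<in> {0..R}")
        case True
        hence "(norm (D j u))\<^sup>2 * exp (- 2 * \<sigma> * u) = (norm (f j u))\<^sup>2 * ((exp (\<sigma> * u))\<^sup>2 * exp (- 2 * \<sigma> * u))"
          by (simp add: Df norm_mult power_mult_distrib mult_ac)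
        also have "(exp (\<sigma> * u))\<^sup>2 * exp (- 2 * \<sigma> * u) = 1" by (simp add: power2_eq_square flip: exp_add)
        finally show ?thesis using True by simp
      qed auto
    qed
    also have "\<dots> \<le> ennreal (2 * pi * exp (1/2)) * (\<integral>\<^sup>+t. ennreal ((norm (\<Phi> j t))\<^sup>2) \<partial>lborel)"
      unfolding f_def by (rule plancherel_ineq[OF \<Phi>int R])
    also have "\<dots> \<le> ennreal (2 * pi * exp (1/2)) * (\<integral>\<^sup>+t. ennreal ((C * 8 * exp 3 * exp 4)\<^sup>2 * k powr (1 - 4 * \<alpha>) * (1 + \<bar>t\<bar>) powr (-(1 + 2 * \<alpha>))) \<partial>lborel)"
      using \<Phi>b by (intro mult_left_mono nn_integral_mono ennreal_leI) auto
    also have "(\<integral>\<^sup>+t. ennreal ((C * 8 * exp 3 * exp 4)\<^sup>2 * k powr (1 - 4 * \<alpha>) * (1 + \<bar>t\<bar>) powr (-(1 + 2 * \<alpha>))) \<partial>lborel) =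
        ennreal (LINT t|lborel. (C * 8 * exp 3 * exp 4)\<^sup>2 * k powr (1 - 4 * \<alpha>) * (1 + \<bar>t\<bar>) powr (-(1 + 2 * \<alpha>)))"
      using I by (intro nn_integral_eq_integral integrable_mult_right) auto
    also have "ennreal (2 * pi * exp (1/2)) * \<dots> = ennreal (K * k powr (1 - 4 * \<alpha>))"
      by (subst ennreal_mult[symmetric]) (auto simp: K_def mult_ac intro!: mult_nonneg_nonneg integral_nonneg_AE)
    finally show ?thesis .
  qed
  have Dlim: "(\<lambda>j. D j u) \<longlonglongrightarrow> gF Lam m (exp (u + k)) - gF Lam m (exp u)" for u
    unfolding D_def q_def \<tau>_def by (intro tendsto_diff perron_mean_quotient_tendsto)
  have Dm[measurable]: "D j \<in> borel_measurable borel" for j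
  proof -
    have [measurable]: "perron_mean Lam m \<in> borel_measurable borel"
    proof -
      have "(\<lambda>u. (\<lambda>(n::nat) u. \<Sum>i\<in>{1..n}. Lam i * of_real (1 - real i * exp (- u))) (nat \<lfloor>exp u\<rfloor>) u) \<in> borel_measurable borel"
        by (rule measurable_compose_countable) auto
      thus ?thesis unfolding perron_mean_def[abs_def] by measurable
    qed
    show ?thesis unfolding D_def q_def by measurable
  qed
  have "(\<integral>\<^sup>+u. ennreal ((norm (gF Lam m (exp (u + k)) - gF Lam m (exp u)))\<^sup>2 * exp (- 2 * \<sigma> * u)) * indicator {0..R} u \<partial>lborel) =
     (\<integral>\<^sup>+u. liminf (\<lambda>j. ennreal ((norm (D j u))\<^sup>2 * exp (- 2 * \<sigma> * u)) * indicator {0..R} u) \<partial>lborel)"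
  proof (intro nn_integral_cong)
    fix u :: real
    have "(\<lambda>j. ennreal ((norm (D j u))\<^sup>2 * exp (- 2 * \<sigma> * u)) * indicator {0..R} u) \<longlonglongrightarrow>
      ennreal ((norm (gF Lam m (exp (u + k)) - gF Lam m (exp u)))\<^sup>2 * exp (- 2 * \<sigma> * u)) * indicator {0..R} u"
      by (cases "u \<in> {0..R}") (auto intro!: tendsto_intros Dlim)
    thus "ennreal ((norm (gF Lam m (exp (u + k)) - gF Lam m (exp u)))\<^sup>2 * exp (- 2 * \<sigma> * u)) * indicator {0..R} u =
      liminf (\<lambda>j. ennreal ((norm (D j u))\<^sup>2 * exp (- 2 * \<sigma> * u)) * indicator {0..R} u)"
      by (rule lim_imp_Liminf[symmetric, rotated]) simp
  qed
  also have "\<dots> \<le> liminf (\<lambda>j. \<integral>\<^sup>+u. ennreal ((norm (D j u))\<^sup>2 * exp (- 2 * \<sigma> * u)) * indicator {0..R} u \<partial>lborel)"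
    by (rule nn_integral_liminf) measurable
  also have "\<dots> \<le> limsup (\<lambda>j. \<integral>\<^sup>+u. ennreal ((norm (D j u))\<^sup>2 * exp (- 2 * \<sigma> * u)) * indicator {0..R} u \<partial>lborel)"
    by (rule Liminf_le_Limsup) simp
  also have "\<dots> \<le> ennreal (K * k powr (1 - 4 * \<alpha>))"
    by (rule Limsup_bounded) (use bound in auto)
  finally show ?thesis .
qed


text \<open>In \<open>u = ln x\<close> a proportional shift becomes the constant shift
  \<open>k = ln (1 + \<kappa>) \<le> \<kappa>\<close>, and the weight
  \<open>exp (-2 * \<sigma> * u)\<close> together with the Jacobian becomes
  \<open>x powr (-2 * \<sigma> - 1)\<close>.\<close>

lemma mean_square_multiplicative:
  fixes Lam :: "nat \<Rightarrow> complex"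
  assumes S: "summable (\<lambda>n. norm (Lam n) / real n powr 3)"
    and H: "\<And>t. H (Complex 3 t) = (\<Sum>n. Lam n / of_nat n powr Complex 3 t) - of_nat m * Complex 3 t / (Complex 3 t - 1)"
    and hol: "H holomorphic_on {s. Re s > 1/2}"
    and \<sigma>: "1/2 < \<sigma>" "\<sigma> < 3" and \<alpha>: "0 < \<alpha>" "\<alpha> \<le> 1/4" and C: "C \<ge> 0"
    and bd: "\<And>s. \<sigma> \<le> Re s \<Longrightarrow> Re s \<le> 3 \<Longrightarrow> norm (H s) \<le> C * (1 + \<bar>Im s\<bar>) powr \<alpha>"
  obtains K where "K \<ge> 0" "\<And>\<kappa> Y. 0 < \<kappa> \<Longrightarrow> \<kappa> \<le> 1 \<Longrightarrow> Y \<ge> 1 \<Longrightarrow>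
     (\<integral>\<^sup>+x. ennreal ((norm (gF Lam m (x + \<kappa> * x) - gF Lam m x))\<^sup>2 * x powr (- 2 * \<sigma> - 1)) * indicator {1..Y} x \<partial>lborel)
       \<le> ennreal (K * \<kappa> powr (1 - 4 * \<alpha>))"
proof -
  define K where "K = 2 * pi * exp (1/2) * ((C * 8 * exp 3 * exp 4)\<^sup>2 * (LINT t|lborel. (1 + \<bar>t\<bar>) powr (-(1 + 2 * \<alpha>))))"
  have K: "K \<ge> 0" unfolding K_def by (intro mult_nonneg_nonneg integral_nonneg_AE) auto
  show ?thesis
  proof (rule that[OF K])
    fix \<kappa> Y :: real assume \<kappa>: "0 < \<kappa>" "\<kappa> \<le> 1" and Y: "Y \<ge> 1"
    define k where "k = ln (1 + \<kappa>)"
    have k0: "k > 0" using \<kappa> by (simp add: k_def)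
    have k\<kappa>: "k \<le> \<kappa>" unfolding k_def using \<kappa> by (intro ln_add_one_self_le_self) auto
    have ek: "exp k = 1 + \<kappa>" using \<kappa> by (simp add: k_def)
    define f where "f = (\<lambda>x. (norm (gF Lam m (x + \<kappa> * x) - gF Lam m x))\<^sup>2 * x powr (- 2 * \<sigma> - 1))"
    have fm: "f \<in> borel_measurable borel" unfolding f_def by measurable
    have "(\<integral>\<^sup>+x. ennreal (f x * indicator {exp 0..exp (ln Y)} x) \<partial>lborel) =
       (\<integral>\<^sup>+u. ennreal (f (exp u) * exp u * indicator {0..ln Y} u) \<partial>lborel)"
    proof (rule nn_integral_substitution)
      show "set_borel_measurable borel {exp 0..exp (ln Y)} f" using fm unfolding set_borel_measurable_def by measurable
    qed (use Y in \<open>auto intro!: derivative_eq_intros continuous_intros\<close>)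
    hence "(\<integral>\<^sup>+x. ennreal (f x) * indicator {1..Y} x \<partial>lborel) = (\<integral>\<^sup>+u. ennreal (f (exp u) * exp u) * indicator {0..ln Y} u \<partial>lborel)"
      using Y by (simp add: ennreal_mult' ennreal_indicator mult.commute ennreal_mult'')
    \<comment> \<open>The range is enlarged by 1 because \<open>ln Y\<close> may be 0, while
      \<open>mean_square_log\<close> asks for a positive length.\<close>
    also have "\<dots> \<le> (\<integral>\<^sup>+u. ennreal ((norm (gF Lam m (exp (u + k)) - gF Lam m (exp u)))\<^sup>2 * exp (- 2 * \<sigma> * u)) * indicator {0..ln Y + 1} u \<partial>lborel)"
    proof (intro nn_integral_mono)
      fix u :: real
      have "exp u powr (- 2 * \<sigma> - 1) * exp u = exp (- 2 * \<sigma> * u)"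
        by (simp add: powr_def flip: exp_add) (simp add: algebra_simps)
      moreover have "exp (u + k) = exp u + \<kappa> * exp u" by (simp add: exp_add ek algebra_simps)
      ultimately have "f (exp u) * exp u = (norm (gF Lam m (exp (u + k)) - gF Lam m (exp u)))\<^sup>2 * exp (- 2 * \<sigma> * u)"
        by (simp add: f_def mult.assoc)
      thus "ennreal (f (exp u) * exp u) * indicator {0..ln Y} u \<le>
        ennreal ((norm (gF Lam m (exp (u + k)) - gF Lam m (exp u)))\<^sup>2 * exp (- 2 * \<sigma> * u)) * indicator {0..ln Y + 1} u"
        by (auto split: split_indicator)
    qed
    also have "\<dots> \<le> ennreal (K * k powr (1 - 4 * \<alpha>))" unfolding K_def
      by (rule mean_square_log[OF S H hol \<sigma> \<alpha> C bd k0]) (use k\<kappa> \<kappa> Y in \<open>auto intro!: add_nonneg_pos\<close>)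
    also have "\<dots> \<le> ennreal (K * \<kappa> powr (1 - 4 * \<alpha>))"
      using K k0 k\<kappa> \<alpha> by (intro ennreal_leI mult_left_mono powr_mono2) auto
    finally show "(\<integral>\<^sup>+x. ennreal ((norm (gF Lam m (x + \<kappa> * x) - gF Lam m x))\<^sup>2 * x powr (- 2 * \<sigma> - 1)) * indicator {1..Y} x \<partial>lborel)
       \<le> ennreal (K * \<kappa> powr (1 - 4 * \<alpha>))" unfolding f_def .
  qed
qed

section \<open>Input from the Selberg class\<close>

lemma ln_three_plus_le_powr:
  fixes x \<alpha> :: real
  assumes "x \<ge> 0" "\<alpha> > 0"
  shows "ln (3 + x) \<le> 3 powr \<alpha> / \<alpha> * (1 + x) powr \<alpha>"
proof -
  have "ln (3 + x) \<le> (3 + x) powr \<alpha> / \<alpha>" using assms by (intro ln_powr_bound) auto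
  also have "\<dots> \<le> (3 * (1 + x)) powr \<alpha> / \<alpha>" using assms by (intro divide_right_mono powr_mono2) auto
  also have "\<dots> = 3 powr \<alpha> / \<alpha> * (1 + x) powr \<alpha>" using assms by (simp only: powr_mult) simp
  finally show ?thesis .
qed

lemma dser_log_deriv:
  assumes data: "selberg_data a m G Q r lam mu eps" and s: "Re s > 1" and nz: "G s \<noteq> 0"
  shows "deriv (dser a) s / dser a s = deriv G s / G s - of_nat m / (s - 1)"
proof -
  have holG: "G holomorphic_on UNIV" and GF: "\<And>s. Re s > 1 \<Longrightarrow> G s = (s - 1) ^ m * dser a s"
    using data unfolding selberg_data_def by blast+
  have s1: "s - 1 \<noteq> 0" using s by auto
  have dG: "(G has_field_derivative deriv G s) (at s)" using holomorphic_derivI[OF holG] by auto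
  have dm: "of_nat m * (s - 1) ^ (m - Suc 0) = of_nat m * (s - 1) ^ m / (s - 1)"
    using s1 by (cases m) auto
  have "((\<lambda>w. (w - 1) ^ m) has_field_derivative of_nat m * (s - 1) ^ m / (s - 1)) (at s)"
    by (rule derivative_eq_intros refl | simp add: dm)+
  from DERIV_divide[OF dG this] s1
  have "((\<lambda>w. G w / (w - 1) ^ m) has_field_derivative
     (deriv G s * (s - 1) ^ m - G s * (of_nat m * (s - 1) ^ m / (s - 1))) / ((s - 1) ^ m * (s - 1) ^ m)) (at s)"
    by auto
  hence "(dser a has_field_derivative
     (deriv G s * (s - 1) ^ m - G s * (of_nat m * (s - 1) ^ m / (s - 1))) / ((s - 1) ^ m * (s - 1) ^ m)) (at s)"
  proof (rule has_field_derivative_transform_within_open)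
    show "open {w. Re w > 1}" by (rule open_halfspace_Re_gt)
  qed (use s GF in auto)
  hence d1: "deriv (dser a) s = (deriv G s * (s - 1) ^ m - G s * (of_nat m * (s - 1) ^ m / (s - 1))) / ((s - 1) ^ m * (s - 1) ^ m)"
    by (rule DERIV_imp_deriv)
  have d2: "dser a s = G s / (s - 1) ^ m" using GF[OF s] s1 by simp
  have "(s - 1) ^ m \<noteq> 0" using s1 by simp
  thus ?thesis unfolding d1 d2 using nz s1 by (simp add: divide_simps) (simp add: algebra_simps)
qed

text \<open>The line is \<open>\<sigma> = 1/2 + e\<close>, so the weight
  \<open>x powr (-2 * \<sigma> - 1)\<close> is \<open>x powr (-2 - 2 * e)\<close>. The logarithmic
  bound is weakened to a power with exponent \<open>\<alpha> = e / 4\<close>, chosen to make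
  \<open>1 - 4 * \<alpha> = 1 - e\<close>.\<close>

lemma selberg_mean_square:
  assumes prim: "selberg_primitive a"
    and data: "selberg_data a m G Q r lam mu eps"
    and Lam: "\<forall>s. Re s > 1 \<longrightarrow> (\<lambda>n. Lam n / of_nat n powr s) sums (- deriv (dser a) s / dser a s)"
    and grh: "GRH G r lam mu" and e: "0 < e" "e \<le> 1"
  obtains K where "K \<ge> 0" "\<And>\<kappa> Y. 0 < \<kappa> \<Longrightarrow> \<kappa> \<le> 1 \<Longrightarrow> Y \<ge> 1 \<Longrightarrow>
     (\<integral>\<^sup>+x. ennreal ((norm (gF Lam m (x + \<kappa> * x) - gF Lam m x))\<^sup>2 * x powr (- 2 - 2 * e)) * indicator {1..Y} x \<partial>lborel)
       \<le> ennreal (K * \<kappa> powr (1 - e))"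
proof -
  have holG: "G holomorphic_on UNIV" and lam: "\<And>j. j < r \<Longrightarrow> lam j > 0" and mu: "\<And>j. j < r \<Longrightarrow> Re (mu j) \<ge> 0"
    using data unfolding selberg_data_def by blast+
  have S: "\<forall>s. Re s > 1 \<longrightarrow> summable (\<lambda>n. norm (a n / of_nat n powr s))"
    using prim unfolding selberg_primitive_def selberg_class_def by blast
  \<comment> \<open>\<open>GRH\<close> speaks of zeros off the poles of the Gamma factors. Such
    poles satisfy \<open>Re s \<le> 0\<close>, as \<open>lam j > 0\<close> and
    \<open>Re (mu j) \<ge> 0\<close>, so to the right of the critical line every zero counts as
    nontrivial.\<close>
  have nz: "G s \<noteq> 0" if s: "Re s > 1/2" for s
  proof
    assume "G s = 0"
    moreover have "no_gamma_pole r lam mu s" unfolding no_gamma_pole_def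
    proof (intro allI impI notI)
      fix j assume j: "j < r" and "of_real (lam j) * s + mu j \<in> \<int>\<^sub>\<le>\<^sub>0"
      then obtain n where "of_real (lam j) * s + mu j = of_int n" "n \<le> 0" by (auto elim!: nonpos_Ints_cases)
      hence "Re (of_real (lam j) * s + mu j) \<le> 0" by (simp only: complex_Re_of_int)
      moreover have "lam j * Re s > 0" using lam[OF j] s by (intro mult_pos_pos) auto
      ultimately show False using mu[OF j] by simp
    qed
    ultimately show False using grh s unfolding GRH_def by fastforce
  qed
  obtain C1 where C1: "C1 > 0" "\<And>s. 1/2 + e \<le> Re s \<Longrightarrow> Re s \<le> 3 \<Longrightarrow> norm (deriv G s / G s) \<le> C1 * ln (3 + \<bar>Im s\<bar>)"
    using selberg_log_deriv_bound[OF S data nz e(1)] by blast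
  \<comment> \<open>On \<open>Re s > 1\<close> this is \<open>-F'/F - m * s / (s - 1)\<close>: since
    \<open>m * s / (s - 1)\<close> and \<open>m / (s - 1)\<close> differ by \<open>m\<close>, the
    pole at 1 cancels.\<close>
  define H where "H = (\<lambda>s. - (deriv G s / G s) - of_nat m)"
  define \<alpha> where "\<alpha> = e / 4"
  have \<alpha>: "0 < \<alpha>" "\<alpha> \<le> 1/4" using e by (auto simp: \<alpha>_def)
  define C where "C = (C1 + real m) * (3 powr \<alpha> / \<alpha>)"
  have C: "C \<ge> 0" using C1 \<alpha> by (simp add: C_def)
  have bd: "norm (H s) \<le> C * (1 + \<bar>Im s\<bar>) powr \<alpha>" if s: "1/2 + e \<le> Re s" "Re s \<le> 3" for s
  proof -
    have ln1: "ln (3 + \<bar>Im s\<bar>) \<ge> 1"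
    proof -
      have "ln (exp 1) \<le> ln (3 + \<bar>Im s\<bar>)" using exp_le by (intro ln_mono) auto
      thus ?thesis by simp
    qed
    have "norm (H s) \<le> norm (deriv G s / G s) + real m"
      using norm_triangle_ineq4[of "- (deriv G s / G s)" "of_nat m"] by (simp add: H_def)
    also have "\<dots> \<le> C1 * ln (3 + \<bar>Im s\<bar>) + real m * ln (3 + \<bar>Im s\<bar>)"
      using C1(2)[OF s] ln1 by (intro add_mono) (auto intro: order_trans[OF _ mult_left_mono[of 1]])
    also have "\<dots> = (C1 + real m) * ln (3 + \<bar>Im s\<bar>)" by (simp add: algebra_simps)
    also have "\<dots> \<le> (C1 + real m) * (3 powr \<alpha> / \<alpha> * (1 + \<bar>Im s\<bar>) powr \<alpha>)"
      using C1(1) \<alpha> by (intro mult_left_mono ln_three_plus_le_powr) auto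
    finally show ?thesis by (simp add: C_def mult_ac)
  qed
  have hol: "H holomorphic_on {s. Re s > 1/2}" unfolding H_def
    using nz by (intro holomorphic_intros holomorphic_on_subset[OF holomorphic_deriv[OF holG]] holomorphic_on_subset[OF holG]) auto
  have sums: "(\<lambda>n. Lam n / of_nat n powr s) sums (- (deriv G s / G s - of_nat m / (s - 1)))" if "Re s > 1" for s
  proof -
    have "G s \<noteq> 0" using that by (intro nz) simp
    hence "- deriv (dser a) s / dser a s = - (deriv G s / G s - of_nat m / (s - 1))"
      using dser_log_deriv[OF data that] by simp
    thus ?thesis using Lam that by metis
  qed
  have H3: "H (Complex 3 t) = (\<Sum>n. Lam n / of_nat n powr Complex 3 t) - of_nat m * Complex 3 t / (Complex 3 t - 1)" for t
  proof -
    define s where "s = Complex 3 t"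
    have s: "Re s > 1" "s - 1 \<noteq> 0" by (auto simp: s_def complex_eq_iff)
    have "(\<Sum>n. Lam n / of_nat n powr s) = - (deriv G s / G s - of_nat m / (s - 1))"
      using sums[OF s(1)] by (simp add: sums_iff)
    moreover have "of_nat m / (s - 1) - of_nat m * s / (s - 1) = - of_nat m"
      using s(2) unfolding diff_divide_distrib[symmetric] by (subst nonzero_divide_eq_eq) (auto simp: algebra_simps)
    ultimately show ?thesis unfolding H_def s_def[symmetric] by (simp add: algebra_simps)
  qed
  \<comment> \<open>Convergence at the single point \<open>3/2\<close> bounds the terms there, and
    the distance \<open>3/2\<close> from it to the abscissa 3 exceeds 1, which gives absolute
    convergence.\<close>
  have S3: "summable (\<lambda>n. norm (Lam n) / real n powr 3)"
  proof -
    have "(\<lambda>n. Lam n / of_nat n powr (complex_of_real (3/2))) \<longlonglongrightarrow> 0"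
      using sums[of "complex_of_real (3/2)"] by (intro summable_LIMSEQ_zero) (auto simp: sums_iff)
    hence "Bseq (\<lambda>n. Lam n / of_nat n powr (complex_of_real (3/2)))"
      by (intro convergent_imp_Bseq) (auto simp: convergent_def)
    then obtain B where B: "\<And>n. norm (Lam n / of_nat n powr (complex_of_real (3/2))) \<le> B" unfolding Bseq_def by auto
    have "summable (\<lambda>n. B * real n powr (-3/2))"
      by (intro summable_mult) (simp add: summable_real_powr_iff)
    thus ?thesis
    proof (rule summable_comparison_test[rotated], intro exI allI impI)
      fix n :: nat
      have "norm (norm (Lam n) / real n powr 3) = norm (Lam n / of_nat n powr (complex_of_real (3/2))) * real n powr (-3/2)"
      proof -
        have "real n powr 3 = real n powr (3/2) * real n powr (3/2)" by (simp flip: powr_add)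
        thus ?thesis by (simp add: norm_dirichlet_term powr_minus field_simps del: of_real_divide)
      qed
      also have "\<dots> \<le> B * real n powr (-3/2)" by (intro mult_right_mono B) auto
      finally show "norm (norm (Lam n) / real n powr 3) \<le> B * real n powr (-3/2)" .
    qed
  qed
  have \<sigma>: "1/2 < 1/2 + e" "1/2 + e < 3" using e by auto
  obtain K where K: "K \<ge> 0" "\<And>\<kappa> Y. 0 < \<kappa> \<Longrightarrow> \<kappa> \<le> 1 \<Longrightarrow> Y \<ge> 1 \<Longrightarrow>
     (\<integral>\<^sup>+x. ennreal ((norm (gF Lam m (x + \<kappa> * x) - gF Lam m x))\<^sup>2 * x powr (- 2 * (1/2 + e) - 1)) * indicator {1..Y} x \<partial>lborel)
       \<le> ennreal (K * \<kappa> powr (1 - 4 * \<alpha>))"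
    using mean_square_multiplicative[OF S3 H3 hol \<sigma> \<alpha> C bd] by blast
  have eqs: "- 2 * (1/2 + e) - 1 = - 2 - 2 * e" "1 - 4 * \<alpha> = 1 - e" by (auto simp: \<alpha>_def)
  show ?thesis using that K unfolding eqs by blast
qed

section \<open>From fixed to proportional shifts\<close>

text \<open>The change of variables \<open>u = x + v\<close>, \<open>w = \<delta> * x - v\<close>,
  whose determinant has absolute value \<open>1 + \<delta>\<close>, is factored into two
  one-dimensional affine substitutions: \<open>x\<close> is replaced by \<open>w\<close> for fixed
  \<open>v\<close>, then, after an exchange of the order of integration, \<open>v\<close> by
  \<open>u\<close> for fixed \<open>w\<close>.\<close>

lemma nn_integral_shear:
  fixes F :: "real \<Rightarrow> real \<Rightarrow> ennreal"
  assumes [measurable]: "case_prod F \<in> borel_measurable (borel \<Otimes>\<^sub>M borel)" and \<delta>: "\<delta> > 0"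
  shows "(\<integral>\<^sup>+x. \<integral>\<^sup>+v. F x v \<partial>lborel \<partial>lborel) =
     ennreal (1 / (1 + \<delta>)) * (\<integral>\<^sup>+w. \<integral>\<^sup>+u. F ((u + w) / (1 + \<delta>)) ((\<delta> * u - w) / (1 + \<delta>)) \<partial>lborel \<partial>lborel)"
proof -
  have "(\<integral>\<^sup>+x. \<integral>\<^sup>+v. F x v \<partial>lborel \<partial>lborel) = (\<integral>\<^sup>+v. \<integral>\<^sup>+x. F x v \<partial>lborel \<partial>lborel)"
    by (rule lborel_pair.Fubini'[symmetric]) measurable
  also have "\<dots> = (\<integral>\<^sup>+v. ennreal (1 / \<delta>) * (\<integral>\<^sup>+w. F ((w + v) / \<delta>) v \<partial>lborel) \<partial>lborel)"
  proof (intro nn_integral_cong)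
    fix v :: real
    have "(\<integral>\<^sup>+x. F x v \<partial>lborel) = ennreal \<bar>1 / \<delta>\<bar> * (\<integral>\<^sup>+w. F (v / \<delta> + 1 / \<delta> * w) v \<partial>lborel)"
      using \<delta> by (intro nn_integral_real_affine) auto
    also have "(\<lambda>w. F (v / \<delta> + 1 / \<delta> * w) v) = (\<lambda>w. F ((w + v) / \<delta>) v)"
      by (simp add: add_divide_distrib add.commute)
    finally show "(\<integral>\<^sup>+x. F x v \<partial>lborel) = ennreal (1 / \<delta>) * (\<integral>\<^sup>+w. F ((w + v) / \<delta>) v \<partial>lborel)" using \<delta> by simp
  qed
  also have "\<dots> = ennreal (1 / \<delta>) * (\<integral>\<^sup>+v. \<integral>\<^sup>+w. F ((w + v) / \<delta>) v \<partial>lborel \<partial>lborel)"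
    by (rule nn_integral_cmult) measurable
  also have "(\<integral>\<^sup>+v. \<integral>\<^sup>+w. F ((w + v) / \<delta>) v \<partial>lborel \<partial>lborel) = (\<integral>\<^sup>+w. \<integral>\<^sup>+v. F ((w + v) / \<delta>) v \<partial>lborel \<partial>lborel)"
    by (rule lborel_pair.Fubini') measurable
  also have "\<dots> = (\<integral>\<^sup>+w. ennreal (\<delta> / (1 + \<delta>)) * (\<integral>\<^sup>+u. F ((u + w) / (1 + \<delta>)) ((\<delta> * u - w) / (1 + \<delta>)) \<partial>lborel) \<partial>lborel)"
  proof (intro nn_integral_cong)
    fix w :: real
    have "(\<integral>\<^sup>+v. F ((w + v) / \<delta>) v \<partial>lborel) = ennreal \<bar>\<delta> / (1 + \<delta>)\<bar> *
       (\<integral>\<^sup>+u. F ((w + (- w / (1 + \<delta>) + \<delta> / (1 + \<delta>) * u)) / \<delta>) (- w / (1 + \<delta>) + \<delta> / (1 + \<delta>) * u) \<partial>lborel)"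
      using \<delta> by (intro nn_integral_real_affine) auto
    also have "(\<lambda>u. F ((w + (- w / (1 + \<delta>) + \<delta> / (1 + \<delta>) * u)) / \<delta>) (- w / (1 + \<delta>) + \<delta> / (1 + \<delta>) * u)) =
        (\<lambda>u. F ((u + w) / (1 + \<delta>)) ((\<delta> * u - w) / (1 + \<delta>)))"
    proof
      fix u
      have "- w / (1 + \<delta>) + \<delta> / (1 + \<delta>) * u = (\<delta> * u - w) / (1 + \<delta>)" by (simp add: diff_divide_distrib)
      moreover have "(w + (\<delta> * u - w) / (1 + \<delta>)) / \<delta> = (u + w) / (1 + \<delta>)"
        using \<delta> by (simp add: divide_simps) (simp add: algebra_simps)
      ultimately show "F ((w + (- w / (1 + \<delta>) + \<delta> / (1 + \<delta>) * u)) / \<delta>) (- w / (1 + \<delta>) + \<delta> / (1 + \<delta>) * u) =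
         F ((u + w) / (1 + \<delta>)) ((\<delta> * u - w) / (1 + \<delta>))" by simp
    qed
    finally show "(\<integral>\<^sup>+v. F ((w + v) / \<delta>) v \<partial>lborel) = ennreal (\<delta> / (1 + \<delta>)) *
       (\<integral>\<^sup>+u. F ((u + w) / (1 + \<delta>)) ((\<delta> * u - w) / (1 + \<delta>)) \<partial>lborel)" using \<delta> by simp
  qed
  also have "\<dots> = ennreal (\<delta> / (1 + \<delta>)) * (\<integral>\<^sup>+w. \<integral>\<^sup>+u. F ((u + w) / (1 + \<delta>)) ((\<delta> * u - w) / (1 + \<delta>)) \<partial>lborel \<partial>lborel)"
    by (rule nn_integral_cmult) measurable
  also have "ennreal (1 / \<delta>) * \<dots> = ennreal (1 / (1 + \<delta>)) * (\<integral>\<^sup>+w. \<integral>\<^sup>+u. F ((u + w) / (1 + \<delta>)) ((\<delta> * u - w) / (1 + \<delta>)) \<partial>lborel \<partial>lborel)"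
    using \<delta> by (simp add: mult.assoc[symmetric] ennreal_mult[symmetric])
  finally show ?thesis .
qed

section \<open>Mean squares as nonnegative integrals\<close>

text \<open>\<open>VF\<close> and \<open>VtF\<close> are gauge integrals, whereas all exchanges of
  integration take place with nonnegative integrals; for bounded measurable functions on an interval
  the two agree.\<close>

lemma nn_integral_Icc_bounded:
  fixes \<phi> :: "real \<Rightarrow> real"
  assumes [measurable]: "\<phi> \<in> borel_measurable borel" and nn: "\<And>x. \<phi> x \<ge> 0" and bd: "\<And>x. x \<in> {a..b} \<Longrightarrow> \<phi> x \<le> D"
  shows "\<phi> integrable_on {a..b}" and "(\<integral>\<^sup>+x. ennreal (\<phi> x) * indicator {a..b} x \<partial>lborel) = ennreal (integral {a..b} \<phi>)"
proof -
  have "integrable lborel (\<lambda>x. indicator {a..b} x *\<^sub>R D)" by (auto simp: integrable_indicator_iff emeasure_lborel_Icc_eq)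
  hence "integrable lborel (\<lambda>x. indicator {a..b} x *\<^sub>R \<phi> x)"
    by (rule Bochner_Integration.integrable_bound) (use nn bd in \<open>auto split: split_indicator intro!: AE_I2 order_trans[OF bd abs_ge_self]\<close>)
  hence si: "set_integrable lborel {a..b} \<phi>" by (simp add: set_integrable_def)
  from set_borel_integral_eq_integral[OF this] show "\<phi> integrable_on {a..b}" by simp
  have "(\<integral>\<^sup>+x. ennreal (\<phi> x) * indicator {a..b} x \<partial>lborel) = (\<integral>\<^sup>+x. ennreal (indicator {a..b} x *\<^sub>R \<phi> x) \<partial>lborel)"
    by (intro nn_integral_cong) (auto split: split_indicator)
  also have "\<dots> = ennreal (LINT x|lborel. indicator {a..b} x *\<^sub>R \<phi> x)"
    using si nn by (intro nn_integral_eq_integral) (auto simp: set_integrable_def)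
  also have "\<dots> = ennreal (integral {a..b} \<phi>)"
    using set_borel_integral_eq_integral(2)[OF si] by (simp add: set_lebesgue_integral_def)
  finally show "(\<integral>\<^sup>+x. ennreal (\<phi> x) * indicator {a..b} x \<partial>lborel) = ennreal (integral {a..b} \<phi>)" .
qed

lemma gF_bounded: "\<exists>D\<ge>0. \<forall>x. 0 \<le> x \<and> x \<le> B \<longrightarrow> norm (gF Lam m x) \<le> D"
proof (intro exI conjI allI impI)
  let ?D = "(\<Sum>n\<in>{1..nat \<lfloor>B\<rfloor>}. norm (Lam n)) + real m * \<bar>B\<bar>"
  show "?D \<ge> 0" by (intro add_nonneg_nonneg sum_nonneg) auto
  fix x assume x: "0 \<le> x \<and> x \<le> B"
  have "norm (psiF Lam x) \<le> (\<Sum>n\<in>{1..nat \<lfloor>x\<rfloor>}. norm (Lam n))" unfolding psiF_def by (rule norm_sum)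
  also have "\<dots> \<le> (\<Sum>n\<in>{1..nat \<lfloor>B\<rfloor>}. norm (Lam n))"
    using x by (intro sum_mono2) (auto simp: le_nat_iff intro: order_trans[OF _ floor_mono])
  finally have "norm (psiF Lam x) \<le> (\<Sum>n\<in>{1..nat \<lfloor>B\<rfloor>}. norm (Lam n))" .
  moreover have "norm (of_nat m * complex_of_real x) \<le> real m * \<bar>B\<bar>"
    using x by (auto simp: norm_mult intro!: mult_left_mono)
  ultimately show "norm (gF Lam m x) \<le> ?D"
    unfolding gF_def by (intro order_trans[OF norm_triangle_ineq4] add_mono)
qed

definition incr2 :: "(nat \<Rightarrow> complex) \<Rightarrow> nat \<Rightarrow> real \<Rightarrow> real \<Rightarrow> real" where
  "incr2 Lam m x h = (norm (gF Lam m (x + h) - gF Lam m x))\<^sup>2"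

lemma incr2_nonneg [simp]: "incr2 Lam m x h \<ge> 0"
  by (simp add: incr2_def)

lemma measurable_incr2_comp [measurable (raw)]:
  assumes [measurable]: "f \<in> borel_measurable M" "h \<in> borel_measurable M"
  shows "(\<lambda>x. incr2 Lam m (f x) (h x)) \<in> borel_measurable M"
  unfolding incr2_def by measurable

lemma VF_eq: "VF Lam m X \<delta> = integral {1..X} (\<lambda>x. incr2 Lam m x (\<delta> * x))"
  by (simp add: VF_def incr2_def gF_def algebra_simps)

lemma VtF_eq: "VtF Lam m X h = integral {1..X} (\<lambda>x. incr2 Lam m x h)"
  by (simp add: VtF_def incr2_def gF_def algebra_simps)

lemma incr2_bounded:
  "\<exists>D. \<forall>x h. 0 \<le> x \<and> 0 \<le> x + h \<and> x \<le> B \<and> x + h \<le> B \<longrightarrow> incr2 Lam m x h \<le> D"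
proof -
  obtain D where D: "D \<ge> 0" "\<And>x. 0 \<le> x \<Longrightarrow> x \<le> B \<Longrightarrow> norm (gF Lam m x) \<le> D" using gF_bounded[of B Lam m] by auto
  show ?thesis
  proof (intro exI allI impI)
    fix x h assume "0 \<le> x \<and> 0 \<le> x + h \<and> x \<le> B \<and> x + h \<le> B"
    hence "norm (gF Lam m (x + h) - gF Lam m x) \<le> D + D"
      by (intro order_trans[OF norm_triangle_ineq4] add_mono D) auto
    thus "incr2 Lam m x h \<le> (D + D)\<^sup>2" unfolding incr2_def by (intro power_mono) auto
  qed
qed

lemma nn_integral_incr2_fixed:
  assumes "1 \<le> a" "h \<ge> 0"
  shows "(\<lambda>x. incr2 Lam m x h) integrable_on {a..b}"
    and "(\<integral>\<^sup>+x. ennreal (incr2 Lam m x h) * indicator {a..b} x \<partial>lborel) = ennreal (integral {a..b} (\<lambda>x. incr2 Lam m x h))"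
proof -
  obtain D where D: "\<And>x h'. 0 \<le> x \<Longrightarrow> 0 \<le> x + h' \<Longrightarrow> x \<le> b + h \<Longrightarrow> x + h' \<le> b + h \<Longrightarrow> incr2 Lam m x h' \<le> D"
    using incr2_bounded[of "b + h" Lam m] by metis
  have bd: "incr2 Lam m x h \<le> D" if "x \<in> {a..b}" for x using that assms by (intro D) auto
  show "(\<lambda>x. incr2 Lam m x h) integrable_on {a..b}"
    by (rule nn_integral_Icc_bounded(1)[OF _ _ bd]) auto
  show "(\<integral>\<^sup>+x. ennreal (incr2 Lam m x h) * indicator {a..b} x \<partial>lborel) = ennreal (integral {a..b} (\<lambda>x. incr2 Lam m x h))"
    by (rule nn_integral_Icc_bounded(2)[OF _ _ bd]) auto
qed

lemma nn_integral_incr2_mult: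
  assumes "1 \<le> a" "\<delta> \<ge> 0"
  shows "(\<lambda>x. incr2 Lam m x (\<delta> * x)) integrable_on {a..b}"
    and "(\<integral>\<^sup>+x. ennreal (incr2 Lam m x (\<delta> * x)) * indicator {a..b} x \<partial>lborel) = ennreal (integral {a..b} (\<lambda>x. incr2 Lam m x (\<delta> * x)))"
proof -
  obtain D where D: "\<And>x h'. 0 \<le> x \<Longrightarrow> 0 \<le> x + h' \<Longrightarrow> x \<le> b + \<delta> * b \<Longrightarrow> x + h' \<le> b + \<delta> * b \<Longrightarrow> incr2 Lam m x h' \<le> D"
    using incr2_bounded[of "b + \<delta> * b" Lam m] by metis
  have bd: "incr2 Lam m x (\<delta> * x) \<le> D" if "x \<in> {a..b}" for x
    using that assms by (intro D) (auto intro!: add_mono mult_left_mono add_nonneg_nonneg mult_nonneg_nonneg intro: order_trans[OF _ le_add_same_cancel1[THEN iffD2]])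
  show "(\<lambda>x. incr2 Lam m x (\<delta> * x)) integrable_on {a..b}"
    by (rule nn_integral_Icc_bounded(1)[OF _ _ bd]) auto
  show "(\<integral>\<^sup>+x. ennreal (incr2 Lam m x (\<delta> * x)) * indicator {a..b} x \<partial>lborel) = ennreal (integral {a..b} (\<lambda>x. incr2 Lam m x (\<delta> * x)))"
    by (rule nn_integral_Icc_bounded(2)[OF _ _ bd]) auto
qed

lemma nn_integral_powr_unit:
  fixes e :: real
  assumes "e > 0"
  shows "(\<integral>\<^sup>+\<kappa>. ennreal (\<kappa> powr (e - 1)) * indicator {0..1} \<kappa> \<partial>lborel) = ennreal (1 / e)"
proof -
  have "((\<lambda>\<kappa>. \<kappa> powr (e - 1)) has_integral (1 powr (e - 1 + 1) / (e - 1 + 1))) {0..1}"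
    using assms by (intro has_integral_powr_from_0) auto
  hence "((\<lambda>\<kappa>. \<kappa> powr (e - 1)) has_integral 1 / e) {0..1}" by simp
  hence "(\<integral>\<^sup>+\<kappa>. ennreal (indicator {0..1} \<kappa> * \<kappa> powr (e - 1)) \<partial>lborel) = ennreal (1 / e)"
    using nn_integral_has_integral_lebesgue[of "{0..1}" "\<lambda>\<kappa>. \<kappa> powr (e - 1)" "1 / e"] by (simp add: nn_integral_completion)
  moreover have "(\<integral>\<^sup>+\<kappa>. ennreal (\<kappa> powr (e - 1)) * indicator {0..1} \<kappa> \<partial>lborel) = (\<integral>\<^sup>+\<kappa>. ennreal (indicator {0..1} \<kappa> * \<kappa> powr (e - 1)) \<partial>lborel)"
    by (intro nn_integral_cong) (auto split: split_indicator)
  ultimately show ?thesis by simp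
qed

text \<open>With \<open>v = \<kappa> * x\<close> the proportional mean square bound applies for each
  \<open>\<kappa>\<close>. The support forces \<open>x \<le> V / \<kappa>\<close> besides
  \<open>x \<le> X\<close>; spending part of the power of \<open>x\<close> on the first condition
  and the rest on the second leaves \<open>\<kappa> powr (e - 1)\<close>, just integrable at 0, and
  a bound in which \<open>Z\<close> does not occur.\<close>

lemma short_shift_mean_square:
  assumes K: "K \<ge> 0" "\<And>\<kappa> Y. 0 < \<kappa> \<Longrightarrow> \<kappa> \<le> 1 \<Longrightarrow> Y \<ge> 1 \<Longrightarrow>
     (\<integral>\<^sup>+x. ennreal ((norm (gF Lam m (x + \<kappa> * x) - gF Lam m x))\<^sup>2 * x powr (- 2 - 2 * e)) * indicator {1..Y} x \<partial>lborel)
       \<le> ennreal (K * \<kappa> powr (1 - e))"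
    and e: "0 < e" "e \<le> 1" and Z: "1 \<le> Z" "Z \<le> X" and V: "0 < V" "V \<le> Z"
  shows "(\<integral>\<^sup>+x. \<integral>\<^sup>+v. ennreal (incr2 Lam m x v) * indicator {Z..X} x * indicator {0..V} v \<partial>lborel \<partial>lborel)
      \<le> ennreal (K / e * X powr (1 + 4 * e) * V powr (2 - 2 * e))"
proof -
  define F where "F = (\<lambda>x \<kappa>. ennreal (x * incr2 Lam m x (\<kappa> * x)) * indicator {Z..X} x * indicator {0..V} (\<kappa> * x))"
  have [measurable]: "case_prod F \<in> borel_measurable (borel \<Otimes>\<^sub>M borel)" unfolding F_def by measurable
  have "(\<integral>\<^sup>+x. \<integral>\<^sup>+v. ennreal (incr2 Lam m x v) * indicator {Z..X} x * indicator {0..V} v \<partial>lborel \<partial>lborel) =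
      (\<integral>\<^sup>+x. \<integral>\<^sup>+\<kappa>. F x \<kappa> \<partial>lborel \<partial>lborel)"
  proof (rule nn_integral_cong)
    fix x :: real
    show "(\<integral>\<^sup>+v. ennreal (incr2 Lam m x v) * indicator {Z..X} x * indicator {0..V} v \<partial>lborel) = (\<integral>\<^sup>+\<kappa>. F x \<kappa> \<partial>lborel)"
    proof (cases "x \<in> {Z..X}")
      case True
      hence x: "x > 0" using Z by auto
      have "(\<integral>\<^sup>+v. ennreal (incr2 Lam m x v) * indicator {Z..X} x * indicator {0..V} v \<partial>lborel) =
         ennreal \<bar>x\<bar> * (\<integral>\<^sup>+\<kappa>. ennreal (incr2 Lam m x (0 + x * \<kappa>)) * indicator {Z..X} x * indicator {0..V} (0 + x * \<kappa>) \<partial>lborel)"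
        using x by (intro nn_integral_real_affine) auto
      also have "\<dots> = (\<integral>\<^sup>+\<kappa>. ennreal \<bar>x\<bar> * (ennreal (incr2 Lam m x (0 + x * \<kappa>)) * indicator {Z..X} x * indicator {0..V} (0 + x * \<kappa>)) \<partial>lborel)"
        by (rule nn_integral_cmult[symmetric]) measurable
      also have "\<dots> = (\<integral>\<^sup>+\<kappa>. F x \<kappa> \<partial>lborel)"
        using x by (intro nn_integral_cong) (auto simp: F_def ennreal_mult mult_ac)
      finally show ?thesis .
    qed (simp add: F_def)
  qed
  also have "\<dots> = (\<integral>\<^sup>+\<kappa>. \<integral>\<^sup>+x. F x \<kappa> \<partial>lborel \<partial>lborel)"
    by (rule lborel_pair.Fubini'[symmetric]) measurable
  also have "\<dots> \<le> (\<integral>\<^sup>+\<kappa>. ennreal (K * X powr (1 + 4 * e) * V powr (2 - 2 * e)) * (ennreal (\<kappa> powr (e - 1)) * indicator {0..1} \<kappa>) \<partial>lborel)"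
  proof (rule nn_integral_mono_AE)
    have "AE \<kappa> in lborel. \<kappa> \<noteq> (0::real)" by (rule AE_lborel_singleton)
    thus "AE \<kappa> in lborel. (\<integral>\<^sup>+x. F x \<kappa> \<partial>lborel) \<le> ennreal (K * X powr (1 + 4 * e) * V powr (2 - 2 * e)) * (ennreal (\<kappa> powr (e - 1)) * indicator {0..1} \<kappa>)"
    proof eventually_elim
      case (elim \<kappa>)
      show ?case
      proof (cases "0 < \<kappa> \<and> \<kappa> \<le> 1")
        case False
        have "F x \<kappa> = 0" for x
        proof (rule ccontr)
          assume "F x \<kappa> \<noteq> 0"
          hence x: "Z \<le> x" "x \<le> X" "0 \<le> \<kappa> * x" "\<kappa> * x \<le> V" by (auto simp: F_def split: split_indicator_asm)
          hence "x > 0" using Z by auto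
          hence "\<kappa> \<ge> 0" using x by (simp add: zero_le_mult_iff)
          moreover have "\<kappa> * x \<le> 1 * x" using x V by linarith
          hence "\<kappa> \<le> 1" using \<open>x > 0\<close> by (simp only: mult_le_cancel_right_pos)
          ultimately show False using False elim by auto
        qed
        thus ?thesis by simp
      next
        case True
        have "(\<integral>\<^sup>+x. F x \<kappa> \<partial>lborel) \<le> (\<integral>\<^sup>+x. ennreal (X powr (1 + 4 * e) * (V / \<kappa>) powr (2 - 2 * e)) *
            (ennreal ((norm (gF Lam m (x + \<kappa> * x) - gF Lam m x))\<^sup>2 * x powr (- 2 - 2 * e)) * indicator {1..X} x) \<partial>lborel)"
        proof (intro nn_integral_mono)
          fix x :: real
          show "F x \<kappa> \<le> ennreal (X powr (1 + 4 * e) * (V / \<kappa>) powr (2 - 2 * e)) *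
            (ennreal ((norm (gF Lam m (x + \<kappa> * x) - gF Lam m x))\<^sup>2 * x powr (- 2 - 2 * e)) * indicator {1..X} x)"
          proof (cases "x \<in> {Z..X} \<and> \<kappa> * x \<in> {0..V}")
            case t: True
            hence x: "x \<ge> 1" "x \<le> X" "x \<le> V / \<kappa>" using Z True by (auto simp: field_simps)
            define N where "N = (norm (gF Lam m (x + \<kappa> * x) - gF Lam m x))\<^sup>2"
            have "x = x powr (1 + 4 * e) * x powr (2 - 2 * e) * x powr (- 2 - 2 * e)"
              using x by (simp flip: powr_add)
            hence "x * N = (x powr (1 + 4 * e) * x powr (2 - 2 * e)) * (N * x powr (- 2 - 2 * e))"
              by (metis mult.assoc mult.commute)
            also have "\<dots> \<le> (X powr (1 + 4 * e) * (V / \<kappa>) powr (2 - 2 * e)) * (N * x powr (- 2 - 2 * e))"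
              using x e by (intro mult_right_mono mult_mono powr_mono2) (auto simp: N_def)
            finally have "ennreal (x * N) \<le> ennreal ((X powr (1 + 4 * e) * (V / \<kappa>) powr (2 - 2 * e)) * (N * x powr (- 2 - 2 * e)))"
              by (rule ennreal_leI)
            thus ?thesis using t x by (simp add: F_def incr2_def N_def ennreal_mult')
          qed (auto simp: F_def split: split_indicator)
        qed
        also have "\<dots> = ennreal (X powr (1 + 4 * e) * (V / \<kappa>) powr (2 - 2 * e)) *
            (\<integral>\<^sup>+x. ennreal ((norm (gF Lam m (x + \<kappa> * x) - gF Lam m x))\<^sup>2 * x powr (- 2 - 2 * e)) * indicator {1..X} x \<partial>lborel)"
          by (rule nn_integral_cmult) measurable
        also have "\<dots> \<le> ennreal (X powr (1 + 4 * e) * (V / \<kappa>) powr (2 - 2 * e)) * ennreal (K * \<kappa> powr (1 - e))"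
          using True Z by (intro mult_left_mono K(2)) auto
        also have "\<dots> = ennreal (X powr (1 + 4 * e) * (V / \<kappa>) powr (2 - 2 * e) * (K * \<kappa> powr (1 - e)))"
          using K by (intro ennreal_mult[symmetric]) auto
        also have "(V / \<kappa>) powr (2 - 2 * e) = V powr (2 - 2 * e) * \<kappa> powr (- (2 - 2 * e))"
          using V True by (subst powr_minus) (simp add: powr_divide field_simps)
        also have "X powr (1 + 4 * e) * (V powr (2 - 2 * e) * \<kappa> powr (- (2 - 2 * e))) * (K * \<kappa> powr (1 - e)) =
            K * X powr (1 + 4 * e) * V powr (2 - 2 * e) * (\<kappa> powr (- (2 - 2 * e)) * \<kappa> powr (1 - e))" by (simp only: mult_ac)
        also have "\<kappa> powr (- (2 - 2 * e)) * \<kappa> powr (1 - e) = \<kappa> powr (e - 1)" by (simp flip: powr_add)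
        finally show ?thesis using True K by (simp add: ennreal_mult)
      qed
    qed
  qed
  also have "\<dots> = ennreal (K * X powr (1 + 4 * e) * V powr (2 - 2 * e)) * ennreal (1 / e)"
    unfolding nn_integral_powr_unit[OF e(1), symmetric] by (rule nn_integral_cmult) measurable
  also have "\<dots> = ennreal (K * X powr (1 + 4 * e) * V powr (2 - 2 * e) * (1 / e))"
    using K e by (intro ennreal_mult[symmetric]) auto
  finally show ?thesis by (simp add: mult_ac)
qed


section \<open>Perturbation of squares and the main terms\<close>

text \<open>The cross term is split with weight \<open>\<theta>\<close>. Both inequalities charge it
  to \<open>norm p\<close> and not to \<open>norm (p - b)\<close>, so after integration only the
  proportional variance and the short shifts occur in the error.\<close>

lemma norm_square_perturb:
  fixes p b :: complex
  assumes "\<theta> > 0"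
  shows "(norm p)\<^sup>2 \<le> (norm (p - b))\<^sup>2 + \<theta> * (norm p)\<^sup>2 + (1 / \<theta> + 1) * (norm b)\<^sup>2"
    and "(norm (p - b))\<^sup>2 \<le> (norm p)\<^sup>2 + \<theta> * (norm p)\<^sup>2 + (1 / \<theta> + 1) * (norm b)\<^sup>2"
proof -
  define P B A where "P = norm p" and "B = norm b" and "A = norm (p - b)"
  have tri: "P \<le> A + B" "A \<le> P + B" "A \<ge> 0" "B \<ge> 0" "P \<ge> 0"
    using norm_triangle_ineq[of "p - b" b] norm_triangle_ineq4[of p b] by (auto simp: P_def B_def A_def)
  have amgm: "2 * P * B \<le> \<theta> * P\<^sup>2 + 1 / \<theta> * B\<^sup>2"
  proof -
    have "0 \<le> (\<theta> * P - B)\<^sup>2" by simp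
    hence "2 * P * B * \<theta> \<le> (\<theta> * P\<^sup>2 + 1 / \<theta> * B\<^sup>2) * \<theta>" using assms by (simp add: power2_eq_square algebra_simps)
    thus ?thesis using assms by simp
  qed
  have "A\<^sup>2 \<le> (P + B)\<^sup>2" using tri by (intro power_mono) auto
  also have "\<dots> = P\<^sup>2 + 2 * P * B + B\<^sup>2" by (simp add: power2_eq_square algebra_simps)
  finally show "(norm (p - b))\<^sup>2 \<le> (norm p)\<^sup>2 + \<theta> * (norm p)\<^sup>2 + (1 / \<theta> + 1) * (norm b)\<^sup>2"
    using amgm unfolding P_def B_def A_def by (simp add: algebra_simps)
  have "P\<^sup>2 \<le> A\<^sup>2 + 2 * P * B"
  proof (cases "P \<le> B")
    case True
    have "P * P \<le> P * B" using True tri by (intro mult_left_mono) auto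
    moreover have "P * B \<ge> 0" using tri by simp
    ultimately have "P\<^sup>2 \<le> 2 * P * B" unfolding power2_eq_square by linarith
    thus ?thesis using zero_le_power2[of A] by linarith
  next
    case False
    have "(P - B)\<^sup>2 \<le> A\<^sup>2" using False tri by (intro power_mono) auto
    moreover have "(P - B)\<^sup>2 = P\<^sup>2 - 2 * P * B + B\<^sup>2" by (rule power2_diff[THEN trans]) simp
    ultimately show ?thesis using zero_le_power2[of B] by linarith
  qed
  thus "(norm p)\<^sup>2 \<le> (norm (p - b))\<^sup>2 + \<theta> * (norm p)\<^sup>2 + (1 / \<theta> + 1) * (norm b)\<^sup>2"
  proof -
    have "(1 / \<theta> + 1) * B\<^sup>2 = 1 / \<theta> * B\<^sup>2 + B\<^sup>2" by (simp add: distrib_right)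
    moreover assume "P\<^sup>2 \<le> A\<^sup>2 + 2 * P * B"
    ultimately show ?thesis using amgm zero_le_power2[of B] unfolding P_def[symmetric] B_def[symmetric] A_def[symmetric] by linarith
  qed
qed

text \<open>The main terms for the shifts \<open>h\<close> and \<open>\<delta> x\<close> are \<open>h * main_fixed X\<close> and \<open>\<delta> * main_mult X\<close>; they match because both
  \<open>main_fixed\<close> and \<open>main_mult\<close> are primitives of multiples of one density.\<close>
definition main_density :: "real \<Rightarrow> real" where
  "main_density u = ln u + 1/2 - 4/3 * ln 2"

definition main_fixed :: "real \<Rightarrow> real" where
  "main_fixed u = u * (ln u - 1/2 - 4/3 * ln 2)"

definition main_mult :: "real \<Rightarrow> real" where
  "main_mult x = x\<^sup>2 * (1/2 * ln x - 2/3 * ln 2)"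

text \<open>At \<open>u = 8\<close> one has \<open>ln u = 3 * ln 2\<close>, which outweighs
  \<open>4/3 * ln 2\<close>; the upper bound rests on \<open>1/2 \<le> 4/3 * ln 2\<close>.
  Nonnegativity lets the main terms be handled as nonnegative integrals.\<close>

lemma main_density_bounds:
  assumes "u \<ge> 8"
  shows "main_density u \<ge> 0" "main_density u \<le> ln u"
proof -
  have "ln 8 = 3 * ln (2::real)" using ln_realpow[of "2::real" 3] by simp
  moreover have "ln 8 \<le> ln u" using assms by simp
  moreover have "ln (2::real) \<ge> 2/3" "ln (2::real) > 0" using ln2_ge_two_thirds by auto
  ultimately show "main_density u \<ge> 0" "main_density u \<le> ln u" unfolding main_density_def by linarith+
qed

lemma measurable_main_density [measurable]: "main_density \<in> borel_measurable borel"
  unfolding main_density_def[abs_def] by measurable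

lemma main_fixed_deriv:
  assumes u: "u > 0"
  shows "(main_fixed has_real_derivative main_density u) (at u)"
  unfolding main_fixed_def[abs_def]
  by (rule DERIV_cong[OF DERIV_mult[OF DERIV_ident DERIV_diff[OF DERIV_diff[OF DERIV_ln_divide[OF u] DERIV_const] DERIV_const]]])
     (use u in \<open>simp add: main_density_def\<close>)

lemma main_mult_deriv:
  assumes x: "x > 0"
  shows "(main_mult has_real_derivative x * main_density x) (at x)"
  unfolding main_mult_def[abs_def]
proof (rule DERIV_cong[OF DERIV_mult[OF DERIV_pow DERIV_diff[OF DERIV_cmult[OF DERIV_ln_divide[OF x]] DERIV_const]]])
  have "1 / 2 * (1 / x) * x\<^sup>2 = x / 2" using x by (simp add: power2_eq_square)
  thus "real 2 * x ^ (2 - Suc 0) * (1/2 * ln x - 2/3 * ln 2) + (1/2 * (1 / x) - 0) * x\<^sup>2 = x * main_density x"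
    by (simp add: main_density_def algebra_simps)
qed

lemma nn_integral_main_density:
  assumes "8 \<le> a" "a \<le> b" "w \<ge> 0"
  shows "(\<integral>\<^sup>+u. ennreal (w * main_density u) * indicator {a..b} u \<partial>lborel) = ennreal (w * (main_fixed b - main_fixed a))"
proof -
  have "(\<integral>\<^sup>+u. ennreal (w * main_density u) * indicator {a..b} u \<partial>lborel) = ennreal (w * main_fixed b - w * main_fixed a)"
  proof (rule nn_integral_FTC_Icc[where F = "\<lambda>u. w * main_fixed u"])
    fix u assume u: "u \<in> {a..b}"
    show "DERIV (\<lambda>u. w * main_fixed u) u :> w * main_density u"
      using u assms by (intro DERIV_cmult main_fixed_deriv) auto
    show "0 \<le> w * main_density u" using u assms by (intro mult_nonneg_nonneg main_density_bounds) auto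
  qed (use assms in auto)
  thus ?thesis by (simp add: right_diff_distrib)
qed

lemma nn_integral_main_mult:
  assumes "8 \<le> a" "a \<le> b" "\<delta> \<ge> 0"
  shows "(\<integral>\<^sup>+x. ennreal (\<delta> * x * main_density x) * indicator {a..b} x \<partial>lborel) = ennreal (\<delta> * (main_mult b - main_mult a))"
proof -
  have "(\<integral>\<^sup>+x. ennreal (\<delta> * (x * main_density x)) * indicator {a..b} x \<partial>lborel) = ennreal (\<delta> * main_mult b - \<delta> * main_mult a)"
  proof (rule nn_integral_FTC_Icc[where F = "\<lambda>x. \<delta> * main_mult x"])
    fix x assume x: "x \<in> {a..b}"
    show "DERIV (\<lambda>x. \<delta> * main_mult x) x :> \<delta> * (x * main_density x)"
      using x assms by (intro DERIV_cmult main_mult_deriv) auto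
    show "0 \<le> \<delta> * (x * main_density x)" using x assms by (intro mult_nonneg_nonneg main_density_bounds) auto
  qed (use assms in auto)
  thus ?thesis by (simp add: right_diff_distrib mult.assoc)
qed

text \<open>Two effects compete: shortening the shift by \<open>v\<close> costs at most
  \<open>v\<close> times the density, and the density itself rises by
  \<open>ln (1 + v / x) \<le> v / x\<close>, which costs at most \<open>\<delta> * v\<close>. Each
  matters in only one of the two directions.\<close>

lemma main_density_shift:
  assumes x: "8 \<le> x" "x \<le> X" and v: "0 \<le> v" "v \<le> V" "v \<le> \<delta> * x" and \<delta>: "0 < \<delta>" "\<delta> \<le> 1"
  shows "(\<delta> * x - v) * main_density (x + v) \<le> \<delta> * x * main_density x + V * ln X"
    and "\<delta> * x * main_density x \<le> (\<delta> * x - v) * main_density (x + v) + V * ln X"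
proof -
  have lnx: "ln x \<le> ln X" using x by simp
  have ln1: "ln x \<ge> 1"
  proof -
    have "ln (exp 1) \<le> ln x" using exp_le x by (intro ln_mono) auto
    thus ?thesis by simp
  qed
  have "main_density (x + v) = main_density x + ln (1 + v / x)"
  proof -
    have "x + v = x * (1 + v / x)" using x by (simp add: field_simps)
    moreover have "ln (x * (1 + v / x)) = ln x + ln (1 + v / x)"
      using x v by (subst ln_mult_pos) (auto intro!: add_pos_nonneg)
    ultimately show ?thesis by (simp add: main_density_def)
  qed
  moreover have "ln (1 + v / x) \<le> v / x" using x v by (intro ln_add_one_self_le_self) auto
  moreover have "ln (1 + v / x) \<ge> 0" using x v by (intro ln_ge_zero) auto
  ultimately have md: "main_density (x + v) \<le> main_density x + v / x" "main_density x \<le> main_density (x + v)" by auto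
  note mb = main_density_bounds[OF x(1)]
  have "(\<delta> * x - v) * main_density (x + v) \<le> \<delta> * x * (main_density x + v / x)"
    using md mb v x \<delta> by (intro mult_mono) auto
  also have "\<dots> = \<delta> * x * main_density x + \<delta> * v" using x by (simp add: field_simps)
  also have "\<delta> * v \<le> 1 * v" using \<delta> v by (intro mult_right_mono) auto
  also have "1 * v \<le> V * 1" using v by simp
  also have "V * 1 \<le> V * ln X" using v ln1 lnx by (intro mult_left_mono) auto
  finally show "(\<delta> * x - v) * main_density (x + v) \<le> \<delta> * x * main_density x + V * ln X" by simp
  have "\<delta> * x * main_density x = (\<delta> * x - v) * main_density x + v * main_density x" by (simp add: algebra_simps)
  also have "\<dots> \<le> (\<delta> * x - v) * main_density (x + v) + V * ln X"
    using md mb v lnx ln1 by (intro add_mono mult_left_mono mult_mono) auto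
  finally show "\<delta> * x * main_density x \<le> (\<delta> * x - v) * main_density (x + v) + V * ln X" .
qed


section \<open>Averages over a rectangle\<close>

text \<open>Kept without normalisation and in \<open>ennreal\<close>: additivity and the exchange of
  integrals then ask for measurability only, and division by \<open>V\<close> is postponed to the
  real numbers.\<close>

definition dint :: "real \<Rightarrow> real \<Rightarrow> real \<Rightarrow> (real \<Rightarrow> real \<Rightarrow> real) \<Rightarrow> ennreal" where
  "dint Z X V f = (\<integral>\<^sup>+x. \<integral>\<^sup>+v. ennreal (f x v) * indicator {Z..X} x * indicator {0..V} v \<partial>lborel \<partial>lborel)"

lemma dint_le_add:
  assumes [measurable]: "case_prod f1 \<in> borel_measurable (borel \<Otimes>\<^sub>M borel)" "case_prod f2 \<in> borel_measurable (borel \<Otimes>\<^sub>M borel)"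
    and le: "\<And>x v. x \<in> {Z..X} \<Longrightarrow> v \<in> {0..V} \<Longrightarrow> f x v \<le> f1 x v + f2 x v"
    and nn: "\<And>x v. x \<in> {Z..X} \<Longrightarrow> v \<in> {0..V} \<Longrightarrow> f1 x v \<ge> 0" "\<And>x v. x \<in> {Z..X} \<Longrightarrow> v \<in> {0..V} \<Longrightarrow> f2 x v \<ge> 0"
  shows "dint Z X V f \<le> dint Z X V f1 + dint Z X V f2"
proof -
  have "dint Z X V f \<le> (\<integral>\<^sup>+x. \<integral>\<^sup>+v. ennreal (f1 x v) * indicator {Z..X} x * indicator {0..V} v + ennreal (f2 x v) * indicator {Z..X} x * indicator {0..V} v \<partial>lborel \<partial>lborel)"
    unfolding dint_def
    by (intro nn_integral_mono) (use le nn in \<open>auto split: split_indicator simp flip: ennreal_plus intro!: ennreal_leI\<close>)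
  also have "\<dots> = (\<integral>\<^sup>+x. (\<integral>\<^sup>+v. ennreal (f1 x v) * indicator {Z..X} x * indicator {0..V} v \<partial>lborel) + (\<integral>\<^sup>+v. ennreal (f2 x v) * indicator {Z..X} x * indicator {0..V} v \<partial>lborel) \<partial>lborel)"
    by (intro nn_integral_cong nn_integral_add) measurable
  also have "\<dots> = dint Z X V f1 + dint Z X V f2"
    unfolding dint_def by (intro nn_integral_add) measurable
  finally show ?thesis .
qed

lemma dint_cmult:
  assumes [measurable]: "case_prod f \<in> borel_measurable (borel \<Otimes>\<^sub>M borel)" and c: "c \<ge> 0"
  shows "dint Z X V (\<lambda>x v. c * f x v) = ennreal c * dint Z X V f"
proof -
  have "dint Z X V (\<lambda>x v. c * f x v) = (\<integral>\<^sup>+x. \<integral>\<^sup>+v. ennreal c * (ennreal (f x v) * indicator {Z..X} x * indicator {0..V} v) \<partial>lborel \<partial>lborel)"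
    unfolding dint_def using c by (intro nn_integral_cong) (simp add: ennreal_mult' mult_ac)
  also have "\<dots> = (\<integral>\<^sup>+x. ennreal c * (\<integral>\<^sup>+v. ennreal (f x v) * indicator {Z..X} x * indicator {0..V} v \<partial>lborel) \<partial>lborel)"
    by (intro nn_integral_cong nn_integral_cmult) measurable
  also have "\<dots> = ennreal c * dint Z X V f" unfolding dint_def by (rule nn_integral_cmult) measurable
  finally show ?thesis .
qed

lemma dint_fst:
  assumes [measurable]: "f \<in> borel_measurable borel" and V: "V \<ge> 0"
  shows "dint Z X V (\<lambda>x v. f x) = ennreal V * (\<integral>\<^sup>+x. ennreal (f x) * indicator {Z..X} x \<partial>lborel)"
proof -
  have "dint Z X V (\<lambda>x v. f x) = (\<integral>\<^sup>+x. ennreal V * (ennreal (f x) * indicator {Z..X} x) \<partial>lborel)"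
    unfolding dint_def
  proof (rule nn_integral_cong)
    fix x
    have "(\<integral>\<^sup>+v. ennreal (f x) * indicator {Z..X} x * indicator {0..V} v \<partial>lborel) = ennreal (f x) * indicator {Z..X} x * emeasure lborel {0..V}"
      by (rule nn_integral_cmult_indicator) auto
    thus "(\<integral>\<^sup>+v. ennreal (f x) * indicator {Z..X} x * indicator {0..V} v \<partial>lborel) = ennreal V * (ennreal (f x) * indicator {Z..X} x)"
      using V by (simp add: mult_ac)
  qed
  also have "\<dots> = ennreal V * (\<integral>\<^sup>+x. ennreal (f x) * indicator {Z..X} x \<partial>lborel)" by (rule nn_integral_cmult) measurable
  finally show ?thesis .
qed

text \<open>For fixed \<open>w = \<delta> x - v\<close> the rectangle is cut in an interval \<open>[a, b]\<close> of values \<open>u = x + v\<close>, where both inner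
  integrals are differences at the end points.\<close>
lemma dint_sheared_comparison:
  assumes Z: "8 \<le> Z" "Z \<le> X" and \<delta>: "0 < \<delta>" "\<delta> \<le> 1" and V: "0 < V" "V \<le> \<delta> * Z / 2" and \<eta>: "\<eta> \<ge> 0"
    and E: "\<And>u w. Z \<le> u \<Longrightarrow> u \<le> 2 * X \<Longrightarrow> \<delta> * u / 4 \<le> w \<Longrightarrow> w \<le> \<delta> * u \<Longrightarrow> \<bar>VtF Lam m u w - w * main_fixed u\<bar> \<le> \<eta>"
  defines "Sf \<equiv> dint Z X V (\<lambda>x v. incr2 Lam m (x + v) (\<delta> * x - v))"
    and "SP \<equiv> dint Z X V (\<lambda>x v. (\<delta> * x - v) * main_density (x + v))"
  shows "Sf \<le> SP + ennreal (2 * \<eta> * \<delta> * X)" and "SP \<le> Sf + ennreal (2 * \<eta> * \<delta> * X)"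
proof -
  \<comment> \<open>The rectangle in the coordinates \<open>(w, u)\<close>; solving its four
    inequalities for \<open>u\<close> gives the slice from \<open>a w\<close> to
    \<open>b w\<close>.\<close>
  define reg where "reg = (\<lambda>w u. (indicator {Z..X} ((u + w) / (1 + \<delta>)) * indicator {0..V} ((\<delta> * u - w) / (1 + \<delta>)) :: ennreal))"
  define a b where "a = (\<lambda>w. max (Z * (1 + \<delta>) - w) (w / \<delta>))" and "b = (\<lambda>w. min (X * (1 + \<delta>) - w) ((w + (1 + \<delta>) * V) / \<delta>))"
  have reg: "reg w u = indicator {a w..b w} u" for w u
    using \<delta> by (auto simp: reg_def a_def b_def indicator_def pos_le_divide_eq pos_divide_le_eq field_simps)
  have coords: "(u + w) / (1 + \<delta>) + (\<delta> * u - w) / (1 + \<delta>) = u" "\<delta> * ((u + w) / (1 + \<delta>)) - (\<delta> * u - w) / (1 + \<delta>) = w" for u w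
    using \<delta> by (simp_all add: divide_simps) (simp_all add: algebra_simps)
  define If where "If = (\<lambda>w. \<integral>\<^sup>+u. ennreal (incr2 Lam m u w) * reg w u \<partial>lborel)"
  define IP where "IP = (\<lambda>w. \<integral>\<^sup>+u. ennreal (w * main_density u) * reg w u \<partial>lborel)"
  have [measurable]: "case_prod reg \<in> borel_measurable (borel \<Otimes>\<^sub>M borel)" unfolding reg_def by measurable
  have [measurable]: "If \<in> borel_measurable borel" "IP \<in> borel_measurable borel" unfolding If_def IP_def by measurable
  have Sf: "Sf = ennreal (1 / (1 + \<delta>)) * (\<integral>\<^sup>+w. If w \<partial>lborel)"
    unfolding Sf_def dint_def by (subst nn_integral_shear[OF _ \<delta>(1)]) (simp_all only: coords If_def reg_def mult.assoc, measurable)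
  have SP: "SP = ennreal (1 / (1 + \<delta>)) * (\<integral>\<^sup>+w. IP w \<partial>lborel)"
    unfolding SP_def dint_def by (subst nn_integral_shear[OF _ \<delta>(1)]) (simp_all only: coords IP_def reg_def mult.assoc, measurable)
  have inner: "If w \<le> IP w + ennreal (2 * \<eta>) * indicator {0..\<delta> * X} w \<and> IP w \<le> If w + ennreal (2 * \<eta>) * indicator {0..\<delta> * X} w" for w
  proof (cases "a w \<le> b w")
    case False
    hence "reg w u = 0" for u by (simp add: reg)
    thus ?thesis by (simp add: If_def IP_def)
  next
    case True
    \<comment> \<open>From \<open>v \<le> \<delta> * x / 2\<close> and \<open>v \<le> x\<close>
      follow \<open>w \<ge> \<delta> * x / 2\<close> and \<open>u \<le> 2 * x\<close>, whence the
      constants in the range of \<open>E\<close>. This holds on the whole slice, in particular at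
      both end points, where \<open>E\<close> is applied.\<close>
    have good: "Z \<le> u \<and> u \<le> 2 * X \<and> \<delta> * u / 4 \<le> w \<and> w \<le> \<delta> * u \<and> 0 \<le> w \<and> w \<le> \<delta> * X" if u: "u \<in> {a w..b w}" for u
    proof -
      define x v where "x = (u + w) / (1 + \<delta>)" and "v = (\<delta> * u - w) / (1 + \<delta>)"
      have "reg w u \<noteq> 0" using u by (simp add: reg)
      hence xv: "Z \<le> x" "x \<le> X" "0 \<le> v" "v \<le> V" by (auto simp: reg_def x_def v_def split: split_indicator_asm)
      have uw: "u = x + v" "w = \<delta> * x - v" using coords[of u w] by (auto simp: x_def v_def)
      have "\<delta> * Z \<le> \<delta> * x" "\<delta> * x \<le> 1 * x" "\<delta> * x \<le> \<delta> * X" using \<delta> xv Z by (auto intro!: mult_left_mono mult_right_mono)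
      hence d: "v \<le> \<delta> * x / 2" "v \<le> x" using V xv Z by linarith+
      have "\<delta> * u \<le> \<delta> * (2 * x)" using d \<delta> unfolding uw by (intro mult_left_mono) auto
      moreover have "\<delta> * v \<ge> 0" using \<delta> xv by simp
      moreover have "\<delta> * u = \<delta> * x + \<delta> * v" by (simp add: uw algebra_simps)
      ultimately show ?thesis using d xv Z \<delta> uw \<open>\<delta> * x \<le> \<delta> * X\<close> by (intro conjI) linarith+
    qed
    have ga: "Z \<le> a w \<and> a w \<le> 2 * X \<and> \<delta> * a w / 4 \<le> w \<and> w \<le> \<delta> * a w \<and> 0 \<le> w \<and> w \<le> \<delta> * X"
      and gb: "Z \<le> b w \<and> b w \<le> 2 * X \<and> \<delta> * b w / 4 \<le> w \<and> w \<le> \<delta> * b w \<and> 0 \<le> w \<and> w \<le> \<delta> * X"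
      using good[of "a w"] good[of "b w"] True by auto
    have w: "0 \<le> w" "w \<le> \<delta> * X" using ga by auto
    define f where "f = integral {a w..b w} (\<lambda>x. incr2 Lam m x w)"
    have f0: "f \<ge> 0" unfolding f_def using ga Z by (intro integral_nonneg nn_integral_incr2_fixed) auto
    have "VtF Lam m (a w) w + f = VtF Lam m (b w) w"
      unfolding VtF_eq f_def using ga True w Z by (intro Henstock_Kurzweil_Integration.integral_combine nn_integral_incr2_fixed) auto
    hence fP: "\<bar>f - w * (main_fixed (b w) - main_fixed (a w))\<bar> \<le> 2 * \<eta>"
      using E[of "a w" w] E[of "b w" w] ga gb by (simp add: right_diff_distrib)
    have If: "If w = ennreal f" unfolding If_def reg f_def using ga Z w by (intro nn_integral_incr2_fixed) auto
    define P where "P = w * (main_fixed (b w) - main_fixed (a w))"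
    have IP: "IP w = ennreal P" unfolding IP_def reg P_def using ga Z w True by (intro nn_integral_main_density) auto
    have ind: "indicator {0..\<delta> * X} w = (1 :: ennreal)" using w by simp
    have "ennreal f \<le> ennreal P + ennreal (2 * \<eta>)"
    \<comment> \<open>\<open>ennreal\<close> sends negative numbers to 0, so a negative
      \<open>P\<close> is treated apart.\<close>
    proof (cases "P \<ge> 0")
      case True
      thus ?thesis using fP \<eta> by (simp add: P_def[symmetric] flip: ennreal_plus)
    next
      case False
      hence "f \<le> 2 * \<eta>" using fP by (simp add: P_def[symmetric])
      thus ?thesis using False by (simp add: ennreal_neg ennreal_leI)
    qed
    moreover have "ennreal P \<le> ennreal f + ennreal (2 * \<eta>)"
      using fP \<eta> f0 by (simp add: P_def[symmetric] flip: ennreal_plus)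
    ultimately show ?thesis unfolding If IP ind by simp
  qed
  have tot: "(\<integral>\<^sup>+w. ennreal (2 * \<eta>) * indicator {0..\<delta> * X} w \<partial>lborel) = ennreal (2 * \<eta> * \<delta> * X)"
    using \<delta> Z \<eta> by (simp add: nn_integral_cmult_indicator ennreal_mult[symmetric] mult.assoc)
  \<comment> \<open>The Jacobian factor is at most 1 and is dropped from the error term; in the main
    comparison it stands on both sides.\<close>
  have fin: "ennreal (1 / (1 + \<delta>)) * (A + T) \<le> ennreal (1 / (1 + \<delta>)) * A + T" for A T :: ennreal
  proof -
    have "ennreal (1 / (1 + \<delta>)) \<le> ennreal 1" using \<delta> by (intro ennreal_leI) simp
    hence "ennreal (1 / (1 + \<delta>)) * T \<le> 1 * T" by (intro mult_right_mono) auto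
    thus ?thesis by (simp add: distrib_left add_left_mono)
  qed
  have "(\<integral>\<^sup>+w. If w \<partial>lborel) \<le> (\<integral>\<^sup>+w. IP w + ennreal (2 * \<eta>) * indicator {0..\<delta> * X} w \<partial>lborel)"
    using inner by (intro nn_integral_mono) auto
  also have "\<dots> = (\<integral>\<^sup>+w. IP w \<partial>lborel) + ennreal (2 * \<eta> * \<delta> * X)" unfolding tot[symmetric] by (intro nn_integral_add) measurable
  finally show "Sf \<le> SP + ennreal (2 * \<eta> * \<delta> * X)" unfolding Sf SP by (intro order_trans[OF mult_left_mono fin]) auto
  have "(\<integral>\<^sup>+w. IP w \<partial>lborel) \<le> (\<integral>\<^sup>+w. If w + ennreal (2 * \<eta>) * indicator {0..\<delta> * X} w \<partial>lborel)"
    using inner by (intro nn_integral_mono) auto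
  also have "\<dots> = (\<integral>\<^sup>+w. If w \<partial>lborel) + ennreal (2 * \<eta> * \<delta> * X)" unfolding tot[symmetric] by (intro nn_integral_add) measurable
  finally show "SP \<le> Sf + ennreal (2 * \<eta> * \<delta> * X)" unfolding Sf SP by (intro order_trans[OF mult_left_mono fin]) auto
qed

text \<open>A chain of three links, each followed in both directions: from \<open>V * M\<close> to
  \<open>Sf\<close> by the perturbation inequality, from \<open>Sf\<close> to \<open>SP\<close> by
  shearing, from \<open>SP\<close> to \<open>V * N\<close> by moving the density. Here
  \<open>\<eta>\<close> is an absolute error for \<open>VtF\<close>, unlike the relative width in
  \<open>VF_estimate\<close>, and \<open>\<theta>\<close> is the weight of the cross term.\<close>

lemma averaged_comparison:
  assumes Z: "8 \<le> Z" "Z \<le> X" and \<delta>: "0 < \<delta>" "\<delta> \<le> 1" and V: "0 < V" "V \<le> \<delta> * Z / 2" and \<eta>: "\<eta> \<ge> 0" and \<theta>: "\<theta> > 0"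
    and E: "\<And>u w. Z \<le> u \<Longrightarrow> u \<le> 2 * X \<Longrightarrow> \<delta> * u / 4 \<le> w \<Longrightarrow> w \<le> \<delta> * u \<Longrightarrow> \<bar>VtF Lam m u w - w * main_fixed u\<bar> \<le> \<eta>"
    and B: "B \<ge> 0" "dint Z X V (incr2 Lam m) \<le> ennreal B"
  defines "M \<equiv> integral {Z..X} (\<lambda>x. incr2 Lam m x (\<delta> * x))" and "N \<equiv> \<delta> * (main_mult X - main_mult Z)"
  shows "\<bar>V * M - V * N\<bar> \<le> \<theta> * V * M + (1 / \<theta> + 1) * B + 2 * \<eta> * \<delta> * X + X * V\<^sup>2 * ln X"
proof -
  define T where "T = \<theta> * (V * M) + (1 / \<theta> + 1) * B"
  define U where "U = X * V\<^sup>2 * ln X"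
  define Sf where "Sf = dint Z X V (\<lambda>x v. incr2 Lam m (x + v) (\<delta> * x - v))"
  define SP where "SP = dint Z X V (\<lambda>x v. (\<delta> * x - v) * main_density (x + v))"
  have M0: "M \<ge> 0" unfolding M_def using Z \<delta> by (intro integral_nonneg nn_integral_incr2_mult) auto
  have N0: "N \<ge> 0" unfolding N_def
  proof (intro mult_nonneg_nonneg)
    have "main_mult Z \<le> main_mult X"
    proof (rule DERIV_nonneg_imp_nondecreasing[OF Z(2)])
      fix x assume "Z \<le> x" "x \<le> X"
      thus "\<exists>y. DERIV main_mult x :> y \<and> 0 \<le> y" using Z
        by (intro exI[of _ "x * main_density x"] conjI main_mult_deriv mult_nonneg_nonneg main_density_bounds) auto
    qed
    thus "main_mult X - main_mult Z \<ge> 0" by simp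
  qed (use \<delta> in auto)
  have lnX: "ln X \<ge> 0" using Z by simp
  have T0: "T \<ge> 0" and U0: "U \<ge> 0" using M0 V \<theta> B lnX Z by (auto simp: T_def U_def intro!: add_nonneg_nonneg mult_nonneg_nonneg)
  have MM: "dint Z X V (\<lambda>x v. incr2 Lam m x (\<delta> * x)) = ennreal (V * M)"
  proof -
    have "dint Z X V (\<lambda>x v. incr2 Lam m x (\<delta> * x)) = ennreal V * (\<integral>\<^sup>+x. ennreal (incr2 Lam m x (\<delta> * x)) * indicator {Z..X} x \<partial>lborel)"
      using V by (intro dint_fst) auto
    also have "\<dots> = ennreal V * ennreal M" unfolding M_def using Z \<delta> by (subst nn_integral_incr2_mult(2)) auto
    finally show ?thesis using V M0 by (simp add: ennreal_mult)
  qed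
  have NN: "dint Z X V (\<lambda>x v. \<delta> * x * main_density x) = ennreal (V * N)"
  proof -
    have "dint Z X V (\<lambda>x v. \<delta> * x * main_density x) = ennreal V * (\<integral>\<^sup>+x. ennreal (\<delta> * x * main_density x) * indicator {Z..X} x \<partial>lborel)"
      using V by (intro dint_fst) auto
    also have "\<dots> = ennreal V * ennreal N" unfolding N_def using Z \<delta> by (subst nn_integral_main_mult) auto
    finally show ?thesis using V N0 by (simp add: ennreal_mult)
  qed
  define R where "R = (\<lambda>x v. \<theta> * incr2 Lam m x (\<delta> * x) + (1 / \<theta> + 1) * incr2 Lam m x v)"
  have Rm[measurable]: "case_prod R \<in> borel_measurable (borel \<Otimes>\<^sub>M borel)" unfolding R_def by measurable
  have R0: "R x v \<ge> 0" for x v unfolding R_def using \<theta> by (intro add_nonneg_nonneg mult_nonneg_nonneg) auto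
  have "dint Z X V R \<le> dint Z X V (\<lambda>x v. \<theta> * incr2 Lam m x (\<delta> * x)) + dint Z X V (\<lambda>x v. (1 / \<theta> + 1) * incr2 Lam m x v)"
    by (rule dint_le_add) (use \<theta> in \<open>auto simp: R_def\<close>)
  also have "dint Z X V (\<lambda>x v. \<theta> * incr2 Lam m x (\<delta> * x)) = ennreal \<theta> * ennreal (V * M)"
    unfolding MM[symmetric] using \<theta> by (intro dint_cmult) auto
  also have "dint Z X V (\<lambda>x v. (1 / \<theta> + 1) * incr2 Lam m x v) = ennreal (1 / \<theta> + 1) * dint Z X V (incr2 Lam m)"
    using \<theta> by (intro dint_cmult) auto
  also have "\<dots> \<le> ennreal (1 / \<theta> + 1) * ennreal B" by (intro mult_left_mono B) auto
  also have "ennreal \<theta> * ennreal (V * M) + ennreal (1 / \<theta> + 1) * ennreal B = ennreal T"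
    unfolding T_def using \<theta> V M0 B by (simp add: ennreal_mult[symmetric] ennreal_plus[symmetric] del: ennreal_plus)
  finally have RT: "dint Z X V R \<le> ennreal T" by (simp add: add_left_mono)
  have pert: "incr2 Lam m x (\<delta> * x) \<le> incr2 Lam m (x + v) (\<delta> * x - v) + R x v"
             "incr2 Lam m (x + v) (\<delta> * x - v) \<le> incr2 Lam m x (\<delta> * x) + R x v" for x v
    using norm_square_perturb[OF \<theta>, of "gF Lam m (x + \<delta> * x) - gF Lam m x" "gF Lam m (x + v) - gF Lam m x"]
    by (auto simp: incr2_def R_def)
  have i1: "ennreal (V * M) \<le> Sf + ennreal T"
  proof -
    have "ennreal (V * M) \<le> Sf + dint Z X V R" unfolding MM[symmetric] Sf_def
      by (rule dint_le_add) (use pert R0 in auto)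
    thus ?thesis using RT by (meson add_left_mono order_trans)
  qed
  have i2: "Sf \<le> ennreal (V * M) + ennreal T"
  proof -
    have "Sf \<le> ennreal (V * M) + dint Z X V R" unfolding MM[symmetric] Sf_def
      by (rule dint_le_add) (use pert R0 in auto)
    thus ?thesis using RT by (meson add_left_mono order_trans)
  qed
  have cmp: "Sf \<le> SP + ennreal (2 * \<eta> * \<delta> * X)" "SP \<le> Sf + ennreal (2 * \<eta> * \<delta> * X)"
    unfolding Sf_def SP_def by (rule dint_sheared_comparison[OF Z \<delta> V \<eta> E]; assumption)+
  have const: "dint Z X V (\<lambda>x v. V * ln X) \<le> ennreal U"
  proof -
    have "dint Z X V (\<lambda>x v. V * ln X) = ennreal V * (\<integral>\<^sup>+x. ennreal (V * ln X) * indicator {Z..X} x \<partial>lborel)"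
      using V by (intro dint_fst) auto
    also have "\<dots> = ennreal V * (ennreal (V * ln X) * ennreal (X - Z))" using Z by (simp add: nn_integral_cmult_indicator)
    also have "\<dots> = ennreal (V * (V * ln X * (X - Z)))" using V lnX Z by (simp add: ennreal_mult)
    also have "\<dots> \<le> ennreal U"
    proof (rule ennreal_leI)
      have "V * (V * ln X) * (X - Z) \<le> V * (V * ln X) * X" using V lnX Z by (intro mult_left_mono mult_nonneg_nonneg) auto
      thus "V * (V * ln X * (X - Z)) \<le> U" by (simp add: U_def power2_eq_square mult_ac)
    qed
    finally show ?thesis .
  qed
  have vx: "v \<le> \<delta> * x" if "x \<in> {Z..X}" "v \<in> {0..V}" for x v
  proof -
    have "\<delta> * Z \<le> \<delta> * x" "\<delta> * Z > 0" using that \<delta> Z by auto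
    thus ?thesis using that V by auto
  qed
  have j1: "SP \<le> ennreal (V * N) + ennreal U"
  proof -
    have "SP \<le> ennreal (V * N) + dint Z X V (\<lambda>x v. V * ln X)" unfolding NN[symmetric] SP_def
    proof (rule dint_le_add)
      fix x v assume xv: "x \<in> {Z..X}" "v \<in> {0..V}"
      show "(\<delta> * x - v) * main_density (x + v) \<le> \<delta> * x * main_density x + V * ln X"
        using xv Z \<delta> vx[OF xv] by (intro main_density_shift(1)) auto
      show "\<delta> * x * main_density x \<ge> 0" using xv Z \<delta> by (intro mult_nonneg_nonneg main_density_bounds) auto
      show "V * ln X \<ge> 0" using V lnX by simp
    qed auto
    thus ?thesis using const by (meson add_left_mono order_trans)
  qed
  have j2: "ennreal (V * N) \<le> SP + ennreal U"
  proof -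
    have "ennreal (V * N) \<le> SP + dint Z X V (\<lambda>x v. V * ln X)" unfolding NN[symmetric] SP_def
    proof (rule dint_le_add)
      fix x v assume xv: "x \<in> {Z..X}" "v \<in> {0..V}"
      show "\<delta> * x * main_density x \<le> (\<delta> * x - v) * main_density (x + v) + V * ln X"
        using xv Z \<delta> vx[OF xv] by (intro main_density_shift(2)) auto
      show "(\<delta> * x - v) * main_density (x + v) \<ge> 0" using xv Z \<delta> vx[OF xv] by (intro mult_nonneg_nonneg main_density_bounds) auto
      show "V * ln X \<ge> 0" using V lnX by simp
    qed auto
    thus ?thesis using const by (meson add_left_mono order_trans)
  qed
  define h where "h = 2 * \<eta> * \<delta> * X"
  have h0: "h \<ge> 0" using \<eta> \<delta> Z by (simp add: h_def)
  have VM: "V * M \<ge> 0" and VN: "V * N \<ge> 0" using V M0 N0 by auto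
  have "ennreal (V * M) \<le> ennreal (V * N) + ennreal U + ennreal h + ennreal T"
    using i1 cmp(1) j1 unfolding h_def by (meson add_right_mono order_trans)
  hence "ennreal (V * M) \<le> ennreal (V * N + U + h + T)" using VN U0 h0 T0 by simp
  hence "V * M \<le> V * N + U + h + T" using VN U0 h0 T0 by (subst (asm) ennreal_le_iff) auto
  moreover have "ennreal (V * N) \<le> ennreal (V * M) + ennreal T + ennreal h + ennreal U"
    using i2 cmp(2) j2 unfolding h_def by (meson add_right_mono order_trans)
  hence "ennreal (V * N) \<le> ennreal (V * M + T + h + U)" using VM U0 h0 T0 by simp
  hence "V * N \<le> V * M + T + h + U" using VM U0 h0 T0 by (subst (asm) ennreal_le_iff) auto
  ultimately show ?thesis unfolding T_def U_def h_def by (simp add: abs_le_iff mult.assoc)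
qed

section \<open>Collecting the errors\<close>

text \<open>Replaces the weight by its smallest value on the range. It serves both for the range
  below the splitting point and for the contribution \<open>\<theta> * M\<close> of the cross
  term.\<close>

lemma VF_upper:
  assumes K: "K \<ge> 0" "\<And>\<kappa> Y. 0 < \<kappa> \<Longrightarrow> \<kappa> \<le> 1 \<Longrightarrow> Y \<ge> 1 \<Longrightarrow>
     (\<integral>\<^sup>+x. ennreal ((norm (gF Lam m (x + \<kappa> * x) - gF Lam m x))\<^sup>2 * x powr (- 2 - 2 * e)) * indicator {1..Y} x \<partial>lborel)
       \<le> ennreal (K * \<kappa> powr (1 - e))"
    and e: "0 < e" and Y: "1 \<le> Y" and \<delta>: "0 < \<delta>" "\<delta> \<le> 1"
  shows "VF Lam m Y \<delta> \<le> Y powr (2 + 2 * e) * (K * \<delta> powr (1 - e))"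
proof -
  have "ennreal (VF Lam m Y \<delta>) = (\<integral>\<^sup>+x. ennreal (incr2 Lam m x (\<delta> * x)) * indicator {1..Y} x \<partial>lborel)"
    unfolding VF_eq using \<delta> by (intro nn_integral_incr2_mult(2)[symmetric]) auto
  also have "\<dots> \<le> (\<integral>\<^sup>+x. ennreal (Y powr (2 + 2 * e)) * (ennreal ((norm (gF Lam m (x + \<delta> * x) - gF Lam m x))\<^sup>2 * x powr (- 2 - 2 * e)) * indicator {1..Y} x) \<partial>lborel)"
  proof (rule nn_integral_mono)
    fix x :: real
    show "ennreal (incr2 Lam m x (\<delta> * x)) * indicator {1..Y} x \<le>
      ennreal (Y powr (2 + 2 * e)) * (ennreal ((norm (gF Lam m (x + \<delta> * x) - gF Lam m x))\<^sup>2 * x powr (- 2 - 2 * e)) * indicator {1..Y} x)"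
    proof (cases "x \<in> {1..Y}")
      case True
      have "incr2 Lam m x (\<delta> * x) = x powr (2 + 2 * e) * (incr2 Lam m x (\<delta> * x) * x powr (- 2 - 2 * e))"
      proof -
        have "x powr (2 + 2 * e) * x powr (- 2 - 2 * e) = 1" using True by (simp flip: powr_add)
        thus ?thesis by (metis mult.left_commute mult.right_neutral)
      qed
      also have "\<dots> \<le> Y powr (2 + 2 * e) * (incr2 Lam m x (\<delta> * x) * x powr (- 2 - 2 * e))"
        using True e by (intro mult_right_mono powr_mono2) auto
      finally show ?thesis using True by (simp add: incr2_def ennreal_mult'[symmetric] ennreal_leI)
    qed auto
  qed
  also have "\<dots> = ennreal (Y powr (2 + 2 * e)) * (\<integral>\<^sup>+x. ennreal ((norm (gF Lam m (x + \<delta> * x) - gF Lam m x))\<^sup>2 * x powr (- 2 - 2 * e)) * indicator {1..Y} x \<partial>lborel)"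
    by (rule nn_integral_cmult) measurable
  also have "\<dots> \<le> ennreal (Y powr (2 + 2 * e)) * ennreal (K * \<delta> powr (1 - e))" using \<delta> Y by (intro mult_left_mono K) auto
  also have "\<dots> = ennreal (Y powr (2 + 2 * e) * (K * \<delta> powr (1 - e)))" using K by (simp add: ennreal_mult)
  finally show ?thesis using K by (subst (asm) ennreal_le_iff) auto
qed


text \<open>Up to a small power of \<open>X\<close>, \<open>B / V\<close> is \<open>\<eta>\<close>
  times the size of the variance, so the errors \<open>\<theta> * M\<close> and
  \<open>(1 / \<theta> + 1) * B / V\<close> balance at \<open>\<theta> = sqrt \<eta>\<close>. Every
  error is then compared with the single quantity \<open>D\<close>, and the coefficients of
  \<open>D\<close> add up to the constant in the conclusion.\<close>

lemma VF_estimate: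
  assumes K: "K \<ge> 0" "\<And>\<kappa> Y. 0 < \<kappa> \<Longrightarrow> \<kappa> \<le> 1 \<Longrightarrow> Y \<ge> 1 \<Longrightarrow>
     (\<integral>\<^sup>+x. ennreal ((norm (gF Lam m (x + \<kappa> * x) - gF Lam m x))\<^sup>2 * x powr (- 2 - 2 * e)) * indicator {1..Y} x \<partial>lborel)
       \<le> ennreal (K * \<kappa> powr (1 - e))"
    and e: "0 < e" "e \<le> 1" and \<delta>: "0 < \<delta>" "\<delta> \<le> 1" "1 \<le> \<delta> * X" and X: "ln X \<le> X powr e"
    and c: "0 < c" "c \<le> 2" and \<eta>: "X powr (- 2 * c / 3) \<le> \<eta>" "\<eta> \<le> 1/4"
    and Y: "8 \<le> Y" "Y \<le> X" "(Y / X) powr (4/3) \<le> \<eta>"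
    and C: "C \<ge> 0" "\<And>u w. Y \<le> u \<Longrightarrow> u \<le> 2 * X \<Longrightarrow> \<delta> * u / 4 \<le> w \<Longrightarrow> w \<le> \<delta> * u \<Longrightarrow>
        \<bar>VtF Lam m u w - w * main_fixed u\<bar> \<le> C * (w * u powr (1 - c))"
  shows "\<bar>VF Lam m X \<delta> - \<delta> * main_mult X\<bar> \<le> (17 * K + 2 * K / e + 8 * C + 17) * (sqrt \<eta> * \<delta> powr (1 - e) * X powr (2 + 7 * e))"
proof -
  have X8: "X \<ge> 8" using Y by simp
  hence X0: "X > 0" "X \<ge> 1" by auto
  have \<eta>0: "\<eta> > 0" using \<eta>(1) X0 by (intro order_less_le_trans[OF _ \<eta>(1)]) simp
  define \<rho> where "\<rho> = sqrt \<eta>"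
  have \<rho>: "\<rho> > 0" "\<rho> \<le> 1" "\<rho> * \<rho> = \<eta>" using \<eta>0 \<eta>(2) by (auto simp: \<rho>_def)
  have \<eta>\<rho>: "\<eta> \<le> \<rho>" using mult_left_mono[OF \<rho>(2), of \<rho>] \<rho> by simp
  \<comment> \<open>Raising the splitting point to \<open>4 * \<eta> * X\<close> guarantees
    \<open>V \<le> \<delta> * Z / 2\<close>. The range below it has relative weight
    \<open>(Z / X)^2\<close>, which is still at most \<open>16 * sqrt \<eta>\<close>.\<close>
  define Z where "Z = max Y (4 * \<eta> * X)"
  define V where "V = \<eta> * \<delta> * X"
  have "4 * \<eta> * X \<le> 1 * X" using \<eta> X0 by (intro mult_right_mono) auto
  hence Z: "8 \<le> Z" "Z \<le> X" "Y \<le> Z" "4 * \<eta> * X \<le> Z" using Y by (auto simp: Z_def)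
  have V0: "V > 0" using \<eta>0 \<delta> X0 by (simp add: V_def)
  have "\<delta> * (4 * \<eta> * X) \<le> \<delta> * Z" using Z \<delta> by (intro mult_left_mono) auto
  hence VZ: "V \<le> \<delta> * Z / 2" using V0 by (simp add: V_def mult_ac)
  have "\<delta> * Z \<le> 1 * Z" using \<delta> Z by (intro mult_right_mono) auto
  hence VZ': "V \<le> Z" using VZ Z by linarith
  \<comment> \<open>\<open>7 * e\<close> is made up of \<open>4 * e\<close> from the short shift
    bound and \<open>3 * e\<close> from estimating \<open>V powr (- 2 * e)\<close>.\<close>
  define D where "D = \<rho> * \<delta> powr (1 - e) * X powr (2 + 7 * e)"
  have \<delta>e: "\<delta> \<le> \<delta> powr (1 - e)" using powr_mono'[of "1 - e" 1 \<delta>] \<delta> e by simp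
  have unit: "\<rho> * \<delta> * X powr (2 + a) \<le> D" if "a \<le> 7 * e" for a
    unfolding D_def using \<rho> \<delta> \<delta>e X0 that by (intro mult_mono powr_mono mult_nonneg_nonneg) auto
  have unit': "\<rho> * \<delta> powr (1 - e) * X powr (2 + a) \<le> D" if "a \<le> 7 * e" for a
    unfolding D_def using \<rho> \<delta> X0 that by (intro mult_left_mono powr_mono mult_nonneg_nonneg) auto
  have Z2: "Z\<^sup>2 \<le> 16 * \<rho> * X\<^sup>2"
  proof (cases "Y \<ge> 4 * \<eta> * X")
    case True
    define y where "y = Y / X"
    have y: "0 < y" "y \<le> 1" using Y X0 by (auto simp: y_def)
    have "y\<^sup>2 = y powr 2" using y by (simp add: powr_numeral)
    also have "\<dots> \<le> y powr (2/3)" using y by (intro powr_mono') auto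
    also have "\<dots> = (y powr (4/3)) powr (1/2)" by (simp add: powr_powr)
    also have "\<dots> \<le> \<eta> powr (1/2)" using Y(3) by (intro powr_mono2) (auto simp: y_def)
    also have "\<dots> = \<rho>" using \<eta>0 by (simp add: \<rho>_def powr_half_sqrt)
    finally have "y\<^sup>2 * X\<^sup>2 \<le> \<rho> * X\<^sup>2" by (intro mult_right_mono) auto
    moreover have "Z\<^sup>2 = y\<^sup>2 * X\<^sup>2" using True X0 by (simp add: Z_def y_def power_divide)
    moreover have "\<rho> * X\<^sup>2 \<ge> 0" using \<rho> by simp
    ultimately show ?thesis by linarith
  next
    case False
    hence "Z\<^sup>2 = 16 * (\<eta> * \<eta>) * X\<^sup>2" by (simp add: Z_def power2_eq_square)
    also have "\<dots> \<le> 16 * (\<rho> * 1) * X\<^sup>2" using \<eta>\<rho> \<eta> \<eta>0 by (intro mult_mono) auto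
    finally show ?thesis by simp
  qed
  define L where "L = integral {1..Z} (\<lambda>x. incr2 Lam m x (\<delta> * x))"
  define M where "M = integral {Z..X} (\<lambda>x. incr2 Lam m x (\<delta> * x))"
  have split: "VF Lam m X \<delta> = L + M" unfolding VF_eq L_def M_def
    by (rule Henstock_Kurzweil_Integration.integral_combine[symmetric]) (use Z \<delta> in \<open>auto intro!: nn_integral_incr2_mult\<close>)
  have L0: "L \<ge> 0" unfolding L_def using \<delta> by (intro integral_nonneg nn_integral_incr2_mult) auto
  have Lb: "L \<le> 16 * K * D"
  proof -
    have "L \<le> Z powr (2 + 2 * e) * (K * \<delta> powr (1 - e))"
      using VF_upper[OF K e(1) _ \<delta>(1,2), of Z] Z unfolding VF_eq L_def by simp
    also have "Z powr (2 + 2 * e) = Z\<^sup>2 * Z powr (2 * e)" using Z by (simp add: powr_add powr_numeral)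
    also have "\<dots> * (K * \<delta> powr (1 - e)) \<le> (16 * \<rho> * X\<^sup>2) * X powr (2 * e) * (K * \<delta> powr (1 - e))"
      using Z2 Z e K \<rho> by (intro mult_right_mono mult_mono powr_mono2) auto
    also have "\<dots> = 16 * K * (\<rho> * \<delta> powr (1 - e) * X powr (2 + 2 * e))" using X0 by (simp add: powr_add powr_numeral)
    also have "\<dots> \<le> 16 * K * D" using K e by (intro mult_left_mono unit') auto
    finally show ?thesis .
  qed
  have Mb: "\<rho> * M \<le> K * D"
  proof -
    have "\<rho> * M \<le> \<rho> * (X powr (2 + 2 * e) * (K * \<delta> powr (1 - e)))"
      using VF_upper[OF K e(1) _ \<delta>(1,2), of X] X0 L0 split \<rho> by (intro mult_left_mono) auto
    also have "\<dots> = K * (\<rho> * \<delta> powr (1 - e) * X powr (2 + 2 * e))" by (simp add: mult_ac)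
    also have "\<dots> \<le> K * D" using K e by (intro mult_left_mono unit') auto
    finally show ?thesis .
  qed
  define B where "B = K / e * X powr (1 + 4 * e) * V powr (2 - 2 * e)"
  have B0: "B \<ge> 0" using K e by (simp add: B_def)
  have Bd: "dint Z X V (incr2 Lam m) \<le> ennreal B" unfolding B_def dint_def
    using K e Z V0 VZ' by (intro short_shift_mean_square) auto
  have Bb: "(1 / \<rho> + 1) * B / V \<le> 2 * K / e * D"
  proof -
    \<comment> \<open>Here \<open>c \<le> 2\<close> and \<open>\<delta> * X \<ge> 1\<close> enter:
      they keep \<open>V\<close> above \<open>X powr (-4/3)\<close>, so its negative power costs at
      most \<open>X powr (3 * e)\<close>.\<close>
    have "X powr (- (4/3)) \<le> X powr (- 2 * c / 3)" using c X0 by (intro powr_mono) auto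
    hence "X powr (- (4/3)) * 1 \<le> \<eta> * (\<delta> * X)" using \<eta>(1) \<delta>(3) \<eta>0 by (intro mult_mono) auto
    hence VX: "X powr (- (4/3)) \<le> V" by (simp add: V_def mult.assoc)
    have "V powr (- 2 * e) \<le> (X powr (- (4/3))) powr (- 2 * e)" using VX X0 e by (intro powr_mono2') auto
    also have "\<dots> = X powr (8/3 * e)" by (simp add: powr_powr)
    also have "\<dots> \<le> X powr (3 * e)" using X0 e by (intro powr_mono) auto
    finally have Ve: "V powr (- 2 * e) \<le> X powr (3 * e)" .
    have Vs: "V powr (2 - 2 * e) = V * V * V powr (- 2 * e)"
    proof -
      have "V powr (2 - 2 * e) = V powr (1 + 1 + (- 2 * e))" by simp
      thus ?thesis using V0 by (simp only: powr_add powr_one)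
    qed
    have "B / V = K / e * X powr (1 + 4 * e) * (V * V powr (- 2 * e))" using V0 by (simp add: B_def Vs)
    also have "\<dots> \<le> K / e * X powr (1 + 4 * e) * (V * X powr (3 * e))"
      using K e V0 Ve by (intro mult_left_mono mult_nonneg_nonneg divide_nonneg_nonneg) auto
    also have "\<dots> = K / e * \<eta> * \<delta> * (X powr (1 + 4 * e) * X powr 1 * X powr (3 * e))" using X0 by (simp add: V_def mult_ac)
    also have "X powr (1 + 4 * e) * X powr 1 * X powr (3 * e) = X powr (2 + 7 * e)"
      by (simp only: powr_add[symmetric]) (simp add: algebra_simps)
    finally have BV: "B / V \<le> K / e * \<eta> * \<delta> * X powr (2 + 7 * e)" .
    have "(1 / \<rho> + 1) * (B / V) \<le> (2 / \<rho>) * (K / e * \<eta> * \<delta> * X powr (2 + 7 * e))"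
      using BV \<rho> B0 V0 by (intro mult_mono) (auto simp: field_simps)
    also have "\<dots> = 2 * K / e * (\<rho> * \<delta> * X powr (2 + 7 * e))"
      unfolding \<rho>(3)[symmetric] using \<rho>(1) by (simp add: field_simps)
    also have "\<dots> \<le> 2 * K / e * D" using K e by (intro mult_left_mono unit) auto
    finally show ?thesis by simp
  qed
  define E where "E = 4 * C * \<delta> * X powr (2 - c)"
  have E0: "E \<ge> 0" using C \<delta> by (simp add: E_def)
  have EE: "\<bar>VtF Lam m u w - w * main_fixed u\<bar> \<le> E" if u: "Z \<le> u" "u \<le> 2 * X" "\<delta> * u / 4 \<le> w" "w \<le> \<delta> * u" for u w
  proof -
    have u0: "u > 0" using u Z by auto
    have "\<bar>VtF Lam m u w - w * main_fixed u\<bar> \<le> C * (w * u powr (1 - c))" using u Z by (intro C) auto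
    also have "\<dots> \<le> C * ((\<delta> * u) * u powr (1 - c))" using u C by (intro mult_left_mono mult_right_mono) auto
    also have "\<dots> = C * \<delta> * u powr (2 - c)"
    proof -
      have "u powr (2 - c) = u powr (1 + (1 - c))" by simp
      thus ?thesis using u0 by (simp only: powr_add powr_one mult_ac)
    qed
    also have "\<dots> \<le> C * \<delta> * (2 * X) powr (2 - c)" using u u0 c C \<delta> by (intro mult_left_mono powr_mono2) auto
    also have "(2 * X) powr (2 - c) = 2 powr (2 - c) * X powr (2 - c)" using X0 by (simp add: powr_mult)
    also have "C * \<delta> * (2 powr (2 - c) * X powr (2 - c)) \<le> C * \<delta> * (4 * X powr (2 - c))"
    proof -
      have "(2::real) powr (2 - c) \<le> 2 powr 2" using c by (intro powr_mono) auto
      thus ?thesis using C \<delta> by (intro mult_left_mono mult_right_mono) auto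
    qed
    finally show ?thesis by (simp add: E_def mult_ac)
  qed
  have Eb: "2 * E * \<delta> * X / V \<le> 8 * C * D"
  proof -
    \<comment> \<open>The lower bound for \<open>\<eta>\<close> in the form
      \<open>X powr (-c) \<le> \<eta> powr (3/2)\<close>: the relative error of the hypothesis,
      divided by the width \<open>\<eta>\<close>, is at most \<open>sqrt \<eta>\<close>.\<close>
    have "X powr (-c) = (X powr (- 2 * c / 3)) powr (3/2)" by (simp add: powr_powr)
    also have "\<dots> \<le> \<eta> powr (3/2)" using \<eta>(1) by (intro powr_mono2) auto
    also have "\<dots> = \<eta> powr (1 + 1/2)" by simp
    also have "\<dots> = \<eta> * \<rho>" using \<eta>0 by (simp only: powr_add powr_one) (simp add: \<rho>_def powr_half_sqrt)
    finally have "X powr (-c) / \<eta> \<le> \<rho>" using \<eta>0 by (simp add: pos_divide_le_eq mult_ac)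
    have "2 * E * \<delta> * X / V = 8 * C * (\<delta> * (X powr (2 - c) / \<eta>))"
      using \<eta>0 \<delta> X0 by (simp add: E_def V_def field_simps)
    also have "X powr (2 - c) = X powr 2 * X powr (-c)" by (simp flip: powr_add)
    also have "8 * C * (\<delta> * (X powr 2 * X powr (-c) / \<eta>)) = 8 * C * (\<delta> * X powr 2 * (X powr (-c) / \<eta>))" by simp
    also have "\<dots> \<le> 8 * C * (\<delta> * X powr 2 * \<rho>)" using \<open>X powr (-c) / \<eta> \<le> \<rho>\<close> C \<delta> by (intro mult_left_mono) auto
    also have "\<delta> * X powr 2 * \<rho> = \<rho> * \<delta> * X powr (2 + 0)" by simp
    also have "8 * C * (\<rho> * \<delta> * X powr (2 + 0)) \<le> 8 * C * D" using C e by (intro mult_left_mono unit) auto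
    finally show ?thesis .
  qed
  have ln: "0 \<le> ln X" using X0 by simp
  have XX: "\<rho> * \<delta> * X\<^sup>2 * ln X \<le> D"
  proof -
    have "\<rho> * \<delta> * X\<^sup>2 * ln X \<le> \<rho> * \<delta> * X\<^sup>2 * X powr e" using X \<rho> \<delta> by (intro mult_left_mono) auto
    also have "\<dots> = \<rho> * \<delta> * X powr (2 + e)" using X0 by (simp add: powr_add powr_numeral)
    also have "\<dots> \<le> D" using e by (intro unit) auto
    finally show ?thesis .
  qed
  have Ub: "X * V\<^sup>2 * ln X / V \<le> D"
  proof -
    have "X * V\<^sup>2 * ln X / V = \<eta> * \<delta> * X\<^sup>2 * ln X" using V0 by (simp add: power2_eq_square V_def)
    also have "\<dots> \<le> \<rho> * \<delta> * X\<^sup>2 * ln X" using \<eta>\<rho> \<delta> ln by (intro mult_right_mono) auto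
    finally show ?thesis using XX by simp
  qed
  have Fb: "\<bar>\<delta> * main_mult Z\<bar> \<le> 16 * D"
  proof -
    have ln8: "ln 8 = 3 * ln (2::real)" using ln_realpow[of "2::real" 3] by simp
    moreover have "ln 8 \<le> ln Z" "ln Z \<le> ln X" using Z by auto
    moreover have "ln (2::real) > 0" by simp
    ultimately have "0 \<le> 1/2 * ln Z - 2/3 * ln 2" "1/2 * ln Z - 2/3 * ln 2 \<le> ln X" by linarith+
    hence "\<bar>1/2 * ln Z - 2/3 * ln 2\<bar> \<le> ln X" by simp
    hence "\<delta> * (Z\<^sup>2 * \<bar>1/2 * ln Z - 2/3 * ln 2\<bar>) \<le> \<delta> * ((16 * \<rho> * X\<^sup>2) * ln X)"
      using Z2 \<delta> \<rho> by (intro mult_left_mono mult_mono) auto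
    also have "\<dots> = 16 * (\<rho> * \<delta> * X\<^sup>2 * ln X)" by simp
    also have "\<dots> \<le> 16 * D" using XX by simp
    finally show ?thesis using \<delta> by (simp add: main_mult_def abs_mult)
  qed
  have "\<bar>V * M - V * (\<delta> * (main_mult X - main_mult Z))\<bar> \<le> \<rho> * V * M + (1 / \<rho> + 1) * B + 2 * E * \<delta> * X + X * V\<^sup>2 * ln X"
    unfolding M_def by (rule averaged_comparison[OF Z(1,2) \<delta>(1,2) V0 VZ E0 \<rho>(1) EE B0 Bd])
  moreover have "V * M - V * (\<delta> * (main_mult X - main_mult Z)) = (M - \<delta> * (main_mult X - main_mult Z)) * V"
    by (simp add: algebra_simps)
  ultimately have "\<bar>M - \<delta> * (main_mult X - main_mult Z)\<bar> * V \<le> \<rho> * V * M + (1 / \<rho> + 1) * B + 2 * E * \<delta> * X + X * V\<^sup>2 * ln X"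
    using V0 by (simp add: abs_mult)
  hence "\<bar>M - \<delta> * (main_mult X - main_mult Z)\<bar> \<le> (\<rho> * V * M + (1 / \<rho> + 1) * B + 2 * E * \<delta> * X + X * V\<^sup>2 * ln X) / V"
    using V0 by (simp add: pos_le_divide_eq)
  also have "\<dots> = \<rho> * M + (1 / \<rho> + 1) * B / V + 2 * E * \<delta> * X / V + X * V\<^sup>2 * ln X / V"
    using V0 by (simp add: add_divide_distrib)
  also have "\<dots> \<le> K * D + 2 * K / e * D + 8 * C * D + D" using Mb Bb Eb Ub by linarith
  finally have "\<bar>M - \<delta> * (main_mult X - main_mult Z)\<bar> \<le> K * D + 2 * K / e * D + 8 * C * D + D" .
  moreover have "VF Lam m X \<delta> - \<delta> * main_mult X = (M - \<delta> * (main_mult X - main_mult Z)) + L - \<delta> * main_mult Z"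
    by (simp add: split algebra_simps)
  ultimately have "\<bar>VF Lam m X \<delta> - \<delta> * main_mult X\<bar> \<le> (K * D + 2 * K / e * D + 8 * C * D + D) + 16 * K * D + 16 * D"
    using Lb L0 Fb by linarith
  also have "\<dots> = (17 * K + 2 * K / e + 8 * C + 17) * D" by (simp add: algebra_simps)
  finally show ?thesis unfolding D_def \<rho>_def .
qed

section \<open>Choice of the parameters, uniformly in the range of \<open>\<delta>\<close>\<close>

theorem theoremD2:
  fixes a Lam :: "nat \<Rightarrow> complex" and m :: nat and G :: "complex \<Rightarrow> complex"
    and Q :: real and r :: nat and lam :: "nat \<Rightarrow> real" and mu :: "nat \<Rightarrow> complex"
    and eps :: complex and B1 B2 B3 c :: real
  assumes prim: "selberg_primitive a"
    and data: "selberg_data a m G Q r lam mu eps"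
    and Lam: "\<forall>s. Re s > 1 \<longrightarrow>
               (\<lambda>n. Lam n / of_nat n powr s) sums (- deriv (dser a) s / dser a s)"
    and grh: "GRH G r lam mu"
    and B: "1 / (2 * (\<Sum>j<r. lam j)) < B1" "B1 \<le> B2" "B2 < B3" "B3 < 1"
    and c: "c > 0"
    and hyp: "unif_O
       (\<lambda>X h. VtF Lam m X h - 1/6 * h * X * (6 * ln X - (3 + 8 * ln 2)))
       (\<lambda>X h. h * X powr (1 - c))
       (\<lambda>X. X powr (1 - B3)) (\<lambda>X. X powr (1 - B1))"
  shows "\<forall>\<epsilon>>0. unif_O
       (\<lambda>X \<delta>. VF Lam m X \<delta> - 1/6 * \<delta> * X\<^sup>2 * (3 * ln X - 4 * ln 2))
       (\<lambda>X \<delta>. \<delta> powr (1 - \<epsilon>) * X powr (2 - c / 3)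
              + \<delta> powr (1 - \<epsilon>) * X\<^sup>2 * (\<delta> * X powr B3) powr (- 2 / (3 * B3)))
       (\<lambda>X. X powr (- B2)) (\<lambda>X. X powr (- B1))"
proof (intro allI impI)
  fix \<epsilon> :: real assume \<epsilon>: "\<epsilon> > 0"
  have lam: "\<And>j. j < r \<Longrightarrow> lam j > 0" using data unfolding selberg_data_def by blast
  have "0 \<le> 1 / (2 * (\<Sum>j<r. lam j))" using lam by (intro divide_nonneg_nonneg mult_nonneg_nonneg sum_nonneg) (auto intro: less_imp_le)
  hence B1: "B1 > 0" using B by linarith
  hence B23: "B2 > 0" "B3 > 0" using B by auto
  \<comment> \<open>The factor \<open>X powr (7 * e)\<close> is at most a constant times
    \<open>\<delta> powr (- 7 * e / B1)\<close>, because
    \<open>\<delta> \<le> k2 * X powr (-B1)\<close>. Together with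
    \<open>\<delta> powr (1 - e)\<close> this asks for
    \<open>e * (1 + 7 / B1) \<le> \<epsilon>\<close>.\<close>
  define e where "e = min 1 (\<epsilon> / (1 + 7 / B1))"
  have p1: "1 + 7 / B1 > 0" using B1 by (intro add_pos_pos) auto
  have e: "0 < e" "e \<le> 1" using \<epsilon> p1 by (auto simp: e_def)
  have "e * (1 + 7 / B1) \<le> \<epsilon> / (1 + 7 / B1) * (1 + 7 / B1)" using p1 by (intro mult_right_mono) (auto simp: e_def)
  also have "\<dots> = \<epsilon>" using p1 by simp
  finally have e\<epsilon>: "e + 7 * e / B1 \<le> \<epsilon>" by (simp add: distrib_left mult_ac)
  obtain K where K: "K \<ge> 0" "\<And>\<kappa> Y. 0 < \<kappa> \<Longrightarrow> \<kappa> \<le> 1 \<Longrightarrow> Y \<ge> 1 \<Longrightarrow>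
     (\<integral>\<^sup>+x. ennreal ((norm (gF Lam m (x + \<kappa> * x) - gF Lam m x))\<^sup>2 * x powr (- 2 - 2 * e)) * indicator {1..Y} x \<partial>lborel)
       \<le> ennreal (K * \<kappa> powr (1 - e))"
    using selberg_mean_square[OF prim data Lam grh e] by blast
  \<comment> \<open>Cutting \<open>c\<close> at 2 is harmless: for \<open>c > 2\<close> the factor
    \<open>X powr (- c' / 3) = X powr (-2/3)\<close> is at most \<open>(Y / X) powr (2/3)\<close>,
    which is the second error term.\<close>
  define c' where "c' = min c 2"
  have c': "0 < c'" "c' \<le> 2" "c' \<le> c" using c by (auto simp: c'_def)
  show "unif_O
       (\<lambda>X \<delta>. VF Lam m X \<delta> - 1/6 * \<delta> * X\<^sup>2 * (3 * ln X - 4 * ln 2))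
       (\<lambda>X \<delta>. \<delta> powr (1 - \<epsilon>) * X powr (2 - c / 3)
              + \<delta> powr (1 - \<epsilon>) * X\<^sup>2 * (\<delta> * X powr B3) powr (- 2 / (3 * B3)))
       (\<lambda>X. X powr (- B2)) (\<lambda>X. X powr (- B1))"
    unfolding unif_O_def
  proof (intro allI impI)
    fix k1 k2 :: real assume k: "k1 > 0" "k2 > 0"
    \<comment> \<open>These constants fit the shifts
      \<open>\<delta> * u / 4 \<le> w \<le> \<delta> * u\<close> with
      \<open>Y \<le> u \<le> 2 * X\<close> that the slices produce: \<open>1/4\<close> for the lower
      end, and \<open>2 powr B1\<close> from \<open>X \<ge> u / 2\<close> for the upper end.\<close>
    have "k2 * 2 powr B1 > 0" "(1/4 :: real) > 0" using k by auto
    with hyp obtain C0 X1 where hyp': "\<And>u w. u \<ge> X1 \<Longrightarrow> 1/4 * u powr (1 - B3) \<le> w \<Longrightarrow> w \<le> k2 * 2 powr B1 * u powr (1 - B1) \<Longrightarrow>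
        \<bar>VtF Lam m u w - 1/6 * w * u * (6 * ln u - (3 + 8 * ln 2))\<bar> \<le> C0 * (w * u powr (1 - c))"
      unfolding unif_O_def by meson
    define C where "C = max C0 0"
    define Y1 where "Y1 = max X1 8"
    define A where "A = 17 * K + 2 * K / e + 8 * C + 17"
    have A: "A \<ge> 0" unfolding A_def C_def using K e by (intro add_nonneg_nonneg mult_nonneg_nonneg divide_nonneg_nonneg) auto
    \<comment> \<open>The five conditions secure, in turn: \<open>\<delta> \<le> 1\<close> and
      \<open>Y \<ge> Y1\<close>; \<open>\<delta> * X \<ge> 1\<close>; \<open>Y \<le> X / 8\<close>,
      where \<open>B2 < B3\<close> is used; the first half of \<open>\<eta> \<le> 1/4\<close>; and
      \<open>ln X \<le> X powr e\<close>.\<close>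
    have "((\<lambda>X. k2 * X powr (- B1)) \<longlongrightarrow> 0) at_top" using B1 by real_asymp
    hence ev1: "eventually (\<lambda>X. k2 * X powr (- B1) < min 1 (Y1 powr (- B3))) at_top"
      by (rule order_tendstoD) (simp add: Y1_def)
    have "filterlim (\<lambda>X. k1 * X powr (1 - B2)) at_top at_top" using k B by real_asymp
    hence ev2: "eventually (\<lambda>X. 1 \<le> k1 * X powr (1 - B2)) at_top" by (simp add: filterlim_at_top)
    have "filterlim (\<lambda>X. k1 * X powr (B3 - B2)) at_top at_top" using k B by real_asymp
    hence ev3: "eventually (\<lambda>X. 8 powr B3 \<le> k1 * X powr (B3 - B2)) at_top" by (simp add: filterlim_at_top)
    have "((\<lambda>X. X powr (- 2 * c' / 3)) \<longlongrightarrow> 0) at_top" using c' by real_asymp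
    hence ev4: "eventually (\<lambda>X. X powr (- 2 * c' / 3) < 1/4) at_top" by (rule order_tendstoD) simp
    have "((\<lambda>X. ln X / X powr e) \<longlongrightarrow> 0) at_top" using e by real_asymp
    hence ev5: "eventually (\<lambda>X. ln X / X powr e < 1) at_top" by (rule order_tendstoD) simp
    have "eventually (\<lambda>X. k2 * X powr (- B1) < min 1 (Y1 powr (- B3)) \<and> 1 \<le> k1 * X powr (1 - B2) \<and>
       8 powr B3 \<le> k1 * X powr (B3 - B2) \<and> X powr (- 2 * c' / 3) < 1/4 \<and> ln X / X powr e < 1 \<and> X \<ge> 8) at_top"
      using ev1 ev2 ev3 ev4 ev5 eventually_ge_at_top[of "8::real"] by eventually_elim simp
    then obtain X0 where X0: "\<And>X. X \<ge> X0 \<Longrightarrow> k2 * X powr (- B1) < min 1 (Y1 powr (- B3)) \<and> 1 \<le> k1 * X powr (1 - B2) \<and>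
       8 powr B3 \<le> k1 * X powr (B3 - B2) \<and> X powr (- 2 * c' / 3) < 1/4 \<and> ln X / X powr e < 1 \<and> X \<ge> 8"
      unfolding eventually_at_top_linorder by blast
    have main: "\<bar>VF Lam m X \<delta> - 1/6 * \<delta> * X\<^sup>2 * (3 * ln X - 4 * ln 2)\<bar> \<le> 2 * A * k2 powr (7 * e / B1) *
       (\<delta> powr (1 - \<epsilon>) * X powr (2 - c / 3) + \<delta> powr (1 - \<epsilon>) * X\<^sup>2 * (\<delta> * X powr B3) powr (- 2 / (3 * B3)))"
      if X: "X \<ge> X0" and \<delta>: "k1 * X powr (- B2) \<le> \<delta>" "\<delta> \<le> k2 * X powr (- B1)" for X \<delta>
    proof -
      note XX = X0[OF X]
      have Xpos: "X > 0" "X \<ge> 1" "X \<ge> 8" using XX by auto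
      have "k1 * X powr (- B2) > 0" using k Xpos by simp
      hence \<delta>0: "\<delta> > 0" using \<delta> by linarith
      have \<delta>1: "\<delta> \<le> 1" "\<delta> \<le> Y1 powr (- B3)" using \<delta> XX by auto
      have \<delta>X: "1 \<le> \<delta> * X"
      proof -
        have "k1 * X powr (1 - B2) = (k1 * X powr (- B2)) * X" using Xpos by (simp add: powr_diff powr_minus field_simps)
        also have "\<dots> \<le> \<delta> * X" using \<delta> Xpos by (intro mult_right_mono) auto
        finally show ?thesis using XX by linarith
      qed
      have eqX: "\<delta> * main_mult X = 1/6 * \<delta> * X\<^sup>2 * (3 * ln X - 4 * ln 2)" by (simp add: main_mult_def algebra_simps)
      \<comment> \<open>The least \<open>u\<close> with
        \<open>\<delta> * u \<ge> u powr (1 - B3)\<close>: from \<open>Y\<close> on, shifts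
        comparable to \<open>\<delta> * u\<close> are admissible in the hypothesis. The smallness of
        \<open>\<delta>\<close> also puts \<open>Y\<close> beyond the threshold \<open>X1\<close> of
        the hypothesis.\<close>
      define Y where "Y = \<delta> powr (- 1 / B3)"
      have YB: "Y powr (- B3) = \<delta>" using \<delta>0 B23 by (simp add: Y_def powr_powr)
      have YY1: "Y1 \<le> Y"
      proof -
        have "Y1 = (Y1 powr (- B3)) powr (- 1 / B3)" using B23 by (simp add: powr_powr Y1_def)
        also have "\<dots> \<le> Y" unfolding Y_def using \<delta>0 \<delta>1 B23 by (intro powr_mono2') auto
        finally show ?thesis .
      qed
      hence Y8: "Y \<ge> 8" "Y \<ge> X1" by (auto simp: Y1_def)
      have YX: "Y \<le> X / 8"
      proof -
        have "(X / 8) powr (- B3) = 8 powr B3 * X powr (- B3)"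
          using Xpos by (simp add: powr_divide powr_minus field_simps)
        also have "\<dots> \<le> (k1 * X powr (B3 - B2)) * X powr (- B3)" using XX by (intro mult_right_mono) auto
        also have "\<dots> = k1 * X powr (- B2)" by (simp flip: powr_add)
        also have "\<dots> \<le> \<delta>" by (rule \<delta>)
        finally have "(X / 8) powr (- B3) \<le> \<delta>" .
        hence "\<delta> powr (- 1 / B3) \<le> ((X / 8) powr (- B3)) powr (- 1 / B3)" using B23 Xpos by (intro powr_mono2') auto
        also have "\<dots> = X / 8" using B23 Xpos by (simp add: powr_powr)
        finally show ?thesis unfolding Y_def .
      qed
      define y where "y = Y / X"
      have y: "0 < y" "y \<le> 1/8" "1 / X \<le> y" using YX Y8 Xpos by (auto simp: y_def field_simps)
      \<comment> \<open>The exponent \<open>4/3\<close> makes \<open>sqrt (y powr (4/3))\<close>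
        equal to \<open>y powr (2/3)\<close>, which is the factor
        \<open>(\<delta> * X powr B3) powr (- 2 / (3 * B3))\<close> of the claim.\<close>
      define \<eta> where "\<eta> = max (X powr (- 2 * c' / 3)) (y powr (4/3))"
      have "y powr (4/3) \<le> y powr 1" using y by (intro powr_mono') auto
      hence "y powr (4/3) \<le> 1/8" using y by simp
      hence \<eta>4: "\<eta> \<le> 1/4" using XX by (auto simp: \<eta>_def)
      have lnX: "ln X \<le> X powr e" using XX Xpos by (simp add: pos_divide_less_eq)
      have hypE: "\<bar>VtF Lam m u w - w * main_fixed u\<bar> \<le> C * (w * u powr (1 - c'))"
        if u: "Y \<le> u" "u \<le> 2 * X" "\<delta> * u / 4 \<le> w" "w \<le> \<delta> * u" for u w
      proof -
        have u0: "u \<ge> 1" "u > 0" "u \<ge> X1" using u Y8 by auto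
        have "\<delta> * u > 0" using \<delta>0 u0 by simp
        hence w0: "w > 0" using u by linarith
        have "u powr (- B3) \<le> \<delta>" unfolding YB[symmetric] using u Y8 B23 by (intro powr_mono2') auto
        hence "u powr (- B3) * u \<le> \<delta> * u" using u0 by (intro mult_right_mono) auto
        moreover have "u powr (1 - B3) = u powr (- B3) * u" using u0 by (simp add: powr_diff powr_minus field_simps)
        ultimately have lo: "1/4 * u powr (1 - B3) \<le> w" using u by linarith
        have "(u / 2) powr (- B1) \<ge> X powr (- B1)" using u u0 B1 by (intro powr_mono2') auto
        hence "k2 * X powr (- B1) * u \<le> k2 * (u / 2) powr (- B1) * u" using k u0 by (intro mult_left_mono mult_right_mono) auto
        also have "(u / 2) powr (- B1) = 2 powr B1 * u powr (- B1)" using u0 by (simp add: powr_divide powr_minus field_simps)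
        also have "k2 * (2 powr B1 * u powr (- B1)) * u = k2 * 2 powr B1 * u powr (1 - B1)"
          using u0 by (simp add: powr_diff powr_minus field_simps)
        finally have "k2 * X powr (- B1) * u \<le> k2 * 2 powr B1 * u powr (1 - B1)" .
        moreover have "\<delta> * u \<le> k2 * X powr (- B1) * u" using \<delta> u0 by (intro mult_right_mono) auto
        ultimately have hi: "w \<le> k2 * 2 powr B1 * u powr (1 - B1)" using u by linarith
        have eqw: "w * main_fixed u = 1/6 * w * u * (6 * ln u - (3 + 8 * ln 2))" by (simp add: main_fixed_def algebra_simps)
        have "\<bar>VtF Lam m u w - w * main_fixed u\<bar> \<le> C0 * (w * u powr (1 - c))" unfolding eqw by (rule hyp'[OF u0(3) lo hi])
        also have "\<dots> \<le> C * (w * u powr (1 - c))" using w0 by (intro mult_right_mono) (auto simp: C_def)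
        also have "\<dots> \<le> C * (w * u powr (1 - c'))" using w0 c' u0 by (intro mult_left_mono powr_mono) (auto simp: C_def)
        finally show ?thesis .
      qed
      have "\<bar>VF Lam m X \<delta> - \<delta> * main_mult X\<bar> \<le> A * (sqrt \<eta> * \<delta> powr (1 - e) * X powr (2 + 7 * e))"
        unfolding A_def
        by (rule VF_estimate[OF K e \<delta>0 \<delta>1(1) \<delta>X lnX c'(1,2) _ \<eta>4 Y8(1) _ _ _ hypE])
           (use YX Xpos in \<open>auto simp: \<eta>_def y_def C_def\<close>)
      also have "\<dots> \<le> A * ((2 * (X powr (- c / 3) + y powr (2/3))) * (k2 powr (7 * e / B1) * \<delta> powr (1 - \<epsilon>) * X\<^sup>2))"
      proof -
        have "sqrt \<eta> \<le> 2 * (X powr (- c / 3) + y powr (2/3))"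
        proof -
          have "sqrt \<eta> = \<eta> powr (1/2)" by (simp add: powr_half_sqrt \<eta>_def le_max_iff_disj)
          also have "\<dots> \<le> X powr (- c' / 3) + y powr (2/3)"
            by (auto simp: \<eta>_def max_def powr_powr)
          finally have 1: "sqrt \<eta> \<le> X powr (- c' / 3) + y powr (2/3)" .
          have 2: "X powr (- c' / 3) \<le> X powr (- c / 3) + y powr (2/3)"
          proof (cases "c \<le> 2")
            case True thus ?thesis by (simp add: c'_def)
          next
            case False
            have "X powr (- c' / 3) = (1 / X) powr (2/3)" using False Xpos by (simp add: c'_def powr_divide powr_minus field_simps)
            also have "\<dots> \<le> y powr (2/3)" using y Xpos by (intro powr_mono2) auto
            finally show ?thesis by (simp add: add_increasing)
          qed
          define p where "p = X powr (- c / 3)"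
          have "0 \<le> p" by (simp add: p_def)
          thus ?thesis using 1 2 unfolding p_def[symmetric] distrib_left by linarith
        qed
        moreover have "\<delta> powr (1 - e) * X powr (2 + 7 * e) \<le> k2 powr (7 * e / B1) * \<delta> powr (1 - \<epsilon>) * X\<^sup>2"
        proof -
          have "X powr (7 * e) = (X powr (- B1)) powr (- (7 * e / B1))" using B1 by (simp add: powr_powr)
          also have "\<dots> \<le> (\<delta> / k2) powr (- (7 * e / B1))"
            using \<delta> \<delta>0 k e B1 by (intro powr_mono2') (auto simp: field_simps)
          also have "\<dots> = k2 powr (7 * e / B1) * \<delta> powr (- (7 * e / B1))"
            using \<delta>0 k by (simp add: powr_divide powr_minus field_simps)
          finally have "\<delta> powr (1 - e) * X powr (7 * e) \<le> \<delta> powr (1 - e) * (k2 powr (7 * e / B1) * \<delta> powr (- (7 * e / B1)))"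
            by (intro mult_left_mono) auto
          also have "\<dots> = k2 powr (7 * e / B1) * \<delta> powr (1 - e - 7 * e / B1)"
          proof -
            have "\<delta> powr (1 - e) * \<delta> powr (- (7 * e / B1)) = \<delta> powr (1 - e - 7 * e / B1)" by (simp flip: powr_add)
            thus ?thesis by (metis mult.left_commute)
          qed
          also have "\<dots> \<le> k2 powr (7 * e / B1) * \<delta> powr (1 - \<epsilon>)"
            using \<delta>0 \<delta>1 e\<epsilon> by (intro mult_left_mono powr_mono') auto
          finally have "\<delta> powr (1 - e) * X powr (7 * e) * X\<^sup>2 \<le> k2 powr (7 * e / B1) * \<delta> powr (1 - \<epsilon>) * X\<^sup>2"
            by (intro mult_right_mono) auto
          moreover have "X powr (2 + 7 * e) = X powr (7 * e) * X\<^sup>2" using Xpos by (simp add: powr_add powr_numeral)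
          ultimately show ?thesis by (simp add: mult.assoc)
        qed
        ultimately have "sqrt \<eta> * (\<delta> powr (1 - e) * X powr (2 + 7 * e)) \<le>
            (2 * (X powr (- c / 3) + y powr (2/3))) * (k2 powr (7 * e / B1) * \<delta> powr (1 - \<epsilon>) * X\<^sup>2)"
          by (rule mult_mono) auto
        thus ?thesis using A by (intro mult_left_mono) (auto simp: mult.assoc)
      qed
      also have "y powr (2/3) = (\<delta> * X powr B3) powr (- 2 / (3 * B3))"
      proof -
        define q where "q = - 2 / (3 * B3)"
        have q: "- 1 / B3 * (2/3) = q" "B3 * q = - 1 * (2/3)" using B23 by (auto simp: q_def)
        have "y = \<delta> powr (- 1 / B3) * X powr (-1)" using Xpos by (simp add: y_def Y_def powr_minus field_simps)
        hence "y powr (2/3) = (\<delta> powr (- 1 / B3)) powr (2/3) * (X powr (-1)) powr (2/3)" by (simp only: powr_mult)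
        also have "\<dots> = \<delta> powr q * (X powr B3) powr q" unfolding powr_powr q ..
        also have "\<dots> = (\<delta> * X powr B3) powr q" by (simp only: powr_mult)
        finally show ?thesis unfolding q_def .
      qed
      also have "A * ((2 * (X powr (- c / 3) + (\<delta> * X powr B3) powr (- 2 / (3 * B3)))) * (k2 powr (7 * e / B1) * \<delta> powr (1 - \<epsilon>) * X\<^sup>2)) =
         2 * A * k2 powr (7 * e / B1) *
         (\<delta> powr (1 - \<epsilon>) * (X\<^sup>2 * X powr (- c / 3)) + \<delta> powr (1 - \<epsilon>) * X\<^sup>2 * (\<delta> * X powr B3) powr (- 2 / (3 * B3)))"
        by (simp add: algebra_simps)
      also have "X\<^sup>2 * X powr (- c / 3) = X powr (2 - c / 3)"
      proof -
        have "X powr (2 + (- c / 3)) = X powr 2 * X powr (- c / 3)" by (rule powr_add)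
        thus ?thesis using Xpos by (simp add: powr_numeral)
      qed
      finally show ?thesis unfolding eqX .
    qed
    show "\<exists>C X0. \<forall>X\<ge>X0. \<forall>\<delta>. k1 * X powr (- B2) \<le> \<delta> \<and> \<delta> \<le> k2 * X powr (- B1) \<longrightarrow>
       \<bar>VF Lam m X \<delta> - 1/6 * \<delta> * X\<^sup>2 * (3 * ln X - 4 * ln 2)\<bar> \<le> C *
       (\<delta> powr (1 - \<epsilon>) * X powr (2 - c / 3) + \<delta> powr (1 - \<epsilon>) * X\<^sup>2 * (\<delta> * X powr B3) powr (- 2 / (3 * B3)))"
      using main by blast
  qed
qed

end
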